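(* Let $X$ be a bullseye space with basepoint $e$ whose associated sequence $(a_k)_{k\in\mathbb{Z}}\in\{0,1\}^{\mathbb{Z}}$ is rich. Then for each non-principal ultrafilter $\mu$ on $\mathbb{N}$ there exists a set $\mathcal{S}$ of scaling factors with $|\mathcal{S}|=2^{\aleph_0}$ such that for all $\alpha,\alpha'\in\mathcal{S}$ with $\alpha\neq\alpha'$ the spaces $\operatorname{Cone}_\mu(X,e,\alpha)$ and $\operatorname{Cone}_\mu(X,e,\alpha')$ are not homeomorphic.
   Context: A sequence $(a_k)_{k\in\mathbb{Z}}\in\{0,1\}^{\mathbb{Z}}$ is rich if every finite sequence of $0$s and $1$s occurs as a block of consecutive terms in its positive part $(a_k)_{k\in\mathbb{N}}$. Bullseye space associated to $(a_k)_{k\in\mathbb{Z}}\in\{0,1\}^{\mathbb{Z}}$: start with the subset of $\mathbb{R}^2$ consisting of the origin $e$ (the basepoint), all circles of radius $2^k$, $k\in\mathbb{Z}$, centered at the origin, and the whole $x$-axis, seen as the union of two rays from the origin. For each $k\in\mathbb{Z}$ the circles of radii $2^k$ and $2^{k+1}$ cut out an interval on each ray. On one of the two rays put a 2-dimensional closed disc on each such interval, and on the other ray put a 3-dimensional closed ball on each such interval, the sizes and positions being scaled so that the resulting space is invariant under rescaling by powers of $2$. Concretely: fix once and for all a non-degenerate closed segment $S\subset(1,2)$, and for each $k$ glue a Euclidean disc (respectively ball) along one of its diameters to the copy of $2^kS$ in the corresponding interval of the first (respectively second) ray. Finally, for each $k\in\mathbb{Z}$ add the segment $\{0\}\times[2^k,2^{k+1}]$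 of the positive $y$-axis (a bridge) if and only if $a_k=1$. The resulting space is endowed with the path metric. A scaling factor is a sequence $\alpha=(\alpha_n)_{n\in\mathbb{N}}$ of positive real numbers diverging to $+\infty$. For an ultrafilter $\mu$ on $\mathbb{N}$ and a sequence $(x_n)$ in $[0,+\infty]$, $\mu\text{-}\lim x_n$ is the unique $a\in[0,+\infty]$ such that for every neighborhood $U$ of $a$ one has $\{n: x_n\in U\}\in\mu$. For a metric space $(X,d)$ and $e\in X$, $\operatorname{Cone}_\mu(X,e,\alpha)$ is the quotient of $\{(x_n)\in X^{\mathbb{N}}: \mu\text{-}\lim d(x_n,e)/\alpha_n<+\infty\}$ by the relation $(x_n)\approx(y_n)\iff \mu\text{-}\lim d(x_n,y_n)/\alpha_n=0$, with metric $d_\infty([x_n],[y_n])=\mu\text{-}\lim d(x_n,y_n)/\alpha_n$. *)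

theory Defs
  imports "HOL-Analysis.Analysis" "HOL-Library.Equipollence"
begin

definition path_length :: "(real \<Rightarrow> 'a::metric_space) \<Rightarrow> ennreal" where
  "path_length g =
     (SUP ts \<in> {ts. sorted ts \<and> set ts \<subseteq> {0..1}}.
        \<Sum>i<length ts - 1. ennreal (dist (g (ts ! i)) (g (ts ! Suc i))))"

text \<open>\<^const>\<open>enn2real\<close> sends \<open>\<infinity>\<close> to 0, so this is the path metric of \<open>X\<close> only if any two points
  of \<open>X\<close> are joined by a path of finite length inside \<open>X\<close>, which is the case for bullseye spaces.\<close>

definition path_metric :: "'a::metric_space set \<Rightarrow> 'a \<Rightarrow> 'a \<Rightarrow> real" where
  "path_metric X x y =
     enn2real (INF g \<in> {g. path g \<and> path_image g \<subseteq> X \<and> pathstart g = x \<and> pathfinish g = y}.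
                 path_length g)"

definition rich :: "(int \<Rightarrow> nat) \<Rightarrow> bool" where
  "rich a \<longleftrightarrow> (\<forall>w::nat list. set w \<subseteq> {0, 1} \<longrightarrow>
                (\<exists>m::nat. \<forall>i<length w. a (int m + int i) = w ! i))"

text \<open>
  The bullseye space is realised inside four-dimensional Euclidean space with coordinates
  \<open>(x, y, z, w)\<close>; the plane containing the circles and the rays is \<open>z = w = 0\<close>. For \<open>S = {s..t}\<close>
  with \<open>1 < s < t < 2\<close>, the disc with diameter \<open>2\<^sup>k S\<close> on the positive \<open>x\<close>-axis lies in the plane
  \<open>y = w = 0\<close>, and the ball with diameter \<open>-2\<^sup>k S\<close> on the negative \<open>x\<close>-axis lies in the hyperplane
  \<open>y = 0\<close>. Each of them meets the rest of the space exactly in its diameter, so that this union,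
  with its path metric, is the space obtained by gluing along the diameters.
\<close>

type_synonym R4 = "real \<times> real \<times> real \<times> real"

definition bullseye_circle :: "int \<Rightarrow> R4 set" where
  "bullseye_circle k = {(x, y, 0, 0) | x y. x\<^sup>2 + y\<^sup>2 = (2 powi k)\<^sup>2}"

definition bullseye_axis :: "R4 set" where
  "bullseye_axis = {(x, 0, 0, 0) | x. True}"

definition bullseye_disc :: "real \<Rightarrow> real \<Rightarrow> int \<Rightarrow> R4 set" where
  "bullseye_disc s t k =
     {(x, 0, z, 0) | x z.
        (x - 2 powi k * ((s + t) / 2))\<^sup>2 + z\<^sup>2 \<le> (2 powi k * ((t - s) / 2))\<^sup>2}"

definition bullseye_ball :: "real \<Rightarrow> real \<Rightarrow> int \<Rightarrow> R4 set" where
  "bullseye_ball s t k =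
     {(x, 0, z, w) | x z w.
        (x + 2 powi k * ((s + t) / 2))\<^sup>2 + z\<^sup>2 + w\<^sup>2 \<le> (2 powi k * ((t - s) / 2))\<^sup>2}"

definition bullseye_bridge :: "int \<Rightarrow> R4 set" where
  "bullseye_bridge k = {(0, y, 0, 0) | y. 2 powi k \<le> y \<and> y \<le> 2 powi (k + 1)}"

definition bullseye :: "real \<Rightarrow> real \<Rightarrow> (int \<Rightarrow> nat) \<Rightarrow> R4 set" where
  "bullseye s t a =
     bullseye_axis \<union> (\<Union>k. bullseye_circle k) \<union> (\<Union>k. bullseye_disc s t k)
       \<union> (\<Union>k. bullseye_ball s t k) \<union> (\<Union>k\<in>{k. a k = 1}. bullseye_bridge k)"

definition bullseye_basepoint :: R4 where
  "bullseye_basepoint = (0, 0, 0, 0)"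

definition ultrafilter :: "'a filter \<Rightarrow> bool" where
  "ultrafilter F \<longleftrightarrow> F \<noteq> bot \<and> (\<forall>P. eventually P F \<or> eventually (\<lambda>x. \<not> P x) F)"

definition nonprincipal_ultrafilter :: "'a filter \<Rightarrow> bool" where
  "nonprincipal_ultrafilter F \<longleftrightarrow> ultrafilter F \<and> (\<forall>x. F \<noteq> principal {x})"

definition scaling_factor :: "(nat \<Rightarrow> real) \<Rightarrow> bool" where
  "scaling_factor \<alpha> \<longleftrightarrow> (\<forall>n. 0 < \<alpha> n) \<and> filterlim \<alpha> at_top sequentially"

text \<open>Since \<^typ>\<open>ennreal\<close> is compact and Hausdorff, the limit exists and is unique along any
  ultrafilter; convergence along the filter \<open>\<mu>\<close> is exactly \<open>\<mu>\<close>-convergence.\<close>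

definition ultra_dist ::
  "nat filter \<Rightarrow> ('a \<Rightarrow> 'a \<Rightarrow> real) \<Rightarrow> (nat \<Rightarrow> real) \<Rightarrow> (nat \<Rightarrow> 'a) \<Rightarrow> (nat \<Rightarrow> 'a) \<Rightarrow> ennreal" where
  "ultra_dist \<mu> d \<alpha> x y = Lim \<mu> (\<lambda>n. ennreal (d (x n) (y n) / \<alpha> n))"

definition cone_seqs ::
  "nat filter \<Rightarrow> 'a set \<Rightarrow> ('a \<Rightarrow> 'a \<Rightarrow> real) \<Rightarrow> 'a \<Rightarrow> (nat \<Rightarrow> real) \<Rightarrow> (nat \<Rightarrow> 'a) set" where
  "cone_seqs \<mu> X d e \<alpha> = {x. (\<forall>n. x n \<in> X) \<and> ultra_dist \<mu> d \<alpha> x (\<lambda>_. e) < \<infinity>}"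

definition cone_rel ::
  "nat filter \<Rightarrow> 'a set \<Rightarrow> ('a \<Rightarrow> 'a \<Rightarrow> real) \<Rightarrow> 'a \<Rightarrow> (nat \<Rightarrow> real) \<Rightarrow> ((nat \<Rightarrow> 'a) \<times> (nat \<Rightarrow> 'a)) set"
  where
  "cone_rel \<mu> X d e \<alpha> =
     {(x, y). x \<in> cone_seqs \<mu> X d e \<alpha> \<and> y \<in> cone_seqs \<mu> X d e \<alpha> \<and> ultra_dist \<mu> d \<alpha> x y = 0}"

definition cone ::
  "nat filter \<Rightarrow> 'a set \<Rightarrow> ('a \<Rightarrow> 'a \<Rightarrow> real) \<Rightarrow> 'a \<Rightarrow> (nat \<Rightarrow> real) \<Rightarrow> (nat \<Rightarrow> 'a) set set" where
  "cone \<mu> X d e \<alpha> = cone_seqs \<mu> X d e \<alpha> // cone_rel \<mu> X d e \<alpha>"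

text \<open>The value does not depend on the chosen representatives.\<close>

definition cone_dist ::
  "nat filter \<Rightarrow> ('a \<Rightarrow> 'a \<Rightarrow> real) \<Rightarrow> (nat \<Rightarrow> real) \<Rightarrow> (nat \<Rightarrow> 'a) set \<Rightarrow> (nat \<Rightarrow> 'a) set \<Rightarrow> real" where
  "cone_dist \<mu> d \<alpha> A B = enn2real (ultra_dist \<mu> d \<alpha> (SOME x. x \<in> A) (SOME y. y \<in> B))"

definition cone_topology ::
  "nat filter \<Rightarrow> 'a set \<Rightarrow> ('a \<Rightarrow> 'a \<Rightarrow> real) \<Rightarrow> 'a \<Rightarrow> (nat \<Rightarrow> real) \<Rightarrow> (nat \<Rightarrow> 'a) set topology" where
  "cone_topology \<mu> X d e \<alpha> = Metric_space.mtopology (cone \<mu> X d e \<alpha>) (cone_dist \<mu> d \<alpha>)"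

end

theory Submission
  imports Defs
begin

text \<open>
  If \<open>a (k + m\<^sub>n) = b k\<close> eventually holds along \<open>\<mu>\<close> for every \<open>k\<close>, then the cone along the scaling
  factor \<open>2\<^bsup>m\<^sub>n\<^esup>\<close> is homeomorphic to the bullseye space of \<open>b\<close>: a sequence \<open>(x\<^sub>n)\<close> is sent to the limit of
  \<open>x\<^sub>n / 2\<^bsup>m\<^sub>n\<^esup>\<close>, and points sufficiently close to a point \<open>p \<noteq> 0\<close> lie together with \<open>p\<close> in one of finitely
  many pieces, on each of which the path metric is Lipschitz equivalent to the Euclidean one. Richness
  provides such \<open>m\<^sub>n\<close> for every \<open>b\<close>.

  The sequence \<open>b\<close> is then partly recovered from the topology. The branch points (other than possibly the
  origin) are \<open>(\<plusminus>2\<^sup>k, 0)\<close>, and \<open>(0, 2\<^sup>k)\<close> when a bridge ends there. Joining two branch points if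
  they lie in the closure of a connected set without branch points gives a graph whose triangles are
  the levels \<open>k\<close> touched by a bridge, and two triangles are joined by three edges exactly if there is a
  bridge between them. So the lengths of the maximal runs of ones in \<open>b\<close> are topological invariants, and
  every set of positive run lengths occurs. The discs and balls play no role in this invariant.
\<close>

section \<open>Path lengths and path metrics\<close>

text \<open>The limit space never gets a path metric: \<open>bullseye s t b\<close> is used with its
  Euclidean subspace topology. The cone distance bounds the Euclidean distance of limit points from
  above globally, and near each point it is at most 10 times that distance. Infinitely many circles
  accumulate at the origin, where finitely many pieces no longer suffice, so the estimate there
  comes from explicit routes to the origin. Whether the origin is a branch point is left open. This
  does no harm: a connected set without branch points that contains a nonzero point stays on one
  circle, or within one level of a ray or of the bridges. Its closure misses the origin, so the
  origin is adjacent to nothing. The position of a run inside the sequence is not visible to the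
  invariant, so information is stored in the set of run lengths. Every subset of the naturals can be
  encoded in this way, which is where the cardinality of the continuum comes from.\<close>

fun chain_length :: "(real \<Rightarrow> 'a::metric_space) \<Rightarrow> real list \<Rightarrow> real" where
  "chain_length g (t # u # ts) = dist (g t) (g u) + chain_length g (u # ts)"
| "chain_length g _ = 0"

lemma chain_length_nonneg: "0 \<le> chain_length g ts"
  by (induction g ts rule: chain_length.induct) auto

text \<open>Recursion on the partition replaces the indexed sum of \<open>path_length\<close>, so
  that splitting, refining and reversing partitions become inductions over lists.\<close>

lemma sum_eq_chain_length:
  "(\<Sum>i<length ts - 1. ennreal (dist (g (ts ! i)) (g (ts ! Suc i)))) = ennreal (chain_length g ts)"
proof (induction g ts rule: chain_length.induct)
  case (1 g t u ts)
  have "(\<Sum>i<length (t # u # ts) - 1. ennreal (dist (g ((t # u # ts) ! i)) (g ((t # u # ts) ! Suc i))))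
    = ennreal (dist (g t) (g u)) +
      (\<Sum>i<length (u # ts) - 1. ennreal (dist (g ((u # ts) ! i)) (g ((u # ts) ! Suc i))))"
    by (simp add: sum.lessThan_Suc_shift del: sum.lessThan_Suc)
  also have "\<dots> = ennreal (chain_length g (t # u # ts))"
    unfolding 1 by (simp add: ennreal_plus chain_length_nonneg)
  finally show ?case .
qed auto

lemma path_length_eq_SUP_chain:
  "path_length g = (SUP ts \<in> {ts. sorted ts \<and> set ts \<subseteq> {0..1}}. ennreal (chain_length g ts))"
  unfolding path_length_def sum_eq_chain_length ..

lemma chain_length_append:
  "chain_length g (xs @ c # ys) = chain_length g (xs @ [c]) + chain_length g (c # ys)"
  by (induction g xs rule: chain_length.induct) auto

text \<open>By the triangle inequality at \<open>c\<close>. It allows the junction time 1/2 to be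
  inserted into an arbitrary partition of a joined path.\<close>

lemma chain_length_insert: "chain_length g (xs @ ys) \<le> chain_length g (xs @ c # ys)"
proof (induction g xs rule: chain_length.induct)
  case ("2_1" g)
  show ?case by (cases ys) auto
next
  case ("2_2" g v)
  show ?case
  proof (cases ys)
    case (Cons a list)
    then show ?thesis using dist_triangle[of "g v" "g a" "g c"] by simp
  qed auto
qed auto

lemma chain_length_cong:
  "(\<And>t. t \<in> set ts \<Longrightarrow> g t = h (f t)) \<Longrightarrow> chain_length g ts = chain_length h (map f ts)"
  by (induction g ts rule: chain_length.induct) auto

lemma chain_length_rev: "chain_length g (rev ts) = chain_length g ts"
proof (induction g ts rule: chain_length.induct)
  case (1 g t u ts)
  have "chain_length g (rev (t # u # ts)) = chain_length g (rev ts @ u # [t])" by simp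
  also have "\<dots> = chain_length g (rev (u # ts)) + dist (g t) (g u)"
    by (subst chain_length_append) (simp add: dist_commute)
  finally show ?case using 1 by simp
qed auto

text \<open>The increments of a sorted partition telescope.\<close>

lemma chain_length_Lipschitz:
  assumes L: "\<And>t u. t \<in> {0..1} \<Longrightarrow> u \<in> {0..1} \<Longrightarrow> dist (g t) (g u) \<le> L * \<bar>t - u\<bar>"
    and "sorted ts" "set ts \<subseteq> {0..1}" "ts \<noteq> []"
  shows "chain_length g ts \<le> L * (last ts - hd ts)"
  using assms(2-4)
proof (induction ts rule: induct_list012)
  case (3 t u ts)
  have "dist (g t) (g u) \<le> L * (u - t)"
    using L[of t u] 3 by (simp add: abs_minus_commute)
  moreover have "chain_length g (u # ts) \<le> L * (last (u # ts) - u)" using 3 by simp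
  ultimately show ?case by (simp add: algebra_simps)
qed auto

lemma path_length_Lipschitz:
  assumes "\<And>t u. t \<in> {0..1} \<Longrightarrow> u \<in> {0..1} \<Longrightarrow> dist (g t) (g u) \<le> L * \<bar>t - u\<bar>"
  shows "path_length g \<le> ennreal L"
  unfolding path_length_eq_SUP_chain
proof (intro SUP_least ennreal_leI)
  fix ts :: "real list" assume ts: "ts \<in> {ts. sorted ts \<and> set ts \<subseteq> {0..1}}"
  have L: "0 \<le> L" using assms[of 0 1] by (simp add: order_trans[OF zero_le_dist])
  show "chain_length g ts \<le> L"
  proof (cases "ts = []")
    case False
    have "last ts \<in> set ts" "hd ts \<in> set ts" using False by auto
    then have "last ts \<in> {0..1}" "hd ts \<in> {0..1}" using ts by blast+
    then have "L * (last ts - hd ts) \<le> L * 1" using L by (intro mult_left_mono) auto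
    then show ?thesis using chain_length_Lipschitz[of g L ts] assms ts False by fastforce
  qed (use L in auto)
qed

lemma path_length_ge_dist: "ennreal (dist (pathstart g) (pathfinish g)) \<le> path_length g"
  unfolding path_length_eq_SUP_chain
  by (rule SUP_upper2[of "[0, 1]"]) (auto simp: pathstart_def pathfinish_def)

lemma path_length_reversepath_le: "path_length (reversepath g) \<le> path_length g"
proof (subst path_length_eq_SUP_chain, rule SUP_least)
  fix ts :: "real list" assume ts: "ts \<in> {ts. sorted ts \<and> set ts \<subseteq> {0..1}}"
  have "chain_length (reversepath g) ts = chain_length g (map (\<lambda>t. 1 - t) ts)"
    by (rule chain_length_cong) (simp add: reversepath_def)
  also have "\<dots> = chain_length g (rev (map (\<lambda>t. 1 - t) ts))" by (simp add: chain_length_rev)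
  finally have "chain_length (reversepath g) ts = chain_length g (rev (map (\<lambda>t. 1 - t) ts))" .
  moreover have "sorted (rev (map (\<lambda>t. 1 - t) ts))"
    using ts by (auto simp: sorted_wrt_map sorted_wrt_rev)
  moreover have "set (rev (map (\<lambda>t. 1 - t) ts)) \<subseteq> {0..1}" using ts by auto
  ultimately show "ennreal (chain_length (reversepath g) ts) \<le> path_length g"
    unfolding path_length_eq_SUP_chain by (auto intro!: SUP_upper2)
qed

lemma path_length_joinpaths_le:
  assumes "pathfinish g = pathstart h"
  shows "path_length (g +++ h) \<le> path_length g + path_length h"
proof (subst path_length_eq_SUP_chain, rule SUP_least)
  fix ts :: "real list" assume ts: "ts \<in> {ts. sorted ts \<and> set ts \<subseteq> {0..1}}"
  \<comment> \<open>Since \<open>ts\<close> is sorted, this cuts the partition at the junction time;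
    1/2 is then added to both halves.\<close>
  define us where "us = takeWhile (\<lambda>t. t \<le> 1/2) ts"
  define vs where "vs = dropWhile (\<lambda>t. t \<le> 1/2) ts"
  have split: "ts = us @ vs" by (simp add: us_def vs_def)
  have sorted: "sorted us" "sorted vs"
    using ts split by (auto simp: sorted_append)
  have us: "set us \<subseteq> {0..1/2}" using ts by (auto simp: us_def dest!: set_takeWhileD)
  have vs: "set vs \<subseteq> {1/2..1}"
  proof
    fix v assume v: "v \<in> set vs"
    then have ne: "vs \<noteq> []" by auto
    then have "hd vs > 1/2" unfolding vs_def using hd_dropWhile[of "\<lambda>t. t \<le> 1/2" ts] by simp
    moreover have "hd vs \<le> v" using sorted v ne by (cases vs) auto
    ultimately show "v \<in> {1/2..1}" using ts split v by auto
  qed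
  define us' where "us' = map (\<lambda>t. 2 * t) (us @ [1/2])"
  define vs' where "vs' = map (\<lambda>t. 2 * t - 1) (1/2 # vs)"
  have "chain_length (g +++ h) (us @ [1/2]) = chain_length g us'"
    unfolding us'_def by (rule chain_length_cong) (use us in \<open>auto simp: joinpaths_def\<close>)
  \<comment> \<open>At 1/2 the joined path is given by the branch of \<open>g\<close>; the matching
    endpoints make \<open>h\<close> agree there, so 1/2 may also head the second half.\<close>
  moreover have half: "(g +++ h) (1/2) = h 0"
    using assms by (simp add: joinpaths_def pathstart_def pathfinish_def)
  moreover have "chain_length (g +++ h) (1/2 # vs) = chain_length h vs'"
    unfolding vs'_def
  proof (rule chain_length_cong)
    fix t assume "t \<in> set (1/2 # vs)"
    then have "t \<ge> 1/2" using vs by auto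
    then show "(g +++ h) t = h (2 * t - 1)"
    proof (cases "t = 1/2")
      case True
      show ?thesis unfolding True using half by simp
    qed (simp add: joinpaths_def)
  qed
  ultimately have "chain_length (g +++ h) ts \<le> chain_length g us' + chain_length h vs'"
    using chain_length_insert[of "g +++ h" us vs "1/2"]
      chain_length_append[of "g +++ h" us "1/2" vs] split by simp
  then have "ennreal (chain_length (g +++ h) ts)
    \<le> ennreal (chain_length g us') + ennreal (chain_length h vs')"
    by (simp add: chain_length_nonneg flip: ennreal_plus)
  also have "\<dots> \<le> path_length g + path_length h"
  proof (rule add_mono)
    show "ennreal (chain_length g us') \<le> path_length g"
      unfolding path_length_eq_SUP_chain
      by (rule SUP_upper) (use us sorted in \<open>auto simp: us'_def sorted_append sorted_wrt_map\<close>)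
    show "ennreal (chain_length h vs') \<le> path_length h"
      unfolding path_length_eq_SUP_chain
      by (rule SUP_upper) (use vs sorted in \<open>auto simp: vs'_def sorted_wrt_map\<close>)
  qed
  finally show "ennreal (chain_length (g +++ h) ts) \<le> path_length g + path_length h" .
qed

text \<open>The infimum is kept in \<open>ennreal\<close>, where symmetry and the triangle
  inequality hold for every set. \<open>enn2real\<close> sends infinity to 0, so the real-valued
  \<open>path_metric\<close> inherits them only after finiteness has been shown.\<close>

definition path_edist :: "'a::metric_space set \<Rightarrow> 'a \<Rightarrow> 'a \<Rightarrow> ennreal" where
  "path_edist X x y =
     (INF g \<in> {g. path g \<and> path_image g \<subseteq> X \<and> pathstart g = x \<and> pathfinish g = y}. path_length g)"

lemma path_metric_eq_path_edist: "path_metric X x y = enn2real (path_edist X x y)"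
  by (simp add: path_metric_def path_edist_def)

lemma path_edist_ge_dist: "ennreal (dist x y) \<le> path_edist X x y"
  unfolding path_edist_def by (intro INF_greatest) (use path_length_ge_dist in blast)

lemma path_edist_le_commute: "path_edist X x y \<le> path_edist X y x"
  unfolding path_edist_def
  by (rule INF_mono, rule_tac x="reversepath m" in bexI) (auto simp: path_length_reversepath_le)

lemma path_edist_commute: "path_edist X x y = path_edist X y x"
  by (intro antisym path_edist_le_commute)

lemma path_edist_triangle: "path_edist X x z \<le> path_edist X x y + path_edist X y z"
proof -
  let ?P = "\<lambda>x y. {g. path g \<and> path_image g \<subseteq> X \<and> pathstart g = x \<and> pathfinish g = y}"
  have join: "path_edist X x z \<le> path_length g + path_length h" if "g \<in> ?P x y" "h \<in> ?P y z" for g h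
    unfolding path_edist_def
    by (rule INF_lower2[of "g +++ h"])
      (use that in \<open>auto simp: path_length_joinpaths_le path_image_join\<close>)
  show ?thesis
  proof (rule ennreal_le_epsilon)
    fix \<epsilon> :: real
    assume fin: "path_edist X x y + path_edist X y z < top" and \<epsilon>: "0 < \<epsilon>"
    have "path_edist X x y < path_edist X x y + ennreal (\<epsilon> / 2)"
      "path_edist X y z < path_edist X y z + ennreal (\<epsilon> / 2)"
      using fin \<epsilon> by (auto simp: ennreal_less_zero_iff less_top[symmetric])
    then obtain g h where g: "g \<in> ?P x y" "path_length g < path_edist X x y + ennreal (\<epsilon> / 2)"
      and h: "h \<in> ?P y z" "path_length h < path_edist X y z + ennreal (\<epsilon> / 2)"
      unfolding path_edist_def INF_less_iff by blast
    have "path_edist X x z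
        \<le> (path_edist X x y + ennreal (\<epsilon> / 2)) + (path_edist X y z + ennreal (\<epsilon> / 2))"
      using join[OF g(1) h(1)] g(2) h(2) by (meson add_mono order.trans less_imp_le)
    also have "\<dots> = path_edist X x y + path_edist X y z + (ennreal (\<epsilon> / 2) + ennreal (\<epsilon> / 2))"
      by (simp add: ac_simps)
    also have "ennreal (\<epsilon> / 2) + ennreal (\<epsilon> / 2) = ennreal \<epsilon>"
      using \<epsilon> by (simp flip: ennreal_plus)
    finally show "path_edist X x z \<le> path_edist X x y + path_edist X y z + ennreal \<epsilon>" .
  qed
qed

text \<open>Direct upper bounds on path distances are obtained here, from explicit curves: segments
  inside convex pieces, and projected chords on circles.\<close>

lemma path_edist_Lipschitz:
  assumes "\<And>t u. t \<in> {0..1} \<Longrightarrow> u \<in> {0..1} \<Longrightarrow> dist (g t) (g u) \<le> L * \<bar>t - u\<bar>"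
    and "g ` {0..1} \<subseteq> X"
  shows "path_edist X (g 0) (g 1) \<le> ennreal L"
proof -
  have "0 \<le> L" using assms(1)[of 0 1] by (simp add: order_trans[OF zero_le_dist])
  then have "L-lipschitz_on {0..1} g"
    by (intro lipschitz_onI) (use assms(1) in \<open>auto simp: dist_real_def\<close>)
  then have "path g" by (simp add: path_def lipschitz_on_continuous_on)
  then have "path_edist X (g 0) (g 1) \<le> path_length g"
    unfolding path_edist_def
    by (intro INF_lower) (use assms(2) in \<open>auto simp: path_image_def pathstart_def pathfinish_def\<close>)
  then show ?thesis using path_length_Lipschitz[of g L] assms(1) by force
qed

lemma path_edist_segment:
  fixes x y :: "'a::real_normed_vector"
  assumes "closed_segment x y \<subseteq> X"
  shows "path_edist X x y \<le> ennreal (norm (x - y))"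
proof -
  have "dist (linepath x y t) (linepath x y u) \<le> norm (x - y) * \<bar>t - u\<bar>" for t u
  proof -
    have "linepath x y t - linepath x y u = (u - t) *\<^sub>R (x - y)"
      by (simp add: linepath_def algebra_simps)
    then show ?thesis by (simp add: dist_norm abs_minus_commute mult.commute)
  qed
  moreover have "linepath x y ` {0..1} \<subseteq> X"
    using assms by (metis path_image_def path_image_linepath)
  ultimately show ?thesis
    using path_edist_Lipschitz[of "linepath x y" "norm (x - y)" X] by (simp add: linepath_def)
qed

section \<open>Metric geometry of bullseye spaces\<close>

lemma norm_R4: "norm (x, y, z, w) = sqrt (x\<^sup>2 + y\<^sup>2 + z\<^sup>2 + w\<^sup>2)" for x y z w :: real
  by (simp add: norm_Pair power2_eq_square algebra_simps)

lemma norm_R4_sq: "(norm (x, y, z, w))\<^sup>2 = x\<^sup>2 + y\<^sup>2 + z\<^sup>2 + w\<^sup>2" for x y z w :: real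
  by (simp add: norm_R4)

lemma mem_bullseye_circle:
  "(x, y, z, w) \<in> bullseye_circle k \<longleftrightarrow> z = 0 \<and> w = 0 \<and> norm (x, y, z, w) = 2 powi k"
proof -
  have "norm (x, y, z, w) = 2 powi k \<longleftrightarrow> (norm (x, y, z, w))\<^sup>2 = (2 powi k)\<^sup>2"
    by (simp add: power2_eq_iff_nonneg)
  then show ?thesis by (auto simp: bullseye_circle_def norm_R4_sq)
qed

lemma mem_bullseye_axis: "(x, y, z, w) \<in> bullseye_axis \<longleftrightarrow> y = 0 \<and> z = 0 \<and> w = 0"
  by (auto simp: bullseye_axis_def)

lemma mem_bullseye_bridge:
  "(x, y, z, w) \<in> bullseye_bridge k
    \<longleftrightarrow> x = 0 \<and> z = 0 \<and> w = 0 \<and> 2 powi k \<le> y \<and> y \<le> 2 powi (k + 1)"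
  by (auto simp: bullseye_bridge_def)

abbreviation disc_centre :: "real \<Rightarrow> real \<Rightarrow> int \<Rightarrow> R4" where
  "disc_centre s t k \<equiv> (2 powi k * ((s + t) / 2), 0, 0, 0)"

text \<open>As a slice of a Euclidean ball by a linear subspace, the disc inherits convexity,
  closedness and the norm bounds. The hypothesis makes the radius nonnegative, so that comparing
  squares is comparing distances.\<close>

lemma bullseye_disc_eq_cball:
  assumes "s \<le> t"
  shows "bullseye_disc s t k
    = cball (disc_centre s t k) (2 powi k * ((t - s) / 2)) \<inter> {p. fst (snd p) = 0 \<and> snd (snd (snd p)) = 0}"
proof -
  have "dist (disc_centre s t k) (x, y, z, w) \<le> 2 powi k * ((t - s) / 2) \<longleftrightarrow>
    (x - 2 powi k * ((s + t) / 2))\<^sup>2 + y\<^sup>2 + z\<^sup>2 + w\<^sup>2 \<le> (2 powi k * ((t - s) / 2))\<^sup>2" for x y z w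
  proof -
    have "0 \<le> 2 powi k * ((t - s) / 2)" using assms by simp
    then have "dist (disc_centre s t k) (x, y, z, w) \<le> 2 powi k * ((t - s) / 2) \<longleftrightarrow>
      (norm ((x, y, z, w) - (disc_centre s t k)))\<^sup>2 \<le> (2 powi k * ((t - s) / 2))\<^sup>2"
      by (subst dist_commute) (simp only: dist_norm power_mono_iff norm_ge_zero zero_less_numeral)
    then show ?thesis by (simp add: norm_R4_sq)
  qed
  then show ?thesis by (auto simp: bullseye_disc_def)
qed

lemma bullseye_ball_eq_cball:
  assumes "s \<le> t"
  shows "bullseye_ball s t k
    = cball (- disc_centre s t k) (2 powi k * ((t - s) / 2)) \<inter> {p. fst (snd p) = 0}"
proof -
  have "dist (- disc_centre s t k) (x, y, z, w) \<le> 2 powi k * ((t - s) / 2) \<longleftrightarrow>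
    (x + 2 powi k * ((s + t) / 2))\<^sup>2 + y\<^sup>2 + z\<^sup>2 + w\<^sup>2 \<le> (2 powi k * ((t - s) / 2))\<^sup>2" for x y z w
  proof -
    have "0 \<le> 2 powi k * ((t - s) / 2)" using assms by simp
    then have "dist (- disc_centre s t k) (x, y, z, w) \<le> 2 powi k * ((t - s) / 2) \<longleftrightarrow>
      (norm ((x, y, z, w) - (- disc_centre s t k)))\<^sup>2 \<le> (2 powi k * ((t - s) / 2))\<^sup>2"
      by (subst dist_commute) (simp only: dist_norm power_mono_iff norm_ge_zero zero_less_numeral)
    then show ?thesis by (simp add: norm_R4_sq)
  qed
  then show ?thesis by (auto simp: bullseye_ball_def)
qed

lemma convex_bullseye_pieces:
  "convex bullseye_axis" "convex (bullseye_bridge k)"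
  "s \<le> t \<Longrightarrow> convex (bullseye_disc s t k)" "s \<le> t \<Longrightarrow> convex (bullseye_ball s t k)"
proof -
  show "convex bullseye_axis"
    by (auto simp: convex_alt bullseye_axis_def)
  have "bullseye_bridge k = {0} \<times> {2 powi k..2 powi (k + 1)} \<times> {0}"
    by (auto simp: bullseye_bridge_def zero_prod_def)
  then show "convex (bullseye_bridge k)" by (simp add: convex_Times)
  have "convex {p::R4. fst (snd p) = 0 \<and> snd (snd (snd p)) = 0}" "convex {p::R4. fst (snd p) = 0}"
    by (auto simp: convex_alt)
  then show "s \<le> t \<Longrightarrow> convex (bullseye_disc s t k)" "s \<le> t \<Longrightarrow> convex (bullseye_ball s t k)"
    by (auto simp: bullseye_disc_eq_cball bullseye_ball_eq_cball intro!: convex_Int)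
qed

lemma closed_bullseye_pieces:
  "closed bullseye_axis" "closed (bullseye_bridge k)" "closed (bullseye_circle k)"
  "s \<le> t \<Longrightarrow> closed (bullseye_disc s t k)" "s \<le> t \<Longrightarrow> closed (bullseye_ball s t k)"
proof -
  have "bullseye_axis = {p. snd p = 0}"
    by (auto simp: bullseye_axis_def zero_prod_def)
  moreover have "closed {p::R4. snd p = 0}" by (intro closed_Collect_eq continuous_intros)
  ultimately show "closed bullseye_axis" by simp
  have "bullseye_bridge k = {0} \<times> {2 powi k..2 powi (k + 1)} \<times> {0}"
    by (auto simp: bullseye_bridge_def zero_prod_def)
  then show "closed (bullseye_bridge k)" by (simp add: closed_Times)
  have "bullseye_circle k = {p. norm p = 2 powi k} \<inter> {p. snd (snd p) = 0}"
    by (auto simp: mem_bullseye_circle zero_prod_def)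
  then show "closed (bullseye_circle k)"
    by (auto intro!: closed_Collect_eq continuous_intros closed_Int)
  have "closed ({p::R4. fst (snd p) = 0} \<inter> {p. snd (snd (snd p)) = 0})" "closed {p::R4. fst (snd p) = 0}"
    by (auto intro!: closed_Collect_eq continuous_intros closed_Int)
  then show "s \<le> t \<Longrightarrow> closed (bullseye_disc s t k)" "s \<le> t \<Longrightarrow> closed (bullseye_ball s t k)"
    by (auto simp: bullseye_disc_eq_cball bullseye_ball_eq_cball Int_def[symmetric] Collect_conj_eq intro!: closed_Int)
qed

text \<open>The pieces attached to level \<open>k\<close>; the axis stays separate because it runs
  through all levels and is convex as a whole. The set depends on the sequence only through
  \<open>a k\<close>, so agreement at one index transfers every piece of that level.\<close>

definition level_pieces :: "real \<Rightarrow> real \<Rightarrow> (int \<Rightarrow> nat) \<Rightarrow> int \<Rightarrow> R4 set set" where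
  "level_pieces s t a k =
     {bullseye_circle k, bullseye_disc s t k, bullseye_ball s t k} \<union> (if a k = 1 then {bullseye_bridge k} else {})"

lemma bullseye_eq_pieces:
  "bullseye s t a = bullseye_axis \<union> (\<Union>k. \<Union>(level_pieces s t a k))"
  by (auto simp: bullseye_def level_pieces_def split: if_splits)

section \<open>Levels between consecutive powers of two\<close>

lemma powi2_less_iff: "(2::real) powi i < 2 powi j \<longleftrightarrow> i < j"
  by (metis linorder_neq_iff one_less_numeral_iff order_less_imp_not_less
      power_int_strict_increasing semiring_norm(76))

lemma powi2_le_iff: "(2::real) powi i \<le> 2 powi j \<longleftrightarrow> i \<le> j"
  by (simp add: powi2_less_iff flip: not_less)

lemma powi2_between:
  assumes "(2::real) powi (k - 1) < 2 powi j" "(2::real) powi j < 2 powi (k + 1)"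
  shows "j = k"
  using assms by (simp add: powi2_less_iff)

lemma powi2_not_between: "2 powi k < (2::real) powi j \<Longrightarrow> (2::real) powi j < 2 powi (k + 1) \<Longrightarrow> False"
  by (simp add: powi2_less_iff)

lemma powi2_eq_iff: "(2::real) powi i = 2 powi j \<longleftrightarrow> i = j"
  by (metis powi2_less_iff linorder_neq_iff)

lemma powi2_step: "(2::real) powi (k - 1) < 2 powi k" "(2::real) powi k < 2 powi (k + 1)"
  by (simp_all add: powi2_less_iff)

lemma powi2_level:
  assumes "0 < (r::real)"
  shows "\<exists>k. r = 2 powi k \<or> 2 powi k < r \<and> r < 2 powi (k + 1)"
proof -
  define k where "k = \<lfloor>log 2 r\<rfloor>"
  have "2 powr (real_of_int k) \<le> r" "r < 2 powr (real_of_int (k + 1))"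
    using assms by (auto simp: k_def powr_le_iff less_powr_iff)
  then have "2 powi k \<le> r" "r < 2 powi (k + 1)"
    by (simp_all add: powr_real_of_int' del: of_int_add)
  then show ?thesis by (intro exI[of _ k]) auto
qed

lemma powi2_same_level:
  assumes "2 powi j < r" "r < 2 powi (j + 1)" "2 powi k < r" "r < (2::real) powi (k + 1)"
  shows "j = k"
proof -
  have "(2::real) powi j < 2 powi (k + 1)" "(2::real) powi k < 2 powi (j + 1)" using assms by linarith+
  then show ?thesis by (simp add: powi2_less_iff)
qed

lemma powi_Suc_real: "2 powi (k + 1) = 2 * (2 powi k :: real)"
  by (simp add: power_int_add)

text \<open>The curve is the radial projection of the chord. A nonnegative inner product keeps the
  chord at distance at least \<open>r / 2\<close> from the centre, where the projection is Lipschitz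
  with constant 4.\<close>

lemma path_edist_circle:
  assumes "p \<in> bullseye_circle k" "q \<in> bullseye_circle k" "0 \<le> inner p q"
    and "bullseye_circle k \<subseteq> X"
  shows "path_edist X p q \<le> ennreal (4 * norm (p - q))"
proof -
  define r :: real where "r = 2 powi k"
  have r: "0 < r" by (simp add: r_def)
  have pq: "snd (snd p) = 0" "snd (snd q) = 0" "norm p = r" "norm q = r"
    using assms by (cases p; cases q; auto simp: mem_bullseye_circle r_def zero_prod_def)+
  define l where "l = linepath p q"
  have l_ge: "r / 2 \<le> norm (l u)" if "u \<in> {0..1}" for u
  proof -
    have "(norm (l u))\<^sup>2 = (1 - u)\<^sup>2 * r\<^sup>2 + u\<^sup>2 * r\<^sup>2 + 2 * (u * (1 - u)) * inner p q"
      unfolding l_def linepath_def power2_norm_eq_inner inner_simps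
      using pq by (simp add: inner_commute dot_square_norm power2_eq_square algebra_simps)
    also have "\<dots> \<ge> (1 - u)\<^sup>2 * r\<^sup>2 + u\<^sup>2 * r\<^sup>2" using that assms(3) by simp
    \<comment> \<open>Completing the square about the midpoint of the chord: the coefficient is 1/2
      plus a square, and half of that 1/2 is set aside.\<close>
    also have "(1 - u)\<^sup>2 * r\<^sup>2 + u\<^sup>2 * r\<^sup>2 = (r / 2)\<^sup>2 + (1/4 + 2 * (u - 1/2)\<^sup>2) * r\<^sup>2"
      by (simp add: power2_eq_square algebra_simps)
    also have "\<dots> \<ge> (r / 2)\<^sup>2" by simp
    finally show ?thesis using r by (simp add: power2_le_iff_abs_le)
  qed
  define g where "g u = (r / norm (l u)) *\<^sub>R l u" for u
  have "path_edist X (g 0) (g 1) \<le> ennreal (4 * norm (p - q))"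
  proof (rule path_edist_Lipschitz)
    fix u v :: real assume uv: "u \<in> {0..1}" "v \<in> {0..1}"
    let ?U = "norm (l u)" and ?V = "norm (l v)"
    have U: "r / 2 \<le> ?U" "0 < ?U" and V: "0 < ?V" using l_ge[OF uv(1)] l_ge[OF uv(2)] r by linarith+
    \<comment> \<open>Splits the difference into a change of position and a change of length. Each
      part is at most \<open>r / ?U\<close> times the distance on the chord, and
      \<open>r / ?U\<close> is at most 2.\<close>
    have "g u - g v = (r / ?U) *\<^sub>R (l u - l v) + (r / ?U * ((?V - ?U) / ?V)) *\<^sub>R l v"
      using U V unfolding g_def by (simp add: algebra_simps divide_simps flip: scaleR_add_left scaleR_diff_left)
    then have "norm (g u - g v) \<le> r / ?U * norm (l u - l v) + r / ?U * (\<bar>?V - ?U\<bar> / ?V) * ?V"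
      using U V r by (simp add: norm_triangle_le abs_mult)
    also have "r / ?U * (\<bar>?V - ?U\<bar> / ?V) * ?V = r / ?U * \<bar>?V - ?U\<bar>" using V by simp
    also have "r / ?U * norm (l u - l v) + r / ?U * \<bar>?V - ?U\<bar>
        \<le> r / ?U * norm (l u - l v) + r / ?U * norm (l u - l v)"
      using U r norm_triangle_ineq3[of "l v" "l u"]
      by (intro add_left_mono mult_left_mono) (auto simp: norm_minus_commute)
    also have "\<dots> = 2 * (r / ?U) * norm (l u - l v)" by simp
    also have "\<dots> \<le> 4 * norm (l u - l v)"
      using U r by (intro mult_right_mono) (auto simp: field_simps)
    also have "l u - l v = (v - u) *\<^sub>R (p - q)" by (simp add: l_def linepath_def algebra_simps)
    finally show "dist (g u) (g v) \<le> 4 * norm (p - q) * \<bar>u - v\<bar>"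
      by (simp add: dist_norm mult.commute mult.left_commute abs_minus_commute)
  next
    have "g u \<in> bullseye_circle k" if "u \<in> {0..1}" for u
    proof -
      have "0 < norm (l u)" using l_ge[OF that] r by linarith
      then have "norm (g u) = r" using r by (simp add: g_def)
      moreover have "snd (snd (g u)) = 0" using pq by (simp add: g_def l_def linepath_def)
      ultimately show ?thesis
        by (cases "g u") (auto simp: mem_bullseye_circle r_def zero_prod_def)
    qed
    then show "g ` {0..1} \<subseteq> X" using assms(4) by auto
  qed
  moreover have "g 0 = p" "g 1 = q" using pq r by (simp_all add: g_def l_def linepath_def)
  ultimately show ?thesis by simp
qed

lemma path_edist_convex:
  assumes "convex Q" "Q \<subseteq> X" "p \<in> Q" "q \<in> Q"
  shows "path_edist X p q \<le> ennreal (norm (p - q))"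
  using assms by (intro path_edist_segment) (meson closed_segment_subset order_trans)

context
  fixes s t :: real
  assumes st: "1 < s" "s < t" "t < 2"
begin

text \<open>Everything follows from the distance to the centre, by projection to the first
  coordinate and by the reverse triangle inequality. As \<open>1 < s\<close> and
  \<open>t < 2\<close>, the disc lies strictly between the two circles of its level.\<close>

lemma mem_disc_bounds:
  assumes "(x, y, z, w) \<in> bullseye_disc s t k"
  shows "y = 0" "w = 0" "2 powi k * s \<le> x" "x \<le> 2 powi k * t"
    and "2 powi k * s \<le> norm (x, y, z, w)" "norm (x, y, z, w) \<le> 2 powi k * t"
proof -
  let ?c = "disc_centre s t k" and ?p = "(x, y, z, w)" and ?r = "2 powi k * ((t - s) / 2)"
  show "y = 0" "w = 0" using assms by (auto simp: bullseye_disc_def)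
  have d: "dist ?c ?p \<le> ?r" using assms st by (auto simp: bullseye_disc_eq_cball)
  have "norm ?c = 2 powi k * ((s + t) / 2)"
    using st by (simp add: norm_R4)
  moreover have "\<bar>norm ?c - norm ?p\<bar> \<le> ?r"
    using d norm_triangle_ineq3[of ?c ?p] unfolding dist_norm by linarith
  ultimately have "\<bar>2 powi k * ((s + t) / 2) - norm ?p\<bar> \<le> ?r" by metis
  then show "2 powi k * s \<le> norm ?p" "norm ?p \<le> 2 powi k * t"
    by (auto simp: abs_le_iff field_simps)
  have "dist (fst ?c) (fst ?p) \<le> ?r" using d dist_fst_le[of ?c ?p] by simp
  then show "2 powi k * s \<le> x" "x \<le> 2 powi k * t"
    by (auto simp: dist_real_def abs_le_iff field_simps)
qed

lemma mem_ball_bounds: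
  assumes "(x, y, z, w) \<in> bullseye_ball s t k"
  shows "y = 0" "x \<le> - (2 powi k * s)" "- (2 powi k * t) \<le> x"
    and "2 powi k * s \<le> norm (x, y, z, w)" "norm (x, y, z, w) \<le> 2 powi k * t"
proof -
  let ?c = "- disc_centre s t k" and ?p = "(x, y, z, w)" and ?r = "2 powi k * ((t - s) / 2)"
  show "y = 0" using assms by (auto simp: bullseye_ball_def)
  have d: "dist ?c ?p \<le> ?r" using assms st by (auto simp: bullseye_ball_eq_cball)
  have "norm ?c = 2 powi k * ((s + t) / 2)"
    using st by (simp add: norm_R4)
  moreover have "\<bar>norm ?c - norm ?p\<bar> \<le> ?r"
    using d norm_triangle_ineq3[of ?c ?p] unfolding dist_norm by linarith
  ultimately have "\<bar>2 powi k * ((s + t) / 2) - norm ?p\<bar> \<le> ?r" by metis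
  then show "2 powi k * s \<le> norm ?p" "norm ?p \<le> 2 powi k * t"
    by (auto simp: abs_le_iff field_simps)
  have "dist (fst ?c) (fst ?p) \<le> ?r" using d dist_fst_le[of ?c ?p] by simp
  then show "x \<le> - (2 powi k * s)" "- (2 powi k * t) \<le> x"
    by (auto simp: dist_real_def abs_le_iff field_simps)
qed

lemma level_piece_norm:
  assumes "Q \<in> level_pieces s t a k" "p \<in> Q"
  shows "2 powi k \<le> norm p" "norm p \<le> 2 powi (k + 1)"
proof -
  obtain x y z w where p: "p = (x, y, z, w)" by (cases p) auto
  have pos: "0 < (2::real) powi k" by simp
  have le: "2 powi k \<le> 2 powi k * s" "2 powi k * t \<le> 2 powi (k + 1)"
    using st pos by (auto simp: powi_Suc_real)
  consider "p \<in> bullseye_circle k" | "p \<in> bullseye_disc s t k" | "p \<in> bullseye_ball s t k"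
    | "p \<in> bullseye_bridge k"
    using assms by (auto simp: level_pieces_def split: if_splits)
  then have "2 powi k \<le> norm p \<and> norm p \<le> 2 powi (k + 1)"
  proof cases
    case 1
    then show ?thesis unfolding p mem_bullseye_circle by (auto simp: powi_Suc_real)
  next
    case 2
    then show ?thesis using mem_disc_bounds(5,6)[of x y z w k] le unfolding p by linarith
  next
    case 3
    then show ?thesis using mem_ball_bounds(4,5)[of x y z w k] le unfolding p by linarith
  next
    case 4
    then have "0 \<le> y" using order.trans[OF less_imp_le[OF pos], of y] by (simp add: p mem_bullseye_bridge)
    then show ?thesis using 4 by (auto simp: p mem_bullseye_bridge norm_R4)
  qed
  then show "2 powi k \<le> norm p" "norm p \<le> 2 powi (k + 1)" by auto
qed

lemma zero_mem_bullseye: "0 \<in> bullseye s t a"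
  by (simp add: bullseye_def mem_bullseye_axis zero_prod_def)

text \<open>Each piece offers a route to the axis of length comparable to \<open>norm p\<close>, and
  the axis leads to the origin. This gives finiteness of the path metric and the comparison of
  metrics at the origin.\<close>

lemma path_edist_origin:
  assumes "p \<in> bullseye s t a"
  shows "path_edist (bullseye s t a) p 0 \<le> ennreal (10 * norm p)"
proof -
  let ?X = "bullseye s t a"
  obtain x y z w where p: "p = (x, y, z, w)" by (cases p) auto
  have axis: "path_edist ?X (x, 0, 0, 0) 0 \<le> ennreal \<bar>x\<bar>" for x
    using path_edist_convex[OF convex_bullseye_pieces(1), of ?X "(x, 0, 0, 0)" 0]
    by (auto simp: mem_bullseye_axis bullseye_eq_pieces norm_R4 zero_prod_def)
  have circle: "path_edist ?X q 0 \<le> ennreal (9 * norm q)" if q: "q \<in> bullseye_circle k" for q k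
  proof -
    obtain x y where q': "q = (x, y, 0, 0)" "norm q = 2 powi k"
      using q by (cases q) (auto simp: mem_bullseye_circle)
    \<comment> \<open>The end of the horizontal diameter on the side of \<open>q\<close>, so that
      the inner product with \<open>q\<close> is nonnegative. The cost is 4 times a chord of length
      at most twice the radius, plus one radius: 9 in total.\<close>
    define u :: real where "u = (if 0 \<le> x then 2 powi k else - (2 powi k))"
    have u: "(u, 0, 0, 0) \<in> bullseye_circle k" "0 \<le> inner q (u, 0, 0, 0)" "\<bar>u\<bar> = 2 powi k"
      by (auto simp: u_def mem_bullseye_circle q' norm_R4 mult_nonpos_nonneg)
    have "path_edist ?X q 0 \<le> path_edist ?X q (u, 0, 0, 0) + path_edist ?X (u, 0, 0, 0) 0"
      by (rule path_edist_triangle)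
    also have "\<dots> \<le> ennreal (4 * norm (q - (u, 0, 0, 0))) + ennreal \<bar>u\<bar>"
      using q u by (intro add_mono axis path_edist_circle) (auto simp: bullseye_def)
    also have "\<dots> = ennreal (4 * norm (q - (u, 0, 0, 0)) + \<bar>u\<bar>)" by (simp flip: ennreal_plus)
    also have "\<dots> \<le> ennreal (9 * norm q)"
      using norm_triangle_ineq4[of q "(u, 0, 0, 0)"] u q' by (intro ennreal_leI) (simp add: norm_R4)
    finally show ?thesis .
  qed
  \<comment> \<open>Disc or ball: a segment to its centre \<open>(c, 0, 0, 0)\<close>, then the
    axis, of total length at most \<open>norm p + 2 * \<bar>c\<bar>\<close>. The factor 4 is a crude
    bound, from \<open>(s + t) / 2 < 2\<close> and \<open>s > 1\<close>.\<close>
  have round: "path_edist ?X p 0 \<le> ennreal (10 * norm p)"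
    if Q: "convex Q" "Q \<subseteq> ?X" "p \<in> Q" "(c, 0, 0, 0) \<in> Q" and le: "\<bar>c\<bar> \<le> 4 * norm p" for Q c
  proof -
    have "path_edist ?X p 0 \<le> path_edist ?X p (c, 0, 0, 0) + path_edist ?X (c, 0, 0, 0) 0"
      by (rule path_edist_triangle)
    also have "\<dots> \<le> ennreal (norm (p - (c, 0, 0, 0))) + ennreal \<bar>c\<bar>"
      using Q by (intro add_mono axis path_edist_convex) auto
    also have "\<dots> = ennreal (norm (p - (c, 0, 0, 0)) + \<bar>c\<bar>)" by (simp flip: ennreal_plus)
    also have "\<dots> \<le> ennreal (10 * norm p)"
      using norm_triangle_ineq4[of p "(c, 0, 0, 0)"] le by (intro ennreal_leI) (simp add: norm_R4)
    finally show ?thesis .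
  qed
  have pos: "0 < (2::real) powi k" for k by simp
  have c: "\<bar>2 powi k * ((s + t) / 2)\<bar> \<le> 4 * norm p" if "2 powi k * s \<le> norm p" for k
  proof -
    have "2 powi k * ((s + t) / 2) \<le> 2 powi k * (4 * s)" using st by (intro mult_left_mono) auto
    then have "2 powi k * ((s + t) / 2) \<le> 4 * norm p" using that by linarith
    moreover have "0 \<le> 2 powi k * ((s + t) / 2)" using st by simp
    ultimately show ?thesis by linarith
  qed
  consider "p \<in> bullseye_axis" | k where "p \<in> bullseye_circle k" | k where "p \<in> bullseye_disc s t k"
    | k where "p \<in> bullseye_ball s t k" | k where "a k = 1" "p \<in> bullseye_bridge k"
    using assms by (auto simp: bullseye_def)
  then show ?thesis
  proof cases
    case 1
    then show ?thesis
      using axis[of x] by (auto simp: p mem_bullseye_axis norm_R4 intro: order_trans ennreal_leI)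
  next
    case (2 k)
    have "ennreal (9 * norm p) \<le> ennreal (10 * norm p)" by (intro ennreal_leI) simp
    then show ?thesis using circle[OF 2] by (rule order_trans[rotated])
  next
    case (3 k)
    show ?thesis
    proof (rule round)
      show "bullseye_disc s t k \<subseteq> ?X" by (auto simp: bullseye_def)
      show "disc_centre s t k \<in> bullseye_disc s t k" using st by (simp add: bullseye_disc_eq_cball)
      show "\<bar>2 powi k * ((s + t) / 2)\<bar> \<le> 4 * norm p"
        using mem_disc_bounds[of x y z w k] 3 p by (intro c) simp
    qed (use 3 st convex_bullseye_pieces in auto)
  next
    case (4 k)
    show ?thesis
    proof (rule round)
      show "bullseye_ball s t k \<subseteq> ?X" by (auto simp: bullseye_def)
      show "(- (2 powi k * ((s + t) / 2)), 0, 0, 0) \<in> bullseye_ball s t k"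
        using st by (simp add: bullseye_ball_eq_cball)
      show "\<bar>- (2 powi k * ((s + t) / 2))\<bar> \<le> 4 * norm p"
        using mem_ball_bounds[of x y z w k] 4 p c[of k] by simp
    qed (use 4 st convex_bullseye_pieces in auto)
  next
    case (5 k)
    let ?q = "(0, 2 powi k, 0, 0) :: R4"
    have q: "?q \<in> bullseye_bridge k" "?q \<in> bullseye_circle k" "norm ?q = 2 powi k"
      by (auto simp: mem_bullseye_bridge mem_bullseye_circle norm_R4 powi_Suc_real)
    have y: "p = (0, y, 0, 0)" "2 powi k \<le> y" using 5 by (auto simp: p mem_bullseye_bridge)
    have "path_edist ?X p 0 \<le> path_edist ?X p ?q + path_edist ?X ?q 0"
      by (rule path_edist_triangle)
    also have "\<dots> \<le> ennreal (norm (p - ?q)) + ennreal (9 * norm ?q)"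
      using 5 q by (intro add_mono circle[of _ k] path_edist_convex[of "bullseye_bridge k"])
        (auto simp: bullseye_def convex_bullseye_pieces)
    also have "\<dots> = ennreal (norm (p - ?q) + 9 * norm ?q)" by (simp flip: ennreal_plus)
    also have "\<dots> \<le> ennreal (10 * norm p)"
      using y pos[of k] by (intro ennreal_leI) (simp add: norm_R4)
    finally show ?thesis .
  qed
qed

lemma path_metric_bullseye:
  assumes "p \<in> bullseye s t a" "q \<in> bullseye s t a"
  shows "path_edist (bullseye s t a) p q < top"
    and "ennreal (path_metric (bullseye s t a) p q) = path_edist (bullseye s t a) p q"
    and "norm (p - q) \<le> path_metric (bullseye s t a) p q"
proof -
  have "path_edist (bullseye s t a) p q \<le> ennreal (10 * norm p) + ennreal (10 * norm q)"
    using path_edist_origin[OF assms(1)] path_edist_origin[OF assms(2)]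
    by (intro order_trans[OF path_edist_triangle[of _ p q 0]] add_mono)
      (simp_all add: path_edist_commute[of _ 0 q])
  also have "\<dots> = ennreal (10 * norm p + 10 * norm q)" by (rule ennreal_plus[symmetric]) simp_all
  also have "\<dots> < top" by (rule ennreal_less_top)
  finally show fin: "path_edist (bullseye s t a) p q < top" .
  then show eq: "ennreal (path_metric (bullseye s t a) p q) = path_edist (bullseye s t a) p q"
    by (simp add: path_metric_eq_path_edist)
  show "norm (p - q) \<le> path_metric (bullseye s t a) p q"
    using path_edist_ge_dist[of p q "bullseye s t a"] unfolding eq[symmetric]
    by (simp add: dist_norm path_metric_eq_path_edist)
qed

lemma path_metric_le_iff:
  assumes "p \<in> bullseye s t a" "q \<in> bullseye s t a" "0 \<le> L"
  shows "path_metric (bullseye s t a) p q \<le> L \<longleftrightarrow> path_edist (bullseye s t a) p q \<le> ennreal L"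
  using assms by (simp flip: path_metric_bullseye(2))

lemma path_metric_bullseye_triangle:
  assumes "p \<in> bullseye s t a" "q \<in> bullseye s t a" "r \<in> bullseye s t a"
  shows "path_metric (bullseye s t a) p r
    \<le> path_metric (bullseye s t a) p q + path_metric (bullseye s t a) q r"
proof -
  have nn: "0 \<le> path_metric (bullseye s t a) p q" "0 \<le> path_metric (bullseye s t a) q r"
    by (simp_all add: path_metric_eq_path_edist)
  then show ?thesis
    using assms path_edist_triangle[of "bullseye s t a" p r q]
    by (simp add: path_metric_le_iff ennreal_plus path_metric_bullseye(2))
qed

end

section \<open>Self-similarity under powers of two\<close>

lemma scale_bullseye_pieces:
  "2 powi i *\<^sub>R q \<in> bullseye_axis \<longleftrightarrow> q \<in> bullseye_axis"
  "2 powi i *\<^sub>R q \<in> bullseye_circle (k + i) \<longleftrightarrow> q \<in> bullseye_circle k"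
  "2 powi i *\<^sub>R q \<in> bullseye_disc s t (k + i) \<longleftrightarrow> q \<in> bullseye_disc s t k"
  "2 powi i *\<^sub>R q \<in> bullseye_ball s t (k + i) \<longleftrightarrow> q \<in> bullseye_ball s t k"
  "2 powi i *\<^sub>R q \<in> bullseye_bridge (k + i) \<longleftrightarrow> q \<in> bullseye_bridge k"
proof -
  obtain x y z w where q: "q = (x, y, z, w)" by (cases q) auto
  define c :: real where "c = 2 powi i"
  have c: "0 < c" "2 powi (k + i) = c * 2 powi k" "2 powi (k + i + 1) = c * 2 powi (k + 1)"
    by (auto simp: c_def power_int_add)
  show "2 powi i *\<^sub>R q \<in> bullseye_axis \<longleftrightarrow> q \<in> bullseye_axis"
    by (simp add: q mem_bullseye_axis)
  show "2 powi i *\<^sub>R q \<in> bullseye_bridge (k + i) \<longleftrightarrow> q \<in> bullseye_bridge k"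
    using c(1) by (simp add: q mem_bullseye_bridge c(2,3) flip: c_def)
  have "norm (c *\<^sub>R q) = c * norm q" using c by simp
  then show "2 powi i *\<^sub>R q \<in> bullseye_circle (k + i) \<longleftrightarrow> q \<in> bullseye_circle k"
    using c(1) by (simp add: q mem_bullseye_circle c(2) flip: c_def)
  have 1: "(c * x - c * 2 powi k * ((s + t) / 2))\<^sup>2 + (c * z)\<^sup>2 \<le> (c * 2 powi k * ((t - s) / 2))\<^sup>2
     \<longleftrightarrow> (x - 2 powi k * ((s + t) / 2))\<^sup>2 + z\<^sup>2 \<le> (2 powi k * ((t - s) / 2))\<^sup>2"
  proof -
    have "(c * x - c * 2 powi k * ((s + t) / 2))\<^sup>2 + (c * z)\<^sup>2
        = c\<^sup>2 * ((x - 2 powi k * ((s + t) / 2))\<^sup>2 + z\<^sup>2)"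
      "(c * 2 powi k * ((t - s) / 2))\<^sup>2 = c\<^sup>2 * (2 powi k * ((t - s) / 2))\<^sup>2"
      by (simp_all add: power2_eq_square algebra_simps)
    then show ?thesis using c(1) by simp
  qed
  show "2 powi i *\<^sub>R q \<in> bullseye_disc s t (k + i) \<longleftrightarrow> q \<in> bullseye_disc s t k"
    using c(1) 1 by (simp add: q bullseye_disc_def c(2) flip: c_def)
  have 2: "(c * x + c * 2 powi k * ((s + t) / 2))\<^sup>2 + (c * z)\<^sup>2 + (c * w)\<^sup>2 \<le> (c * 2 powi k * ((t - s) / 2))\<^sup>2
     \<longleftrightarrow> (x + 2 powi k * ((s + t) / 2))\<^sup>2 + z\<^sup>2 + w\<^sup>2 \<le> (2 powi k * ((t - s) / 2))\<^sup>2"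
  proof -
    have "(c * x + c * 2 powi k * ((s + t) / 2))\<^sup>2 + (c * z)\<^sup>2 + (c * w)\<^sup>2
        = c\<^sup>2 * ((x + 2 powi k * ((s + t) / 2))\<^sup>2 + z\<^sup>2 + w\<^sup>2)"
      "(c * 2 powi k * ((t - s) / 2))\<^sup>2 = c\<^sup>2 * (2 powi k * ((t - s) / 2))\<^sup>2"
      by (simp_all add: power2_eq_square algebra_simps)
    then show ?thesis using c(1) by simp
  qed
  show "2 powi i *\<^sub>R q \<in> bullseye_ball s t (k + i) \<longleftrightarrow> q \<in> bullseye_ball s t k"
    using c(1) 2 by (simp add: q bullseye_ball_def c(2) flip: c_def)
qed

text \<open>This turns a change of scale into a shift of the sequence, which is why the scaling
  factors are chosen among powers of two.\<close>

lemma scale_bullseye: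
  "2 powi i *\<^sub>R q \<in> bullseye s t a \<longleftrightarrow> q \<in> bullseye s t (\<lambda>k. a (k + i))"
proof -
  have shift: "(\<exists>k. P k) \<longleftrightarrow> (\<exists>k. P (k + i))" for P :: "int \<Rightarrow> bool"
    by (metis diff_add_cancel)
  note pieces = scale_bullseye_pieces[of i q]
  have "(\<exists>k. 2 powi i *\<^sub>R q \<in> bullseye_circle k) \<longleftrightarrow> (\<exists>k. q \<in> bullseye_circle k)"
    "(\<exists>k. 2 powi i *\<^sub>R q \<in> bullseye_disc s t k) \<longleftrightarrow> (\<exists>k. q \<in> bullseye_disc s t k)"
    "(\<exists>k. 2 powi i *\<^sub>R q \<in> bullseye_ball s t k) \<longleftrightarrow> (\<exists>k. q \<in> bullseye_ball s t k)"
    "(\<exists>k. a k = 1 \<and> 2 powi i *\<^sub>R q \<in> bullseye_bridge k)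
      \<longleftrightarrow> (\<exists>k. a (k + i) = 1 \<and> q \<in> bullseye_bridge k)"
    using shift[of "\<lambda>k. 2 powi i *\<^sub>R q \<in> bullseye_circle k"]
      shift[of "\<lambda>k. 2 powi i *\<^sub>R q \<in> bullseye_disc s t k"]
      shift[of "\<lambda>k. 2 powi i *\<^sub>R q \<in> bullseye_ball s t k"]
      shift[of "\<lambda>k. a k = 1 \<and> 2 powi i *\<^sub>R q \<in> bullseye_bridge k"]
    by (simp_all only: pieces)
  then show ?thesis by (simp add: bullseye_def pieces(1))
qed

section \<open>Asymptotic cones along powers of two\<close>

text \<open>Only finitely many pieces can come near \<open>p\<close>, all closed. The union of those
  that miss \<open>p\<close> is closed, and a ball around \<open>p\<close> avoiding it meets only
  pieces that contain \<open>p\<close>.\<close>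

lemma bullseye_local:
  fixes p :: R4
  assumes st: "1 < s" "s < t" "t < 2" and "p \<noteq> 0"
  obtains \<eta> K where "0 < \<eta>" "finite K"
    "\<And>b q. q \<in> bullseye s t b \<Longrightarrow> norm (q - p) < \<eta> \<Longrightarrow>
      (p \<in> bullseye_axis \<and> q \<in> bullseye_axis) \<or> (\<exists>k\<in>K. \<exists>Q\<in>level_pieces s t b k. p \<in> Q \<and> q \<in> Q)"
proof -
  have "0 < norm p" using assms(4) by simp
  then obtain j where j: "norm p = 2 powi j \<or> 2 powi j < norm p \<and> norm p < 2 powi (j + 1)"
    using powi2_level by blast
  \<comment> \<open>Pieces of level \<open>k\<close> have norms between \<open>2 powi k\<close> and
    \<open>2 powi (k + 1)\<close>, so only these two levels meet the shell used in
    \<open>U\<close>.\<close>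
  define K where "K = {j - 1, j}"
  \<comment> \<open>The constant sequence 1 supplies every possible bridge, so \<open>\<eta>\<close>
    serves all sequences \<open>b\<close> at once.\<close>
  define \<F> where "\<F> = insert bullseye_axis (\<Union>k\<in>K. level_pieces s t (\<lambda>_. 1) k)"
  define T where "T = \<Union>{Q \<in> \<F>. p \<notin> Q}"
  define U where "U = {q. 2 powi (j - 1) < norm q \<and> norm q < 2 powi (j + 1)} - T"
  have "finite \<F>" by (simp add: \<F>_def K_def level_pieces_def)
  moreover have "closed Q" if "Q \<in> \<F>" for Q
    using that st closed_bullseye_pieces by (auto simp: \<F>_def level_pieces_def)
  ultimately have "closed T" unfolding T_def by (intro closed_Union) auto
  moreover have "open {q::R4. 2 powi (j - 1) < norm q \<and> norm q < 2 powi (j + 1)}"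
    by (intro open_Collect_conj open_Collect_less continuous_intros)
  ultimately have "open U" unfolding U_def by (rule open_Diff[rotated])
  moreover have "p \<in> U" using j powi2_step[of j] by (auto simp: U_def T_def)
  ultimately obtain \<eta> where \<eta>: "0 < \<eta>" "ball p \<eta> \<subseteq> U" by (meson open_contains_ball)
  show ?thesis
  proof (rule that[of \<eta> K])
    fix b q assume q: "q \<in> bullseye s t b" "norm (q - p) < \<eta>"
    then have U: "q \<in> U" using \<eta>(2) by (auto simp: dist_norm norm_minus_commute)
    show "(p \<in> bullseye_axis \<and> q \<in> bullseye_axis) \<or> (\<exists>k\<in>K. \<exists>Q\<in>level_pieces s t b k. p \<in> Q \<and> q \<in> Q)"
    proof (cases "q \<in> bullseye_axis")
      case True
      then show ?thesis using U by (auto simp: U_def T_def \<F>_def)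
    next
      case False
      then obtain k Q where Q: "Q \<in> level_pieces s t b k" "q \<in> Q"
        using q(1) by (auto simp: bullseye_eq_pieces)
      have "2 powi k \<le> norm q" "norm q \<le> 2 powi (k + 1)"
        using level_piece_norm[OF st Q] .
      then have "(2::real) powi (j - 1) < 2 powi (k + 1)" "(2::real) powi k < 2 powi (j + 1)"
        using U by (auto simp: U_def)
      then have "j - 1 < k + 1" "k < j + 1"
        by (simp_all add: powi2_less_iff)
      then have k: "k \<in> K" by (auto simp: K_def)
      moreover have "Q \<in> \<F>"
        using Q k by (auto simp: \<F>_def level_pieces_def split: if_splits)
      then have "p \<in> Q" using U Q(2) by (auto simp: U_def T_def)
      ultimately show ?thesis using Q by blast
    qed
  qed (use \<eta> in \<open>auto simp: K_def\<close>)
qed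

text \<open>\<open>\<eta>\<close> and \<open>K\<close> depend neither on the sequence nor on the
  scale \<open>i\<close>, so they can be fixed before the limit along the ultrafilter is taken. The
  constant 10 comes from the origin; elsewhere 4 for circles and 1 for convex pieces would
  do.\<close>

lemma bullseye_local_metric:
  fixes p :: R4
  assumes st: "1 < s" "s < t" "t < 2"
  obtains \<eta> K where "0 < \<eta>" "finite K"
    "\<And>a i q b. q \<in> bullseye s t (\<lambda>k. a (k + i)) \<Longrightarrow> norm (q - p) < \<eta> \<Longrightarrow>
       (\<And>k. k \<in> K \<Longrightarrow> b k = a (k + i)) \<Longrightarrow> p \<in> bullseye s t b"
    "\<And>a i q. q \<in> bullseye s t (\<lambda>k. a (k + i)) \<Longrightarrow> norm (q - p) < \<eta> \<Longrightarrow>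
       2 powi i *\<^sub>R p \<in> bullseye s t a \<and>
       path_metric (bullseye s t a) (2 powi i *\<^sub>R q) (2 powi i *\<^sub>R p) / 2 powi i \<le> 10 * norm (q - p)"
proof (cases "p = 0")
  case True
  show ?thesis
  proof (rule that[of 1 "{}"])
    fix a :: "int \<Rightarrow> nat" and i and q :: R4
    assume "q \<in> bullseye s t (\<lambda>k. a (k + i))"
    then have q: "2 powi i *\<^sub>R q \<in> bullseye s t a" by (simp add: scale_bullseye)
    then have "path_metric (bullseye s t a) (2 powi i *\<^sub>R q) 0 \<le> 10 * norm (2 powi i *\<^sub>R q)"
      using path_edist_origin[OF st q] by (simp add: path_metric_le_iff[OF st] zero_mem_bullseye[OF st])
    then show "2 powi i *\<^sub>R p \<in> bullseye s t a \<and>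
      path_metric (bullseye s t a) (2 powi i *\<^sub>R q) (2 powi i *\<^sub>R p) / 2 powi i \<le> 10 * norm (q - p)"
      by (simp add: True zero_mem_bullseye[OF st] divide_simps mult_ac)
  qed (auto simp: True zero_mem_bullseye[OF st])
next
  case False
  show ?thesis
  proof (rule bullseye_local[OF st False])
    fix \<eta> K assume \<eta>: "0 < \<eta>" "finite K" and loc:
      "\<And>b q. q \<in> bullseye s t b \<Longrightarrow> norm (q - p) < \<eta> \<Longrightarrow>
        (p \<in> bullseye_axis \<and> q \<in> bullseye_axis) \<or> (\<exists>k\<in>K. \<exists>Q\<in>level_pieces s t b k. p \<in> Q \<and> q \<in> Q)"
    show ?thesis
    \<comment> \<open>The bound \<open>norm p\<close> forces a nonnegative inner product of
      \<open>q\<close> and \<open>p\<close>, as the estimate on circles requires.\<close>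
    proof (rule that[of "min \<eta> (norm p)" K])
      show "0 < min \<eta> (norm p)" "finite K" using \<eta> False by auto
    next
      fix a b :: "int \<Rightarrow> nat" and i q
      assume q: "q \<in> bullseye s t (\<lambda>k. a (k + i))" "norm (q - p) < min \<eta> (norm p)"
        and eq: "\<And>k. k \<in> K \<Longrightarrow> b k = a (k + i)"
      have "p \<in> bullseye_axis \<or> (\<exists>k\<in>K. \<exists>Q\<in>level_pieces s t b k. p \<in> Q)"
        using loc[OF q(1)] q(2) eq by (fastforce simp: level_pieces_def split: if_splits)
      then show "p \<in> bullseye s t b" by (auto simp: bullseye_eq_pieces)
    next
      fix a :: "int \<Rightarrow> nat" and i q
      assume q: "q \<in> bullseye s t (\<lambda>k. a (k + i))" "norm (q - p) < min \<eta> (norm p)"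
      let ?X = "bullseye s t a" and ?c = "2 powi i :: real"
      have "(norm (q - p))\<^sup>2 \<le> (norm p)\<^sup>2" using q(2) by (intro power_mono) auto
      moreover have "(norm (q - p))\<^sup>2 = (norm q)\<^sup>2 + (norm p)\<^sup>2 - 2 * inner q p"
        by (simp add: power2_norm_eq_inner inner_simps inner_commute)
      ultimately have "(norm q)\<^sup>2 \<le> 2 * inner q p" by linarith
      then have inner: "0 \<le> inner q p" using zero_le_power2[of "norm q"] by linarith
      have "\<exists>Q. (?c::real) *\<^sub>R q \<in> Q \<and> ?c *\<^sub>R p \<in> Q \<and> Q \<subseteq> ?X \<and> (convex Q \<or> (\<exists>k. Q = bullseye_circle k))"
      proof -
        consider "p \<in> bullseye_axis" "q \<in> bullseye_axis"
          | k Q where "Q \<in> level_pieces s t (\<lambda>k. a (k + i)) k" "p \<in> Q" "q \<in> Q"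
          using loc[OF q(1)] q(2) by auto
        then show ?thesis
        proof cases
          case 1
          then show ?thesis
            by (intro exI[of _ bullseye_axis])
              (auto simp: scale_bullseye_pieces convex_bullseye_pieces bullseye_def)
        next
          case (2 k Q)
          then consider "Q = bullseye_circle k" | "Q = bullseye_disc s t k" | "Q = bullseye_ball s t k"
            | "Q = bullseye_bridge k" "a (k + i) = 1"
            by (auto simp: level_pieces_def split: if_splits)
          then show ?thesis
          proof cases
            case 1
            then show ?thesis using 2
              by (intro exI[of _ "bullseye_circle (k + i)"]) (auto simp: scale_bullseye_pieces bullseye_def)
          next
            case C: 2
            then show ?thesis using 2 st
              by (intro exI[of _ "bullseye_disc s t (k + i)"])
                (auto simp: scale_bullseye_pieces convex_bullseye_pieces bullseye_def)
          next
            case 3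
            then show ?thesis using 2 st
              by (intro exI[of _ "bullseye_ball s t (k + i)"])
                (auto simp: scale_bullseye_pieces convex_bullseye_pieces bullseye_def)
          next
            case 4
            then show ?thesis using 2
              by (intro exI[of _ "bullseye_bridge (k + i)"])
                (auto simp: scale_bullseye_pieces convex_bullseye_pieces bullseye_def)
          qed
        qed
      qed
      then obtain Q where Q: "?c *\<^sub>R q \<in> Q" "?c *\<^sub>R p \<in> Q" "Q \<subseteq> ?X"
        and "convex Q \<or> (\<exists>k. Q = bullseye_circle k)" by blast
      then have "path_edist ?X (?c *\<^sub>R q) (?c *\<^sub>R p) \<le> ennreal (4 * norm (?c *\<^sub>R q - ?c *\<^sub>R p))"
      proof (elim disjE exE)
        assume "convex Q"
        then show ?thesis
          using path_edist_convex[of Q ?X "?c *\<^sub>R q" "?c *\<^sub>R p"] Q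
          by (auto intro!: ennreal_leI elim: order_trans)
      next
        fix k assume "Q = bullseye_circle k"
        then show ?thesis using inner Q by (intro path_edist_circle[of _ k]) auto
      qed
      then have "path_metric ?X (?c *\<^sub>R q) (?c *\<^sub>R p) \<le> 4 * norm (?c *\<^sub>R q - ?c *\<^sub>R p)"
        using Q by (subst path_metric_le_iff[OF st]) auto
      also have "?c *\<^sub>R q - ?c *\<^sub>R p = ?c *\<^sub>R (q - p)" by (simp add: algebra_simps)
      also have "4 * norm \<dots> \<le> ?c * (10 * norm (q - p))" by simp
      finally show "?c *\<^sub>R p \<in> ?X \<and> path_metric ?X (?c *\<^sub>R q) (?c *\<^sub>R p) / ?c \<le> 10 * norm (q - p)"
        using Q by (auto simp: divide_le_eq mult.commute)
    qed
  qed
qed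

text \<open>Compactness yields a cluster point; along an ultrafilter a cluster point is a limit,
  since a neighbourhood that is not eventually entered would eventually be avoided.\<close>

lemma ultrafilter_compact_limit:
  fixes f :: "'a \<Rightarrow> 'b::topological_space"
  assumes F: "ultrafilter F" and "compact K" and ev: "eventually (\<lambda>x. f x \<in> K) F"
  obtains l where "l \<in> K" "(f \<longlongrightarrow> l) F"
proof -
  have "filtermap f F \<noteq> bot" using F by (simp add: ultrafilter_def filtermap_bot_iff)
  then obtain l where l: "l \<in> K" "inf (nhds l) (filtermap f F) \<noteq> bot"
    using \<open>compact K\<close> ev by (auto simp: compact_filter eventually_filtermap)
  have "(f \<longlongrightarrow> l) F"
  proof (rule topological_tendstoI)
    fix S assume S: "open S" "l \<in> S"
    show "eventually (\<lambda>x. f x \<in> S) F"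
    proof (rule ccontr)
      assume "\<not> eventually (\<lambda>x. f x \<in> S) F"
      then have "eventually (\<lambda>x. f x \<notin> S) F" using F by (auto simp: ultrafilter_def)
      then have "eventually (\<lambda>y. y \<notin> S) (filtermap f F)" by (simp add: eventually_filtermap)
      moreover have "eventually (\<lambda>y. y \<in> S) (nhds l)" using S by (rule eventually_nhds_in_open)
      ultimately have "eventually (\<lambda>_. False) (inf (nhds l) (filtermap f F))"
        unfolding eventually_inf by blast
      then show False using l(2) by (simp add: trivial_limit_def)
    qed
  qed
  then show ?thesis using l that by blast
qed

text \<open>The hypotheses are asymmetric on purpose: \<open>\<Phi>\<close> does not increase
  distances, while its inverse is controlled only near each point, with \<open>\<eta>\<close>
  depending on the point. The local comparison of metrics gives just that.\<close>

lemma mtopology_homeomorphic_subspace: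
  fixes \<Phi> :: "'a \<Rightarrow> 'b::metric_space"
  assumes "Metric_space M d" and bij: "bij_betw \<Phi> M S"
    and le: "\<And>A B. A \<in> M \<Longrightarrow> B \<in> M \<Longrightarrow> dist (\<Phi> A) (\<Phi> B) \<le> d A B"
    and ge: "\<And>A \<epsilon>. A \<in> M \<Longrightarrow> 0 < \<epsilon> \<Longrightarrow> \<exists>\<eta>>0. \<forall>B\<in>M. dist (\<Phi> A) (\<Phi> B) < \<eta> \<longrightarrow> d A B < \<epsilon>"
  shows "Metric_space.mtopology M d homeomorphic_space top_of_set S"
proof -
  interpret Metric_space M d by fact
  have M: "\<Phi> A \<in> S" if "A \<in> M" for A using bij that by (auto simp: bij_betw_def)
  have inj: "inj_on \<Phi> M" "\<Phi> ` M = S" using bij by (auto simp: bij_betw_def)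
  have "homeomorphic_map mtopology (top_of_set S) \<Phi>"
  proof (rule bijective_open_imp_homeomorphic_map)
    show "continuous_map mtopology (top_of_set S) \<Phi>"
      unfolding continuous_map_def
    proof (intro conjI allI impI)
      show "\<Phi> \<in> topspace mtopology \<rightarrow> topspace (top_of_set S)" using M by auto
      fix U assume U: "openin (top_of_set S) U"
      show "openin mtopology {x \<in> topspace mtopology. \<Phi> x \<in> U}"
        unfolding openin_mtopology
      proof (intro conjI ballI impI allI subsetI)
        fix A assume "A \<in> {x \<in> topspace mtopology. \<Phi> x \<in> U}"
        then have A: "A \<in> M" "\<Phi> A \<in> U" by auto
        then obtain r where r: "r > 0" "\<And>y. y \<in> S \<Longrightarrow> dist y (\<Phi> A) < r \<Longrightarrow> y \<in> U"
          using U by (auto simp: openin_euclidean_subtopology_iff)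
        have "mball A r \<subseteq> {x \<in> topspace mtopology. \<Phi> x \<in> U}"
        proof
          fix B assume "B \<in> mball A r"
          then have B: "B \<in> M" "d A B < r" by auto
          then have "dist (\<Phi> B) (\<Phi> A) < r" using le[OF A(1) B(1)] by (simp add: dist_commute)
          then show "B \<in> {x \<in> topspace mtopology. \<Phi> x \<in> U}" using r(2) B M by simp
        qed
        then show "\<exists>r>0. mball A r \<subseteq> {x \<in> topspace mtopology. \<Phi> x \<in> U}" using r(1) by blast
      qed auto
    qed
    show "open_map mtopology (top_of_set S) \<Phi>"
      unfolding open_map_def
    proof (intro allI impI)
      fix U assume U: "openin mtopology U"
      show "openin (top_of_set S) (\<Phi> ` U)"
        unfolding openin_euclidean_subtopology_iff
      proof (intro conjI ballI)
        show "\<Phi> ` U \<subseteq> S" using U M by (auto simp: openin_mtopology)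
        fix y assume "y \<in> \<Phi> ` U"
        then obtain A where A: "A \<in> U" "A \<in> M" "y = \<Phi> A" using U by (auto simp: openin_mtopology)
        then obtain r where r: "r > 0" "mball A r \<subseteq> U" using U by (auto simp: openin_mtopology)
        then obtain \<eta> where \<eta>: "\<eta> > 0" "\<forall>B\<in>M. dist (\<Phi> A) (\<Phi> B) < \<eta> \<longrightarrow> d A B < r"
          using ge A by blast
        have "z \<in> \<Phi> ` U" if z: "z \<in> S" "dist z y < \<eta>" for z
        proof -
          obtain B where B: "B \<in> M" "z = \<Phi> B" using z(1) inj by blast
          then have "B \<in> mball A r" using \<eta>(2) z(2) A by (auto simp: dist_commute)
          then show ?thesis using r(2) B by blast
        qed
        then show "\<exists>e>0. \<forall>x'\<in>S. dist x' y < e \<longrightarrow> x' \<in> \<Phi> ` U" using \<eta>(1) by blast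
      qed
    qed
  qed (use inj in auto)
  then show ?thesis using homeomorphic_map_imp_homeomorphic_space by blast
qed

text \<open>Agreement is assumed index by index, with no uniformity in \<open>k\<close>: the
  neighbourhood of a point involves finitely many levels, and finitely many such conditions hold
  simultaneously along \<open>\<mu>\<close>.\<close>

locale bullseye_cone =
  fixes s t :: real and a b :: "int \<Rightarrow> nat" and \<mu> :: "nat filter" and m :: "nat \<Rightarrow> int"
  assumes st: "1 < s" "s < t" "t < 2" and ultra: "ultrafilter \<mu>"
    and agree: "\<And>k. eventually (\<lambda>n. a (k + m n) = b k) \<mu>"
begin

abbreviation "X \<equiv> bullseye s t a"
abbreviation "d \<equiv> path_metric X"
abbreviation "\<alpha> n \<equiv> (2::real) powi m n"
abbreviation "seqs \<equiv> cone_seqs \<mu> X d 0 \<alpha>"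
abbreviation "rel \<equiv> cone_rel \<mu> X d 0 \<alpha>"

section \<open>The limit map from sequences to the limiting bullseye space\<close>

lemma nontrivial: "\<mu> \<noteq> bot" using ultra by (simp add: ultrafilter_def)

lemma d_nonneg: "0 \<le> d x y" by (simp add: path_metric_eq_path_edist)

lemma d_commute: "d x y = d y x" by (simp add: path_metric_eq_path_edist path_edist_commute)

lemma d_triangle: "x \<in> X \<Longrightarrow> y \<in> X \<Longrightarrow> z \<in> X \<Longrightarrow> d x z \<le> d x y + d y z"
  by (rule path_metric_bullseye_triangle[OF st])

lemma ultra_dist_limit:
  assumes "eventually (\<lambda>n. d (x n) (y n) / \<alpha> n \<le> B) \<mu>"
  obtains l where "0 \<le> l" "((\<lambda>n. d (x n) (y n) / \<alpha> n) \<longlongrightarrow> l) \<mu>" "ultra_dist \<mu> d \<alpha> x y = ennreal l"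
proof -
  have "eventually (\<lambda>n. d (x n) (y n) / \<alpha> n \<in> {0..B}) \<mu>"
    using assms by eventually_elim (simp add: d_nonneg)
  from ultrafilter_compact_limit[OF ultra compact_Icc this] obtain l
    where l: "l \<in> {0..B}" "((\<lambda>n. d (x n) (y n) / \<alpha> n) \<longlongrightarrow> l) \<mu>" .
  then have "((\<lambda>n. ennreal (d (x n) (y n) / \<alpha> n)) \<longlongrightarrow> ennreal l) \<mu>" by (intro tendsto_ennrealI)
  then have "ultra_dist \<mu> d \<alpha> x y = ennreal l"
    unfolding ultra_dist_def by (rule tendsto_Lim[OF nontrivial])
  with l that show ?thesis by auto
qed

lemma seqs_iff:
  "x \<in> seqs \<longleftrightarrow> (\<forall>n. x n \<in> X) \<and> (\<exists>B. eventually (\<lambda>n. d (x n) 0 / \<alpha> n \<le> B) \<mu>)"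
proof (intro iffI conjI)
  assume x: "x \<in> seqs"
  then show "\<forall>n. x n \<in> X" by (simp add: cone_seqs_def)
  let ?f = "\<lambda>n. ennreal (d (x n) 0 / \<alpha> n)"
  have "eventually (\<lambda>n. ?f n \<in> UNIV) \<mu>" by simp
  from ultrafilter_compact_limit[OF ultra compact_UNIV this] obtain l
    where l: "(?f \<longlongrightarrow> l) \<mu>" .
  then have "ultra_dist \<mu> d \<alpha> x (\<lambda>_. 0) = l"
    unfolding ultra_dist_def by (rule tendsto_Lim[OF nontrivial])
  then have "l < top" using x by (simp add: cone_seqs_def)
  then obtain r where r: "0 \<le> r" "l = ennreal r" by (cases l) auto
  \<comment> \<open>A limit \<open>r\<close> gives eventual bounds only by numbers strictly above
    it.\<close>
  define B where "B = r + 1"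
  have "l < ennreal B" "0 \<le> B" using r by (simp_all add: B_def ennreal_less_iff)
  then have "eventually (\<lambda>n. ?f n < ennreal B) \<mu>" using l by (simp add: order_tendstoD)
  then have "eventually (\<lambda>n. d (x n) 0 / \<alpha> n \<le> B) \<mu>"
    by eventually_elim (use \<open>0 \<le> B\<close> in \<open>simp add: ennreal_less_iff d_nonneg\<close>)
  then show "\<exists>B. eventually (\<lambda>n. d (x n) 0 / \<alpha> n \<le> B) \<mu>" by blast
next
  assume "(\<forall>n. x n \<in> X) \<and> (\<exists>B. eventually (\<lambda>n. d (x n) 0 / \<alpha> n \<le> B) \<mu>)"
  moreover from this obtain B where "eventually (\<lambda>n. d (x n) 0 / \<alpha> n \<le> B) \<mu>" by blast
  from ultra_dist_limit[of x "\<lambda>_. 0", OF this] obtain l where "ultra_dist \<mu> d \<alpha> x (\<lambda>_. 0) = ennreal l"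
    by metis
  ultimately show "x \<in> seqs" by (simp add: cone_seqs_def)
qed

lemma rescale: "x n \<in> X \<Longrightarrow> (1 / \<alpha> n) *\<^sub>R x n \<in> bullseye s t (\<lambda>k. a (k + m n))"
  by (subst scale_bullseye[symmetric]) simp

text \<open>The map that becomes the homeomorphism. \<open>Lim\<close> is meaningful on
  \<open>seqs\<close>, where bounded rescaled sequences in Euclidean space converge along
  \<open>\<mu>\<close>.\<close>

definition pt :: "(nat \<Rightarrow> R4) \<Rightarrow> R4" where "pt x = Lim \<mu> (\<lambda>n. (1 / \<alpha> n) *\<^sub>R x n)"

lemma pt_eqI: "((\<lambda>n. (1 / \<alpha> n) *\<^sub>R x n) \<longlongrightarrow> p) \<mu> \<Longrightarrow> pt x = p"
  unfolding pt_def by (rule tendsto_Lim[OF nontrivial])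

lemma pt_limit:
  assumes x: "x \<in> seqs"
  shows "((\<lambda>n. (1 / \<alpha> n) *\<^sub>R x n) \<longlongrightarrow> pt x) \<mu>"
proof -
  obtain B where B: "eventually (\<lambda>n. d (x n) 0 / \<alpha> n \<le> B) \<mu>" and X: "\<And>n. x n \<in> X"
    using x by (auto simp: seqs_iff)
  have "eventually (\<lambda>n. (1 / \<alpha> n) *\<^sub>R x n \<in> cball 0 B) \<mu>"
    using B
  proof eventually_elim
    case (elim n)
    have "norm (x n) \<le> d (x n) 0"
      using path_metric_bullseye(3)[OF st X[of n] zero_mem_bullseye[OF st]] by simp
    then have "norm (x n) / \<alpha> n \<le> d (x n) 0 / \<alpha> n" by (intro divide_right_mono) auto
    then show ?case using elim by simp
  qed
  from ultrafilter_compact_limit[OF ultra compact_cball this] obtain p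
    where p: "((\<lambda>n. (1 / \<alpha> n) *\<^sub>R x n) \<longlongrightarrow> p) \<mu>" .
  then show ?thesis using pt_eqI[OF p] by simp
qed

text \<open>The local comparison at \<open>p\<close>, read off at the points \<open>x n\<close>
  rescaled. That \<open>p\<close> lies in the limiting space is a conclusion, not a hypothesis, so
  the choice \<open>p = pt x\<close> shows that limits never leave that space.\<close>

lemma near_limit:
  obtains \<eta> where "0 < \<eta>"
    "\<And>x. x \<in> seqs \<Longrightarrow> norm (pt x - p) < \<eta> \<Longrightarrow> p \<in> bullseye s t b \<and>
      eventually (\<lambda>n. \<alpha> n *\<^sub>R p \<in> X \<and> d (x n) (\<alpha> n *\<^sub>R p) / \<alpha> n \<le> 10 * norm ((1 / \<alpha> n) *\<^sub>R x n - p)) \<mu>"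
proof (rule bullseye_local_metric[OF st, where p = p])
  fix \<eta> K
  assume \<eta>: "0 < \<eta>" "finite K"
    and 1: "\<And>a i q b. q \<in> bullseye s t (\<lambda>k. a (k + i)) \<Longrightarrow> norm (q - p) < \<eta> \<Longrightarrow>
       (\<And>k. k \<in> K \<Longrightarrow> b k = a (k + i)) \<Longrightarrow> p \<in> bullseye s t b"
    and 2: "\<And>a i q. q \<in> bullseye s t (\<lambda>k. a (k + i)) \<Longrightarrow> norm (q - p) < \<eta> \<Longrightarrow>
       2 powi i *\<^sub>R p \<in> bullseye s t a \<and>
       path_metric (bullseye s t a) (2 powi i *\<^sub>R q) (2 powi i *\<^sub>R p) / 2 powi i \<le> 10 * norm (q - p)"
  show ?thesis
  proof (rule that[OF \<eta>(1)])
    fix x assume x: "x \<in> seqs" "norm (pt x - p) < \<eta>"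
    have X: "\<And>n. x n \<in> X" using x(1) by (simp add: seqs_iff)
    let ?q = "\<lambda>n. (1 / \<alpha> n) *\<^sub>R x n"
    have "((\<lambda>n. norm (?q n - p)) \<longlongrightarrow> norm (pt x - p)) \<mu>"
      by (intro tendsto_intros pt_limit x)
    then have near: "eventually (\<lambda>n. norm (?q n - p) < \<eta>) \<mu>"
      using x(2) by (rule order_tendstoD)
    have "eventually (\<lambda>n. \<forall>k\<in>K. a (k + m n) = b k) \<mu>"
      using \<eta>(2) agree by (simp add: eventually_ball_finite_distrib)
    \<comment> \<open>A statement independent of \<open>n\<close> that holds eventually is true,
      because the filter is proper.\<close>
    then have "eventually (\<lambda>_. p \<in> bullseye s t b) \<mu>"
      using near
    proof eventually_elim
      case (elim n)
      then show ?case by (intro 1[OF rescale[of x n, OF X[of n]]]) auto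
    qed
    then have "p \<in> bullseye s t b" using nontrivial by simp
    moreover have "eventually (\<lambda>n. \<alpha> n *\<^sub>R p \<in> X \<and> d (x n) (\<alpha> n *\<^sub>R p) / \<alpha> n \<le> 10 * norm (?q n - p)) \<mu>"
      using near
    proof eventually_elim
      case (elim n)
      have "\<alpha> n *\<^sub>R ?q n = x n" by simp
      then show ?case using 2[OF rescale[of x n, OF X[of n]]] elim by simp
    qed
    ultimately show "p \<in> bullseye s t b \<and>
      eventually (\<lambda>n. \<alpha> n *\<^sub>R p \<in> X \<and> d (x n) (\<alpha> n *\<^sub>R p) / \<alpha> n \<le> 10 * norm (?q n - p)) \<mu>" ..
  qed
qed

lemma pt_mem: "x \<in> seqs \<Longrightarrow> pt x \<in> bullseye s t b"
  by (rule near_limit[of "pt x"]) auto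

lemma dist_limit:
  assumes "x \<in> seqs" "y \<in> seqs"
  obtains l where "0 \<le> l" "((\<lambda>n. d (x n) (y n) / \<alpha> n) \<longlongrightarrow> l) \<mu>" "ultra_dist \<mu> d \<alpha> x y = ennreal l"
    "norm (pt x - pt y) \<le> l"
proof -
  obtain B B' where B: "eventually (\<lambda>n. d (x n) 0 / \<alpha> n \<le> B) \<mu>" "eventually (\<lambda>n. d (y n) 0 / \<alpha> n \<le> B') \<mu>"
    and X: "\<And>n. x n \<in> X" "\<And>n. y n \<in> X"
    using assms by (auto simp: seqs_iff)
  have "eventually (\<lambda>n. d (x n) (y n) / \<alpha> n \<le> B + B') \<mu>"
    using B
  proof eventually_elim
    case (elim n)
    have "d (x n) (y n) / \<alpha> n \<le> (d (x n) 0 + d (y n) 0) / \<alpha> n"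
      using d_triangle[OF X(1) zero_mem_bullseye[OF st] X(2)] d_commute by (intro divide_right_mono) auto
    then show ?case using elim by (simp add: add_divide_distrib)
  qed
  from ultra_dist_limit[OF this] obtain l where l: "0 \<le> l" "((\<lambda>n. d (x n) (y n) / \<alpha> n) \<longlongrightarrow> l) \<mu>"
    "ultra_dist \<mu> d \<alpha> x y = ennreal l" .
  have "norm (pt x - pt y) \<le> l"
  proof (rule tendsto_le[OF nontrivial l(2)])
    show "((\<lambda>n. norm ((1 / \<alpha> n) *\<^sub>R x n - (1 / \<alpha> n) *\<^sub>R y n)) \<longlongrightarrow> norm (pt x - pt y)) \<mu>"
      by (intro tendsto_intros pt_limit assms)
    have "norm ((1 / \<alpha> n) *\<^sub>R x n - (1 / \<alpha> n) *\<^sub>R y n) \<le> d (x n) (y n) / \<alpha> n" for n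
    proof -
      have "(1 / \<alpha> n) *\<^sub>R x n - (1 / \<alpha> n) *\<^sub>R y n = (1 / \<alpha> n) *\<^sub>R (x n - y n)" by (simp add: algebra_simps)
      then show ?thesis using path_metric_bullseye(3)[OF st X] by (simp add: divide_right_mono)
    qed
    then show "eventually (\<lambda>n. norm ((1 / \<alpha> n) *\<^sub>R x n - (1 / \<alpha> n) *\<^sub>R y n) \<le> d (x n) (y n) / \<alpha> n) \<mu>"
      by simp
  qed
  with l that show ?thesis by blast
qed

text \<open>Both sequences are compared with the dilated limit
  \<open>\<alpha> n *\<^sub>R pt x\<close>. The rescaled distance of \<open>x n\<close> to it tends
  to 0, that of \<open>y n\<close> is eventually at most 10 times a quantity tending to
  \<open>norm (pt y - pt x)\<close>.\<close>

lemma dist_limit_le: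
  assumes x: "x \<in> seqs"
  obtains \<eta> where "0 < \<eta>"
    "\<And>y l. y \<in> seqs \<Longrightarrow> norm (pt y - pt x) < \<eta> \<Longrightarrow>
       ((\<lambda>n. d (x n) (y n) / \<alpha> n) \<longlongrightarrow> l) \<mu> \<Longrightarrow> l \<le> 10 * norm (pt y - pt x)"
proof -
  let ?p = "pt x"
  obtain \<eta> where \<eta>: "0 < \<eta>"
    "\<And>x. x \<in> seqs \<Longrightarrow> norm (pt x - ?p) < \<eta> \<Longrightarrow> ?p \<in> bullseye s t b \<and>
      eventually (\<lambda>n. \<alpha> n *\<^sub>R ?p \<in> X \<and> d (x n) (\<alpha> n *\<^sub>R ?p) / \<alpha> n \<le> 10 * norm ((1 / \<alpha> n) *\<^sub>R x n - ?p)) \<mu>"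
    by (rule near_limit[of ?p]) (rule that; blast)
  show ?thesis
  proof (rule that[OF \<eta>(1)])
    fix y l assume y: "y \<in> seqs" "norm (pt y - ?p) < \<eta>"
      and l: "((\<lambda>n. d (x n) (y n) / \<alpha> n) \<longlongrightarrow> l) \<mu>"
    have X: "\<And>n. x n \<in> X" "\<And>n. y n \<in> X" using x y(1) by (auto simp: seqs_iff)
    let ?g = "\<lambda>n. 10 * norm ((1 / \<alpha> n) *\<^sub>R x n - ?p) + 10 * norm ((1 / \<alpha> n) *\<^sub>R y n - ?p)"
    have "(?g \<longlongrightarrow> 10 * norm (?p - ?p) + 10 * norm (pt y - ?p)) \<mu>"
      by (intro tendsto_intros pt_limit x y)
    then have g: "(?g \<longlongrightarrow> 10 * norm (pt y - ?p)) \<mu>" by simp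
    have "eventually (\<lambda>n. \<alpha> n *\<^sub>R ?p \<in> X \<and> d (x n) (\<alpha> n *\<^sub>R ?p) / \<alpha> n \<le> 10 * norm ((1 / \<alpha> n) *\<^sub>R x n - ?p)) \<mu>"
      "eventually (\<lambda>n. \<alpha> n *\<^sub>R ?p \<in> X \<and> d (y n) (\<alpha> n *\<^sub>R ?p) / \<alpha> n \<le> 10 * norm ((1 / \<alpha> n) *\<^sub>R y n - ?p)) \<mu>"
      using \<eta> x y by auto
    then have "eventually (\<lambda>n. d (x n) (y n) / \<alpha> n \<le> ?g n) \<mu>"
    proof eventually_elim
      case (elim n)
      have "d (x n) (y n) / \<alpha> n \<le> (d (x n) (\<alpha> n *\<^sub>R ?p) + d (y n) (\<alpha> n *\<^sub>R ?p)) / \<alpha> n"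
        using d_triangle[of "x n" "\<alpha> n *\<^sub>R ?p" "y n"] X elim d_commute[of "\<alpha> n *\<^sub>R ?p"]
        by (intro divide_right_mono) auto
      then show ?case using elim by (simp add: add_divide_distrib)
    qed
    then show "l \<le> 10 * norm (pt y - ?p)" by (rule tendsto_le[OF nontrivial g l])
  qed
qed

lemma pt_surj:
  assumes q: "q \<in> bullseye s t b"
  obtains x where "x \<in> seqs" "pt x = q"
proof -
  \<comment> \<open>The origin is a default for those \<open>n\<close> at which the dilated point is
    not in \<open>X\<close>; by \<open>agree\<close> this does not happen on a set belonging to
    \<open>\<mu>\<close>.\<close>
  define x where "x n = (if \<alpha> n *\<^sub>R q \<in> X then \<alpha> n *\<^sub>R q else 0)" for n
  have X: "x n \<in> X" for n by (simp add: x_def zero_mem_bullseye[OF st])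
  have x0: "d (x n) 0 / \<alpha> n \<le> 10 * norm q" for n
  proof -
    have "d (x n) 0 \<le> 10 * norm (x n)"
      using path_edist_origin[OF st X] by (simp add: path_metric_le_iff[OF st X zero_mem_bullseye[OF st]])
    also have "\<dots> \<le> \<alpha> n * (10 * norm q)" by (simp add: x_def)
    finally show ?thesis by (simp add: divide_le_eq mult.commute)
  qed
  then have "eventually (\<lambda>n. d (x n) 0 / \<alpha> n \<le> 10 * norm q) \<mu>" by simp
  then have "x \<in> seqs" using X by (auto simp: seqs_iff)
  moreover have "eventually (\<lambda>n. \<alpha> n *\<^sub>R q \<in> X) \<mu>"
  proof -
    consider "q \<in> bullseye_axis" | k Q where "Q \<in> level_pieces s t b k" "q \<in> Q"
      using q by (auto simp: bullseye_eq_pieces)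
    then show ?thesis
    proof cases
      case 1
      then show ?thesis by (simp add: bullseye_def scale_bullseye_pieces)
    next
      case (2 k Q)
      from agree[of k] show ?thesis
      proof eventually_elim
        case (elim n)
        have "Q \<in> level_pieces s t (\<lambda>k. a (k + m n)) k" using 2 elim by (simp add: level_pieces_def)
        then have "q \<in> bullseye s t (\<lambda>k. a (k + m n))" using 2 by (auto simp: bullseye_eq_pieces)
        then show ?case by (simp add: scale_bullseye)
      qed
    qed
  qed
  then have "eventually (\<lambda>n. q = (1 / \<alpha> n) *\<^sub>R x n) \<mu>"
    by eventually_elim (simp add: x_def)
  then have "((\<lambda>n. (1 / \<alpha> n) *\<^sub>R x n) \<longlongrightarrow> q) \<mu>"
    by (rule tendsto_eventually[OF eventually_mono]) simp
  ultimately show ?thesis using that pt_eqI by blast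
qed

text \<open>The cone relation is the kernel of \<open>pt\<close>, so \<open>pt\<close> is well
  defined and injective on the quotient.\<close>

lemma rel_iff: "(x, y) \<in> rel \<longleftrightarrow> x \<in> seqs \<and> y \<in> seqs \<and> pt x = pt y"
proof -
  have "ultra_dist \<mu> d \<alpha> x y = 0 \<longleftrightarrow> pt x = pt y" if xy: "x \<in> seqs" "y \<in> seqs"
  proof -
    obtain l where l: "0 \<le> l" "((\<lambda>n. d (x n) (y n) / \<alpha> n) \<longlongrightarrow> l) \<mu>"
      "ultra_dist \<mu> d \<alpha> x y = ennreal l" "norm (pt x - pt y) \<le> l"
      using dist_limit[OF xy] .
    have "l \<le> 0" if "pt x = pt y"
      by (rule dist_limit_le[OF xy(1)]) (use l(2) xy that in fastforce)
    then show ?thesis using l by (auto simp: ennreal_eq_0_iff)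
  qed
  then show ?thesis by (auto simp: cone_rel_def)
qed

abbreviation "M \<equiv> cone \<mu> X d 0 \<alpha>"

lemma rep:
  assumes "A \<in> M"
  shows "(SOME x. x \<in> A) \<in> seqs" "A = {y \<in> seqs. pt y = pt (SOME x. x \<in> A)}"
proof -
  obtain x where x: "x \<in> seqs" "A = rel `` {x}" using assms by (auto simp: cone_def elim: quotientE)
  then have A: "A = {y \<in> seqs. pt y = pt x}" by (auto simp: rel_iff)
  then have "x \<in> A" using x by simp
  then have "(SOME x. x \<in> A) \<in> A" by (rule someI[where P = "\<lambda>x. x \<in> A"])
  then show "(SOME x. x \<in> A) \<in> seqs" "A = {y \<in> seqs. pt y = pt (SOME x. x \<in> A)}"
    using A by auto
qed

lemma cone_dist_limit:
  assumes "A \<in> M" "B \<in> M"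
  shows "((\<lambda>n. d ((SOME x. x \<in> A) n) ((SOME x. x \<in> B) n) / \<alpha> n) \<longlongrightarrow> cone_dist \<mu> d \<alpha> A B) \<mu>"
    "norm (pt (SOME x. x \<in> A) - pt (SOME x. x \<in> B)) \<le> cone_dist \<mu> d \<alpha> A B"
  by (rule dist_limit[OF rep(1)[OF assms(1)] rep(1)[OF assms(2)]]; simp add: cone_dist_def)+

theorem cone_homeomorphic:
  "cone_topology \<mu> X d 0 \<alpha> homeomorphic_space top_of_set (bullseye s t b)"
  unfolding cone_topology_def
proof (rule mtopology_homeomorphic_subspace)
  let ?D = "cone_dist \<mu> d \<alpha>" and ?r = "\<lambda>A. SOME x. x \<in> A"
  have eqI: "A = B" if "A \<in> M" "B \<in> M" "pt (?r A) = pt (?r B)" for A B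
    using rep(2)[OF that(1)] rep(2)[OF that(2)] that(3) by simp
  have ge: "\<exists>\<eta>>0. \<forall>B\<in>M. dist (pt (?r A)) (pt (?r B)) < \<eta> \<longrightarrow> ?D A B < \<epsilon>"
    if A: "A \<in> M" and \<epsilon>: "0 < \<epsilon>" for A \<epsilon>
  proof -
    obtain \<eta> where \<eta>: "0 < \<eta>"
      "\<And>y l. y \<in> seqs \<Longrightarrow> norm (pt y - pt (?r A)) < \<eta> \<Longrightarrow>
       ((\<lambda>n. d (?r A n) (y n) / \<alpha> n) \<longlongrightarrow> l) \<mu> \<Longrightarrow> l \<le> 10 * norm (pt y - pt (?r A))"
      by (rule dist_limit_le[OF rep(1)[OF A]]) (rule that; blast)
    have "?D A B < \<epsilon>" if B: "B \<in> M" and lt: "dist (pt (?r A)) (pt (?r B)) < min \<eta> (\<epsilon> / 10)" for B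
      using \<eta>(2)[OF rep(1)[OF B] _ cone_dist_limit(1)[OF A B]] lt
      by (auto simp: dist_norm norm_minus_commute)
    then show ?thesis using \<eta>(1) \<epsilon> by (intro exI[of _ "min \<eta> (\<epsilon> / 10)"]) auto
  qed
  show "Metric_space M ?D"
  proof
    fix A B
    show "0 \<le> ?D A B" by (simp add: cone_dist_def)
    show "?D A B = ?D B A" by (simp add: cone_dist_def ultra_dist_def d_commute)
  next
    fix A B assume AB: "A \<in> M" "B \<in> M"
    show "?D A B = 0 \<longleftrightarrow> A = B"
    proof
      assume "?D A B = 0"
      then show "A = B" using cone_dist_limit(2)[OF AB] eqI[OF AB] by simp
    next
      assume eq: "A = B"
      show "?D A B = 0"
      \<comment> \<open>The chosen representatives coincide here; \<open>ge\<close> with the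
        supposed positive distance as \<open>\<epsilon>\<close> would make that distance smaller
        than itself.\<close>
      proof (rule ccontr)
        assume "?D A B \<noteq> 0"
        then have "0 < ?D A B" by (simp add: cone_dist_def less_le)
        from ge[OF AB(1) this] show False using AB(2) eq by force
      qed
    qed
  next
    fix A B C assume M: "A \<in> M" "B \<in> M" "C \<in> M"
    note r = rep(1)[OF M(1)] rep(1)[OF M(2)] rep(1)[OF M(3)]
    have "((\<lambda>n. d (?r A n) (?r B n) / \<alpha> n + d (?r B n) (?r C n) / \<alpha> n) \<longlongrightarrow> ?D A B + ?D B C) \<mu>"
      by (intro tendsto_add cone_dist_limit M)
    then show "?D A C \<le> ?D A B + ?D B C"
    proof (rule tendsto_le[OF nontrivial _ cone_dist_limit(1)[OF M(1,3)]])
      have "d (?r A n) (?r C n) / \<alpha> n \<le> d (?r A n) (?r B n) / \<alpha> n + d (?r B n) (?r C n) / \<alpha> n" for n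
        using d_triangle[of "?r A n" "?r B n" "?r C n"] r
        by (simp add: seqs_iff divide_right_mono flip: add_divide_distrib)
      then show "eventually (\<lambda>n. d (?r A n) (?r C n) / \<alpha> n
          \<le> d (?r A n) (?r B n) / \<alpha> n + d (?r B n) (?r C n) / \<alpha> n) \<mu>" by simp
    qed
  qed
  show "bij_betw (\<lambda>A. pt (?r A)) M (bullseye s t b)"
  proof (rule bij_betwI')
    fix q assume "q \<in> bullseye s t b"
    then obtain x where x: "x \<in> seqs" "pt x = q" using pt_surj by blast
    have A: "rel `` {x} \<in> M" unfolding cone_def using x(1) by (rule quotientI)
    have "x \<in> rel `` {x}" using x(1) by (auto simp: rel_iff)
    then have "pt x = pt (?r (rel `` {x}))" using rep(2)[OF A] by blast
    then have "q = pt (?r (rel `` {x}))" using x(2) by simp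
    then show "\<exists>A\<in>M. q = pt (?r A)" using A by (rule bexI)
  qed (use eqI pt_mem rep(1) in auto)
  show "dist (pt (?r A)) (pt (?r B)) \<le> ?D A B" if "A \<in> M" "B \<in> M" for A B
    using cone_dist_limit(2)[OF that] by (simp add: dist_norm)
  show "\<exists>\<eta>>0. \<forall>B\<in>M. dist (pt (?r A)) (pt (?r B)) < \<eta> \<longrightarrow> ?D A B < \<epsilon>" if "A \<in> M" "0 < \<epsilon>" for A \<epsilon>
    using that by (rule ge)
qed

end

section \<open>The graph of branch points of a topological space\<close>

text \<open>At least three local sides. The sides need not be connected, so a point with four
  directions qualifies by merging two of them.\<close>

definition branch_point :: "'a topology \<Rightarrow> 'a \<Rightarrow> bool" where
  "branch_point X x \<longleftrightarrow> (\<exists>U A B C. openin X U \<and> openin X A \<and> openin X B \<and> openin X C \<and>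
     x \<in> U \<and> U - {x} = A \<union> B \<union> C \<and> A \<inter> B = {} \<and> A \<inter> C = {} \<and> B \<inter> C = {} \<and>
     x \<in> X closure_of A \<and> x \<in> X closure_of B \<and> x \<in> X closure_of C)"

text \<open>The connecting set need not be an arc, so an edge along a ray may run through a disc or
  a ball.\<close>

definition adjacent :: "'a topology \<Rightarrow> 'a \<Rightarrow> 'a \<Rightarrow> bool" where
  "adjacent X u v \<longleftrightarrow> branch_point X u \<and> branch_point X v \<and> u \<noteq> v \<and>
     (\<exists>C. connectedin X C \<and> (\<forall>x\<in>C. \<not> branch_point X x) \<and> u \<in> X closure_of C \<and> v \<in> X closure_of C)"

definition triangle :: "'a topology \<Rightarrow> 'a set \<Rightarrow> bool" where
  "triangle X T \<longleftrightarrow> (\<exists>u v w. T = {u, v, w} \<and> adjacent X u v \<and> adjacent X v w \<and> adjacent X u w)"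

text \<open>Without a bridge, consecutive levels are still joined along the two rays. Asking every
  vertex of \<open>T\<close> for a neighbour makes the third vertex decide.\<close>

definition triangle_link :: "'a topology \<Rightarrow> ('a set \<times> 'a set) set" where
  "triangle_link X = {(T, T'). triangle X T \<and> triangle X T' \<and> T \<inter> T' = {} \<and>
     (\<forall>u\<in>T. \<exists>v\<in>T'. adjacent X u v)}"

text \<open>A maximal run of \<open>n\<close> ones touches \<open>n + 1\<close> levels, so it
  contributes \<open>n + 1\<close>. An infinite component is recorded as 0, by the convention for
  \<open>card\<close>.\<close>

definition chain_sizes :: "'a topology \<Rightarrow> nat set" where
  "chain_sizes X = {card ((triangle_link X)\<^sup>* `` {T}) | T. triangle X T}"

section \<open>Invariance under homeomorphisms\<close>

lemma branch_point_in_topspace: "branch_point X x \<Longrightarrow> x \<in> topspace X"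
  by (auto simp: branch_point_def dest: openin_subset)

lemma triangle_subset_topspace: "triangle X T \<Longrightarrow> T \<subseteq> topspace X"
  by (auto simp: triangle_def adjacent_def branch_point_in_topspace)

lemma branch_point_homeomorphic_map:
  assumes f: "homeomorphic_map X Y f" and "branch_point X x"
  shows "branch_point Y (f x)"
proof -
  obtain U A B C where o: "openin X U" "openin X A" "openin X B" "openin X C" and
     U: "x \<in> U" "U - {x} = A \<union> B \<union> C" "A \<inter> B = {}" "A \<inter> C = {}" "B \<inter> C = {}" and
     cl: "x \<in> X closure_of A" "x \<in> X closure_of B" "x \<in> X closure_of C"
    using assms(2) unfolding branch_point_def by blast
  have sub: "U \<subseteq> topspace X" "A \<subseteq> topspace X" "B \<subseteq> topspace X" "C \<subseteq> topspace X"
    using o by (auto dest: openin_subset)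
  have inj: "inj_on f (topspace X)"
    using f by (simp add: homeomorphic_imp_injective_map)
  have "openin Y (f ` U)" "openin Y (f ` A)" "openin Y (f ` B)" "openin Y (f ` C)"
    using o sub homeomorphic_map_openness[OF f] by simp_all
  moreover have "f ` U - {f x} = f ` A \<union> f ` B \<union> f ` C"
  proof -
    have "f ` U - {f x} = f ` (U - {x})" using inj_on_image_set_diff[OF inj, of U "{x}"] sub U(1) by auto
    then show ?thesis using U(2) by auto
  qed
  moreover have "f ` A \<inter> f ` B = {}" "f ` A \<inter> f ` C = {}" "f ` B \<inter> f ` C = {}"
    using inj_on_image_Int[OF inj sub(2,3)] inj_on_image_Int[OF inj sub(2,4)]
      inj_on_image_Int[OF inj sub(3,4)] U(3-5) by simp_all
  moreover have "f x \<in> Y closure_of (f ` A)" "f x \<in> Y closure_of (f ` B)" "f x \<in> Y closure_of (f ` C)"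
    using homeomorphic_map_closure_of[OF f] sub cl by auto
  moreover have "f x \<in> f ` U" using U(1) by simp
  ultimately show ?thesis
    unfolding branch_point_def
    by (intro exI[of _ "f ` U"] exI[of _ "f ` A"] exI[of _ "f ` B"] exI[of _ "f ` C"] conjI)
qed

lemma homeomorphic_map_inverse:
  assumes "homeomorphic_map X Y f"
  shows "\<exists>g. homeomorphic_map Y X g \<and> (\<forall>x\<in>topspace X. g (f x) = x) \<and> (\<forall>y\<in>topspace Y. f (g y) = y)"
proof -
  obtain g where "homeomorphic_maps X Y f g" using assms by (auto simp only: homeomorphic_map_maps)
  then show ?thesis by (auto simp only: homeomorphic_maps_map)
qed

lemma branch_point_homeomorphic_map_iff:
  assumes f: "homeomorphic_map X Y f" and x: "x \<in> topspace X"
  shows "branch_point Y (f x) \<longleftrightarrow> branch_point X x"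
proof -
  obtain g where "homeomorphic_map Y X g" "g (f x) = x"
    using homeomorphic_map_inverse[OF f] x by blast
  then show ?thesis
    using branch_point_homeomorphic_map[OF f] branch_point_homeomorphic_map[of Y X g "f x"] by auto
qed

lemma adjacent_homeomorphic_map:
  assumes f: "homeomorphic_map X Y f" and "adjacent X u v"
  shows "adjacent Y (f u) (f v)"
proof -
  obtain C where uv: "branch_point X u" "branch_point X v" "u \<noteq> v" and
    C: "connectedin X C" "\<forall>x\<in>C. \<not> branch_point X x" "u \<in> X closure_of C" "v \<in> X closure_of C"
    using assms(2) unfolding adjacent_def by blast
  have sub: "C \<subseteq> topspace X" "u \<in> topspace X" "v \<in> topspace X"
    using C(1) uv by (auto simp: connectedin branch_point_in_topspace)
  have "connectedin Y (f ` C)" using homeomorphic_map_connectedness[OF f sub(1)] C(1) by simp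
  moreover have "\<forall>y\<in>f ` C. \<not> branch_point Y y"
    using C(2) sub branch_point_homeomorphic_map_iff[OF f] by auto
  moreover have "f u \<in> Y closure_of (f ` C)" "f v \<in> Y closure_of (f ` C)"
    using homeomorphic_map_closure_of[OF f sub(1)] C by auto
  moreover have "f u \<noteq> f v"
    using homeomorphic_imp_injective_map[OF f] sub uv(3) by (auto dest: inj_onD)
  ultimately show ?thesis
    using uv branch_point_homeomorphic_map[OF f] unfolding adjacent_def by blast
qed

lemma triangle_homeomorphic_map:
  assumes "homeomorphic_map X Y f" "triangle X T"
  shows "triangle Y (f ` T)"
proof -
  obtain u v w where "T = {u, v, w}" "adjacent X u v" "adjacent X v w" "adjacent X u w"
    using assms(2) unfolding triangle_def by blast
  then show ?thesis
    unfolding triangle_def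
    by (intro exI[of _ "f u"] exI[of _ "f v"] exI[of _ "f w"])
      (simp add: adjacent_homeomorphic_map[OF assms(1)])
qed

lemma triangle_link_homeomorphic_map:
  assumes f: "homeomorphic_map X Y f" and "(T, T') \<in> triangle_link X"
  shows "(f ` T, f ` T') \<in> triangle_link Y"
proof -
  have T: "triangle X T" "triangle X T'" "T \<inter> T' = {}" "\<forall>u\<in>T. \<exists>v\<in>T'. adjacent X u v"
    using assms(2) by (auto simp: triangle_link_def)
  have "f ` T \<inter> f ` T' = {}"
    using inj_on_image_Int[OF homeomorphic_imp_injective_map[OF f]] T triangle_subset_topspace
    by (metis image_empty)
  then show ?thesis
    using T triangle_homeomorphic_map[OF f] adjacent_homeomorphic_map[OF f]
    by (fastforce simp: triangle_link_def)
qed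

lemma triangle_link_rtrancl_homeomorphic_map:
  assumes f: "homeomorphic_map X Y f" and "(T, T') \<in> (triangle_link X)\<^sup>*"
  shows "(f ` T, f ` T') \<in> (triangle_link Y)\<^sup>*"
  using assms(2)
proof induction
  case (step T' T'')
  then show ?case using triangle_link_homeomorphic_map[OF f] by (meson rtrancl.rtrancl_into_rtrancl)
qed auto

lemma triangle_link_rtrancl_triangle:
  assumes "(T, T') \<in> (triangle_link X)\<^sup>*" "triangle X T"
  shows "triangle X T'"
  using assms by induction (auto simp: triangle_link_def)

text \<open>The inverse map undoes \<open>f\<close> on the topspace, which contains all triangles;
  hence taking images under \<open>f\<close> maps each component bijectively onto a
  component.\<close>

lemma chain_sizes_mono_homeomorphic_map:
  assumes f: "homeomorphic_map X Y f"
  shows "chain_sizes X \<subseteq> chain_sizes Y"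
proof
  fix n assume "n \<in> chain_sizes X"
  then obtain T where T: "triangle X T" "n = card ((triangle_link X)\<^sup>* `` {T})"
    by (auto simp: chain_sizes_def)
  obtain g where g: "homeomorphic_map Y X g"
    and gf: "\<forall>x\<in>topspace X. g (f x) = x" and fg: "\<forall>y\<in>topspace Y. f (g y) = y"
    using homeomorphic_map_inverse[OF f] by blast
  have gfT: "g ` f ` T = T" if "triangle X T" for T
    using triangle_subset_topspace[OF that] gf by (force simp: image_image)
  have fgT: "f ` g ` T = T" if "triangle Y T" for T
    using triangle_subset_topspace[OF that] fg by (force simp: image_image)
  have "(triangle_link Y)\<^sup>* `` {f ` T} = image f ` ((triangle_link X)\<^sup>* `` {T})"
  proof (intro equalityI subsetI)
    fix S assume "S \<in> (triangle_link Y)\<^sup>* `` {f ` T}"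
    then have S: "(f ` T, S) \<in> (triangle_link Y)\<^sup>*" by simp
    then have "(T, g ` S) \<in> (triangle_link X)\<^sup>*"
      using triangle_link_rtrancl_homeomorphic_map[OF g S] gfT[OF T(1)] by simp
    moreover have "f ` g ` S = S"
      using fgT triangle_link_rtrancl_triangle[OF S] triangle_homeomorphic_map[OF f T(1)] by simp
    ultimately show "S \<in> image f ` ((triangle_link X)\<^sup>* `` {T})"
      by (metis ImageI image_eqI singletonI)
  next
    fix S assume "S \<in> image f ` ((triangle_link X)\<^sup>* `` {T})"
    then show "S \<in> (triangle_link Y)\<^sup>* `` {f ` T}"
      using triangle_link_rtrancl_homeomorphic_map[OF f] by auto
  qed
  moreover have "inj_on (image f) ((triangle_link X)\<^sup>* `` {T})"
    by (rule inj_on_inverseI[of _ "image g"]) (use gfT triangle_link_rtrancl_triangle T(1) in blast)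
  ultimately have "card ((triangle_link Y)\<^sup>* `` {f ` T}) = n"
    using T(2) by (simp add: card_image)
  then show "n \<in> chain_sizes Y"
    using triangle_homeomorphic_map[OF f T(1)] by (auto simp: chain_sizes_def)
qed

lemma chain_sizes_homeomorphic:
  assumes "X homeomorphic_space Y"
  shows "chain_sizes X = chain_sizes Y"
proof -
  obtain f where f: "homeomorphic_map X Y f" using assms by (auto simp: homeomorphic_space)
  obtain g where g: "homeomorphic_map Y X g" using homeomorphic_map_inverse[OF f] by blast
  show ?thesis
    using chain_sizes_mono_homeomorphic_map[OF f] chain_sizes_mono_homeomorphic_map[OF g] by blast
qed

text \<open>Pigeonhole: of the three sides of a branch point, two would meet the same connected piece.\<close>

lemma not_branch_pointI:
  assumes "\<And>U. openin X U \<Longrightarrow> x \<in> U \<Longrightarrow>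
    \<exists>W P Q. openin X W \<and> x \<in> W \<and> W \<subseteq> U \<and> W - {x} = P \<union> Q \<and> connectedin X P \<and> connectedin X Q"
  shows "\<not> branch_point X x"
proof
  assume "branch_point X x"
  then obtain U A B C where o: "openin X U" "openin X A" "openin X B" "openin X C" and
     U: "x \<in> U" "U - {x} = A \<union> B \<union> C" "A \<inter> B = {}" "A \<inter> C = {}" "B \<inter> C = {}" and
     cl: "x \<in> X closure_of A" "x \<in> X closure_of B" "x \<in> X closure_of C"
    unfolding branch_point_def by blast
  from assms[OF o(1) U(1)] obtain W P Q where W: "openin X W" "x \<in> W" "W \<subseteq> U" "W - {x} = P \<union> Q"
    and PQ: "connectedin X P" "connectedin X Q" by blast
  have sub: "P \<subseteq> A \<union> B \<union> C" "Q \<subseteq> A \<union> B \<union> C" using W U by blast+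
  have meet: "E \<inter> (P \<union> Q) \<noteq> {}" if E: "x \<in> X closure_of E" "E \<subseteq> U - {x}" for E
  proof -
    obtain y where "y \<in> E" "y \<in> W" using E(1) W(1,2) unfolding in_closure_of by blast
    then show ?thesis using E(2) W(4) by blast
  qed
  have m: "A \<inter> (P \<union> Q) \<noteq> {}" "B \<inter> (P \<union> Q) \<noteq> {}" "C \<inter> (P \<union> Q) \<noteq> {}"
    using meet[OF cl(1)] meet[OF cl(2)] meet[OF cl(3)] U(2) by auto
  have one: "R \<inter> E = {} \<or> R \<inter> (F \<union> G) = {}"
    if "connectedin X R" "R \<subseteq> E \<union> (F \<union> G)" "openin X E" "openin X F" "openin X G" "E \<inter> (F \<union> G) = {}" for R E F G
    using connectedinD[OF that(1,3) openin_Un[OF that(4,5)] that(2)] that(6) by blast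
  have "R \<inter> A = {} \<or> R \<inter> (B \<union> C) = {}" "R \<inter> B = {} \<or> R \<inter> (A \<union> C) = {}"
    if "connectedin X R" "R \<subseteq> A \<union> B \<union> C" for R
    using one[OF that(1), of A B C] one[OF that(1), of B A C] that(2) o U by blast+
  from this[OF PQ(1) sub(1)] this[OF PQ(2) sub(2)] m show False by blast
qed

section \<open>Local criteria: curves, arcs and convex neighbourhoods\<close>

lemma closure_of_top_of_set:
  "A \<subseteq> S \<Longrightarrow> top_of_set S closure_of A = S \<inter> closure A"
  by (simp add: closure_of_subtopology Int_absorb1)

text \<open>Used to show that a side accumulates at a branch point, and that an open edge
  accumulates at its two ends.\<close>

lemma path_ends_in_closure:
  fixes \<gamma> :: "real \<Rightarrow> 'a::topological_space"
  assumes "t0 < t1" "continuous_on {t0..t1} \<gamma>" "\<gamma> ` {t0<..<t1} \<subseteq> A"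
  shows "\<gamma> t0 \<in> closure A" "\<gamma> t1 \<in> closure A"
proof -
  have "\<gamma> ` closure {t0<..<t1} \<subseteq> closure A"
    using assms closure_subset
    by (intro image_closure_subset) (auto simp: intro: subsetD[OF closure_mono])
  then show "\<gamma> t0 \<in> closure A" "\<gamma> t1 \<in> closure A" using assms(1) by auto
qed

text \<open>The space is locally an arc, and \<open>\<xi>\<close> is a globally continuous left
  inverse of its parametrisation. It makes the images of small parameter intervals relatively open,
  and removing \<open>p\<close> leaves two subarcs.\<close>

lemma not_branch_point_arc:
  fixes \<gamma> :: "real \<Rightarrow> 'a::metric_space" and \<xi> :: "'a \<Rightarrow> real"
  assumes "open V" "S \<inter> V = \<gamma> ` {t0<..<t1}" and cont: "continuous_on {t0<..<t1} \<gamma>"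
    and \<xi>: "continuous_on UNIV \<xi>" "\<And>u. u \<in> {t0<..<t1} \<Longrightarrow> \<xi> (\<gamma> u) = u"
    and p: "p \<in> S" "p \<in> V"
  shows "\<not> branch_point (top_of_set S) p"
proof (rule not_branch_pointI)
  fix U assume U: "openin (top_of_set S) U" "p \<in> U"
  obtain v where v: "v \<in> {t0<..<t1}" "p = \<gamma> v" using assms(2) p by blast
  obtain e where e: "0 < e" "\<And>y. y \<in> S \<Longrightarrow> dist y p < e \<Longrightarrow> y \<in> U"
    using U by (auto simp: openin_euclidean_subtopology_iff)
  obtain h where h: "0 < h" "\<And>u. u \<in> {t0<..<t1} \<Longrightarrow> dist u v < h \<Longrightarrow> dist (\<gamma> u) (\<gamma> v) < e"
    using cont v(1) e(1) unfolding continuous_on_iff by blast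
  define I where "I = {max t0 (v - h)<..<min t1 (v + h)}"
  define W where "W = S \<inter> (V \<inter> \<xi> -` {v - h<..<v + h})"
  define P where "P = \<gamma> ` {max t0 (v - h)<..<v}"
  define Q where "Q = \<gamma> ` {v<..<min t1 (v + h)}"
  have W: "W = \<gamma> ` I"
  proof -
    have "W = {q \<in> S \<inter> V. \<xi> q \<in> {v - h<..<v + h}}" by (auto simp: W_def)
    also have "\<dots> = \<gamma> ` I" unfolding assms(2) using \<xi>(2) by (auto simp: I_def)
    finally show ?thesis .
  qed
  have "openin (top_of_set S) W"
    unfolding W_def by (intro openin_open_Int open_Int assms open_vimage[OF _ \<xi>(1)]) simp
  moreover have "p \<in> W" using v h(1) unfolding W by (auto simp: I_def)
  moreover have "W \<subseteq> U"
  proof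
    fix q assume q: "q \<in> W"
    then obtain u where "u \<in> I" "q = \<gamma> u" using W by blast
    moreover have "q \<in> S" using q by (simp add: W_def)
    ultimately show "q \<in> U" using e(2) h(2)[of u] v(2) by (auto simp: I_def dist_real_def)
  qed
  moreover have "W - {p} = P \<union> Q"
  proof -
    have "I - {v} = {max t0 (v - h)<..<v} \<union> {v<..<min t1 (v + h)}"
      using v(1) h(1) by (auto simp: I_def)
    moreover have "inj_on \<gamma> I"
      by (rule inj_on_inverseI[of _ \<xi>]) (use \<xi>(2) in \<open>auto simp: I_def\<close>)
    then have "\<gamma> ` I - {p} = \<gamma> ` (I - {v})"
      using v h(1) inj_on_image_set_diff[of \<gamma> I I "{v}"] by (auto simp: I_def)
    ultimately show ?thesis by (auto simp: W P_def Q_def image_Un)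
  qed
  moreover have "P \<subseteq> S" "Q \<subseteq> S"
    using assms(2) v by (auto simp: P_def Q_def)
  moreover have "connected P" "connected Q"
    unfolding P_def Q_def by (rule connected_continuous_image;
      use v in \<open>auto intro!: continuous_on_subset[OF cont] connected_Ioo\<close>)+
  ultimately show "\<exists>W P Q. openin (top_of_set S) W \<and> p \<in> W \<and> W \<subseteq> U \<and> W - {p} = P \<union> Q \<and>
      connectedin (top_of_set S) P \<and> connectedin (top_of_set S) Q"
    by (intro exI[of _ W] exI[of _ P] exI[of _ Q]) (simp add: connectedin_subtopology)
qed

text \<open>A point splits a convex neighbourhood into two convex sets, its lexicographic predecessors and
  successors. In contrast to a dimension argument, this treats segments, discs and balls alike, and it
  still works at the ends of a disc, where the space is not locally convex.\<close>

fun lex_less :: "R4 \<Rightarrow> R4 \<Rightarrow> bool" where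
  "lex_less (x, y, z, w) (x', y', z', w') \<longleftrightarrow>
     x < x' \<or> x = x' \<and> (y < y' \<or> y = y' \<and> (z < z' \<or> z = z' \<and> w < w'))"

lemma lex_less_linear: "p = q \<or> lex_less p q \<or> lex_less q p"
  by (cases p; cases q; auto)

lemma lex_less_irrefl: "\<not> lex_less p p"
  by (cases p; auto)

lemma convex_less_comb:
  fixes x u v :: real
  assumes "x < u" "x \<le> v" "0 < l" "0 \<le> m" "l + m = 1"
  shows "x < l * u + m * v"
proof -
  have "x = l * x + m * x" using assms by (simp flip: distrib_right)
  also have "\<dots> < l * u + m * v" using assms by (intro add_less_le_mono mult_left_mono) auto
  finally show ?thesis .
qed

text \<open>At each coordinate, either the combination is already strictly larger than that of
  \<open>p\<close>, or both points agree with \<open>p\<close> there and the next coordinate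
  decides.\<close>

lemma convex_lex_greater: "convex {q. lex_less p q}"
proof (rule convexI)
  fix q r :: R4 and l m :: real
  assume q: "q \<in> {q. lex_less p q}" and r: "r \<in> {q. lex_less p q}" and lm: "0 \<le> l" "0 \<le> m" "l + m = 1"
  have comb: "x < l * u + m * v" if "x < u \<and> x \<le> v \<or> x \<le> u \<and> x < v" "0 < l" "0 < m" for x u v :: real
    using that convex_less_comb[of x u v l m] convex_less_comb[of x v u m l] lm by (auto simp: add.commute)
  have eq: "l * x + m * x = x" for x using lm by (simp flip: distrib_right)
  show "l *\<^sub>R q + m *\<^sub>R r \<in> {q. lex_less p q}"
  proof (cases "l = 0 \<or> m = 0")
    case True
    then show ?thesis using q r lm by auto
  next
    case False
    then have pos: "0 < l" "0 < m" using lm by auto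
    obtain x y z w x1 y1 z1 w1 x2 y2 z2 w2 where
      e: "p = (x, y, z, w)" "q = (x1, y1, z1, w1)" "r = (x2, y2, z2, w2)"
      by (cases p; cases q; cases r) auto
    have step: "x < l * u + m * v \<or> x = u \<and> x = v" if "x \<le> u" "x \<le> v" for x u v :: real
      using comb[of x u v] that pos by linarith
    show ?thesis using q r step[of x x1 x2] step[of y y1 y2] step[of z z1 z2] comb[of w w1 w2] pos eq
      by (auto simp: e)
  qed
qed

lemma convex_lex_smaller: "convex {q. lex_less q p}"
proof -
  have "lex_less (- p) (- q) \<longleftrightarrow> lex_less q p" for q by (cases p; cases q; auto)
  then have "{q. lex_less q p} = uminus -` {q. lex_less (- p) q}" by auto
  then show ?thesis
    using convex_linear_vimage[OF linear_uminus convex_lex_greater[of "- p"]] by simp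
qed

text \<open>\<open>C\<close> and \<open>D\<close> may differ: at an end of a disc or ball, the space
  looks like the disc or ball on one side of \<open>p\<close> and like the axis on the
  other.\<close>

lemma not_branch_point_convex:
  fixes S :: "R4 set"
  assumes p: "p \<in> S" and "0 < \<delta>" and "convex C" "convex D"
    and C: "\<And>q. dist p q < \<delta> \<Longrightarrow> lex_less p q \<Longrightarrow> q \<in> S \<longleftrightarrow> q \<in> C"
    and D: "\<And>q. dist p q < \<delta> \<Longrightarrow> lex_less q p \<Longrightarrow> q \<in> S \<longleftrightarrow> q \<in> D"
  shows "\<not> branch_point (top_of_set S) p"
proof (rule not_branch_pointI)
  fix U assume U: "openin (top_of_set S) U" "p \<in> U"
  obtain e where e: "0 < e" "\<And>y. y \<in> S \<Longrightarrow> dist y p < e \<Longrightarrow> y \<in> U"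
    using U by (auto simp: openin_euclidean_subtopology_iff)
  define r where "r = min e \<delta>"
  define W where "W = S \<inter> ball p r"
  define P where "P = C \<inter> ball p r \<inter> {q. lex_less p q}"
  define Q where "Q = D \<inter> ball p r \<inter> {q. lex_less q p}"
  have "openin (top_of_set S) W" unfolding W_def by (intro openin_open_Int open_ball)
  moreover have "p \<in> W" using p e(1) assms(2) by (simp add: W_def r_def)
  moreover have "W \<subseteq> U" using e(2) by (auto simp: W_def r_def dist_commute)
  moreover have PQ: "W - {p} = P \<union> Q"
  proof (rule set_eqI)
    fix q
    show "q \<in> W - {p} \<longleftrightarrow> q \<in> P \<union> Q"
      using C[of q] D[of q] lex_less_linear[of p q] lex_less_irrefl[of p]
      by (auto simp: W_def P_def Q_def r_def)
  qed
  moreover have "convex P" "convex Q"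
    unfolding P_def Q_def
    by (intro convex_Int convex_ball convex_lex_greater convex_lex_smaller assms)+
  then have "connected P" "connected Q" by (auto simp: convex_connected)
  moreover have "P \<subseteq> S" "Q \<subseteq> S" using PQ by (auto simp: W_def)
  ultimately show "\<exists>W P Q. openin (top_of_set S) W \<and> p \<in> W \<and> W \<subseteq> U \<and> W - {p} = P \<union> Q \<and>
      connectedin (top_of_set S) P \<and> connectedin (top_of_set S) Q"
    by (intro exI[of _ W] exI[of _ P] exI[of _ Q]) (simp add: connectedin_subtopology)
qed

text \<open>One statement for both rays, with the disc or the ball as the bead \<open>D\<close> and
  \<open>c0\<close>, \<open>c1\<close> as the ends of its diameter. The decisive property in
  \<open>bd\<close> is that \<open>D\<close> meets the hyperplanes through its ends only on the
  axis.\<close>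

lemma not_branch_point_beaded_axis:
  fixes S R D :: "R4 set" and c0 c1 :: real
  assumes R: "open R" "\<And>q. q \<in> R \<Longrightarrow> q \<in> S \<longleftrightarrow> q \<in> D \<or> q \<in> bullseye_axis"
    and D: "convex D" "closed D" and c: "c0 < c1"
    and sub: "\<And>u. c0 \<le> u \<Longrightarrow> u \<le> c1 \<Longrightarrow> (u, 0, 0, 0) \<in> D"
    and bd: "\<And>x y z w. (x, y, z, w) \<in> D \<Longrightarrow> c0 \<le> x \<and> x \<le> c1 \<and> (x = c0 \<or> x = c1 \<longrightarrow> y = 0 \<and> z = 0 \<and> w = 0)"
    and p: "p \<in> S" "p \<in> R"
  shows "\<not> branch_point (top_of_set S) p"
proof -
  have ball: "\<exists>\<delta>>0. \<forall>q. dist p q < \<delta> \<longrightarrow> q \<in> V" if "open V" "p \<in> V" for V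
    using that by (meson open_contains_ball mem_ball subsetD)
  obtain \<rho> where \<rho>: "0 < \<rho>" "\<And>q. dist p q < \<rho> \<Longrightarrow> q \<in> R" using ball R(1) p(2) by blast
  note axis = convex_bullseye_pieces(1) closed_bullseye_pieces(1)
  show ?thesis
  proof (cases "p \<in> bullseye_axis")
    case False
    then obtain \<delta> where \<delta>: "0 < \<delta>" "\<And>q. dist p q < \<delta> \<Longrightarrow> q \<notin> bullseye_axis"
      using ball[of "- bullseye_axis"] axis by (auto simp: open_Compl)
    show ?thesis
      by (rule not_branch_point_convex[where \<delta> = "min \<rho> \<delta>", OF p(1) _ D(1) D(1)]) (use \<rho> \<delta> R(2) in auto)
  next
    case True
    then obtain u where u: "p = (u, 0, 0, 0)" by (auto simp: bullseye_axis_def)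
    have lex: "lex_less p q \<longleftrightarrow> u < fst q" "lex_less q p \<longleftrightarrow> fst q < u"
      if "q \<in> bullseye_axis" for q
      using that by (auto simp: bullseye_axis_def u)
    have near: "\<bar>fst q - u\<bar> < r" if "dist p q < r" for q r
      using dist_fst_le[of p q] that by (simp add: u dist_real_def abs_minus_commute)
    have axis_D: "q \<in> D" if "q \<in> bullseye_axis" "c0 \<le> fst q" "fst q \<le> c1" for q
      using that sub by (auto simp: bullseye_axis_def)
    have D_lex: "c0 \<le> fst q" "fst q \<le> c1" "fst q = c0 \<or> fst q = c1 \<Longrightarrow> q \<in> bullseye_axis"
      "lex_less p q \<Longrightarrow> u \<le> fst q" "lex_less q p \<Longrightarrow> fst q \<le> u" if "q \<in> D" for q
      using that bd[of "fst q" "fst (snd q)" "fst (snd (snd q))" "snd (snd (snd q))"]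
      by (cases q; auto simp: u mem_bullseye_axis)+
    \<comment> \<open>Outside the bead the space is locally the axis, inside it is locally
      \<open>D\<close>; only at the two ends do the sides differ.\<close>
    consider "u < c0 \<or> c1 < u" | "c0 < u" "u < c1" | "u = c0" | "u = c1" by linarith
    then show ?thesis
    proof cases
      case 1
      then have "p \<notin> D" using bd[of u 0 0 0] by (auto simp: u)
      then obtain \<delta> where \<delta>: "0 < \<delta>" "\<And>q. dist p q < \<delta> \<Longrightarrow> q \<notin> D"
        using ball[of "- D"] D by (auto simp: open_Compl)
      show ?thesis
        by (rule not_branch_point_convex[where \<delta> = "min \<rho> \<delta>", OF p(1) _ axis(1) axis(1)])
          (use \<rho> \<delta> R(2) in auto)
    next
      case 2
      have "q \<in> S \<longleftrightarrow> q \<in> D" if "dist p q < min \<rho> (min (u - c0) (c1 - u))" for q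
        using R(2)[OF \<rho>(2)[of q]] axis_D[of q] near[of q "min (u - c0) (c1 - u)"] that by auto
      then show ?thesis
        by (intro not_branch_point_convex[where \<delta> = "min \<rho> (min (u - c0) (c1 - u))", OF p(1) _ D(1) D(1)])
          (use \<rho> 2 in auto)
    next
      case 3
      show ?thesis
      proof (rule not_branch_point_convex[where \<delta> = "min \<rho> (c1 - c0)", OF p(1) _ D(1) axis(1)])
        fix q assume q: "dist p q < min \<rho> (c1 - c0)"
        show "q \<in> S \<longleftrightarrow> q \<in> D" if "lex_less p q"
          using R(2)[OF \<rho>(2)[of q]] axis_D[of q] lex[of q] near[of q "c1 - c0"] q that 3 by auto
        \<comment> \<open>A predecessor of \<open>p\<close> in \<open>D\<close> would have first
          coordinate exactly \<open>c0\<close>, hence would lie on the axis.\<close>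
        show "q \<in> S \<longleftrightarrow> q \<in> bullseye_axis" if "lex_less q p"
          using R(2)[OF \<rho>(2)[of q]] D_lex[of q] lex[of q] q that 3 by force
      qed (use c \<rho> in auto)
    next
      case 4
      show ?thesis
      proof (rule not_branch_point_convex[where \<delta> = "min \<rho> (c1 - c0)", OF p(1) _ axis(1) D(1)])
        fix q assume q: "dist p q < min \<rho> (c1 - c0)"
        show "q \<in> S \<longleftrightarrow> q \<in> D" if "lex_less q p"
          using R(2)[OF \<rho>(2)[of q]] axis_D[of q] lex[of q] near[of q "c1 - c0"] q that 4 by auto
        show "q \<in> S \<longleftrightarrow> q \<in> bullseye_axis" if "lex_less p q"
          using R(2)[OF \<rho>(2)[of q]] D_lex[of q] lex[of q] q that 4 by force
      qed (use c \<rho> in auto)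
    qed
  qed
qed

section \<open>Branch points of bullseye spaces\<close>

definition active :: "(int \<Rightarrow> nat) \<Rightarrow> int \<Rightarrow> bool" where
  "active b k \<longleftrightarrow> b (k - 1) = 1 \<or> b k = 1"

text \<open>Every index other than 0 and 1 gives the point on the y-axis;
  \<open>vertex_index\<close> restores uniqueness of the index and records when that point is a
  branch point.\<close>

definition vert :: "int \<Rightarrow> nat \<Rightarrow> R4" where
  "vert k i = (if i = 0 then (2 powi k, 0, 0, 0) else if i = 1 then (- (2 powi k), 0, 0, 0)
     else (0, 2 powi k, 0, 0))"

definition vertex_index :: "(int \<Rightarrow> nat) \<Rightarrow> int \<Rightarrow> nat \<Rightarrow> bool" where
  "vertex_index b k i \<longleftrightarrow> i = 0 \<or> i = 1 \<or> i = 2 \<and> active b k"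

lemma vert_simps [simp]: "vert k 0 = (2 powi k, 0, 0, 0)" "vert k (Suc 0) = (- (2 powi k), 0, 0, 0)"
  "vert k 2 = (0, 2 powi k, 0, 0)"
  by (simp_all add: vert_def)

lemma norm_vert: "norm (vert k i) = 2 powi k"
  by (simp add: vert_def norm_R4)

lemma vert_eq_iff:
  assumes "vertex_index b k i" "vertex_index b' l j"
  shows "vert k i = vert l j \<longleftrightarrow> k = l \<and> i = j"
proof
  assume eq: "vert k i = vert l j"
  then have "(2::real) powi k = 2 powi l" by (metis norm_vert)
  then have "k = l" by (simp add: powi2_eq_iff)
  moreover have pos: "0 < (2::real) powi l" by simp
  then have "(2::real) powi l \<noteq> - (2 powi l)" by linarith
  then have "i = j" using eq assms \<open>k = l\<close> pos by (auto simp: vertex_index_def)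
  ultimately show "k = l \<and> i = j" ..
qed auto

lemma R4_exhaust: obtains x y z w where "p = (x, y, z, w :: real)"
  by (cases p) auto

lemma norm_axis: "norm (x, 0::real, 0::real, 0::real) = \<bar>x\<bar>"
  "norm (x, 0::real, 0::real) = \<bar>x\<bar>" "norm (0::real, x, 0::real, 0::real) = \<bar>x\<bar>" for x :: real
  by (simp_all add: norm_R4) (simp add: norm_Pair)

lemma norm_semicircle: "\<bar>u\<bar> \<le> r \<Longrightarrow> norm (u, c * sqrt (r\<^sup>2 - u\<^sup>2), 0::real, 0::real) = r"
  "\<bar>u\<bar> \<le> r \<Longrightarrow> norm (c * sqrt (r\<^sup>2 - u\<^sup>2), u, 0::real, 0::real) = r"
  if "c = 1 \<or> c = -1" for u r c :: real
proof -
  assume "\<bar>u\<bar> \<le> r"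
  then have "u\<^sup>2 \<le> r\<^sup>2" "0 \<le> r" by (auto simp: abs_le_square_iff[symmetric])
  moreover have "c\<^sup>2 = 1" using that by auto
  ultimately show "norm (u, c * sqrt (r\<^sup>2 - u\<^sup>2), 0::real, 0::real) = r"
    "norm (c * sqrt (r\<^sup>2 - u\<^sup>2), u, 0::real, 0::real) = r"
    by (auto simp: norm_R4 power_mult_distrib)
qed

locale bullseye_space =
  fixes s t :: real and b :: "int \<Rightarrow> nat"
  assumes st: "1 < s" "s < t" "t < 2"
begin

abbreviation "Y \<equiv> bullseye s t b"

section \<open>Which pieces meet a given region\<close>

lemma axis_mem: "(x, 0, 0, 0) \<in> Y"
  by (simp add: bullseye_def mem_bullseye_axis)

lemma circle_mem: "norm (x, y, 0::real, 0::real) = 2 powi k \<Longrightarrow> (x, y, 0, 0) \<in> Y"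
  unfolding bullseye_def using mem_bullseye_circle[of x y 0 0 k] by blast

lemma bridge_mem: "b k = 1 \<Longrightarrow> 2 powi k \<le> y \<Longrightarrow> y \<le> 2 powi (k + 1) \<Longrightarrow> (0, y, 0, 0) \<in> Y"
  unfolding bullseye_def using mem_bullseye_bridge[of 0 y 0 0 k] by blast

text \<open>Discs and balls come with strict norm bounds and the sign of \<open>x\<close>, so that
  cases at the wrong level or on the wrong side are discarded by arithmetic.\<close>

lemma bullseye_memE:
  assumes "(x, y, z, w) \<in> Y"
  obtains (axis) "y = 0" "z = 0" "w = 0"
  | (circle) k where "z = 0" "w = 0" "norm (x, y, z, w) = 2 powi k"
  | (disc) k where "(x, y, z, w) \<in> bullseye_disc s t k" "y = 0" "0 < x"
      "2 powi k < norm (x, y, z, w)" "norm (x, y, z, w) < 2 powi (k + 1)"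
  | (ball) k where "(x, y, z, w) \<in> bullseye_ball s t k" "y = 0" "x < 0"
      "2 powi k < norm (x, y, z, w)" "norm (x, y, z, w) < 2 powi (k + 1)"
  | (bridge) k where "b k = 1" "x = 0" "z = 0" "w = 0" "2 powi k \<le> y" "y \<le> 2 powi (k + 1)"
proof -
  have lt: "2 powi k < 2 powi k * s" "2 powi k * t < 2 powi (k + 1)" "0 < 2 powi k * s" for k
    using st by (auto simp: powi_Suc_real)
  consider "(x, y, z, w) \<in> bullseye_axis" | k where "(x, y, z, w) \<in> bullseye_circle k"
    | k where "(x, y, z, w) \<in> bullseye_disc s t k" | k where "(x, y, z, w) \<in> bullseye_ball s t k"
    | k where "b k = 1" "(x, y, z, w) \<in> bullseye_bridge k"
    using assms by (auto simp: bullseye_def)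
  then show ?thesis
  proof cases
    case 1
    then show ?thesis using axis by (simp add: mem_bullseye_axis)
  next
    case (2 k)
    then show ?thesis unfolding mem_bullseye_circle using circle by blast
  next
    case (3 k)
    from mem_disc_bounds[OF st 3] show ?thesis using disc[OF 3] lt[of k] by linarith
  next
    case (4 k)
    from mem_ball_bounds[OF st 4] show ?thesis using ball[OF 4] lt[of k] by linarith
  next
    case (5 k)
    then show ?thesis using bridge by (simp add: mem_bullseye_bridge)
  qed
qed

text \<open>The last hypothesis excludes the axis, discs and balls because \<open>y\<close> is
  nonzero, and bridges because \<open>x\<close> is nonzero, \<open>y\<close> is negative or no
  bridge touches the level. Only the circle remains.\<close>

lemma mem_circle_level:
  assumes "(x, y, z, w) \<in> Y" "2 powi (k - 1) < norm (x, y, z, w)" "norm (x, y, z, w) < 2 powi (k + 1)"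
    and "y \<noteq> 0 \<and> x \<noteq> 0 \<or> y < 0 \<or> 0 < y \<and> \<not> active b k"
  shows "z = 0 \<and> w = 0 \<and> norm (x, y, z, w) = 2 powi k"
  using assms(1)
proof (cases rule: bullseye_memE)
  case (circle j)
  then show ?thesis using powi2_between[of k j] assms(2,3) by simp
next
  case (bridge j)
  have pos: "0 < (2::real) powi j" by simp
  then have y: "0 < y" using bridge by linarith
  then have na: "\<not> active b k" using assms(4) bridge by auto
  have n: "norm (x, y, z, w) = y" using bridge y by (simp add: norm_axis)
  have "(2::real) powi (k - 1) < 2 powi (j + 1)" "(2::real) powi j < 2 powi (k + 1)"
    using assms(2,3) n bridge by linarith+
  then have "j = k \<or> j = k - 1" by (auto simp: powi2_less_iff)
  then show ?thesis using na bridge(1) by (auto simp: active_def)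
qed (use assms in auto)

lemma mem_bridge_level:
  assumes "(x, y, z, w) \<in> Y" "2 powi k < norm (x, y, z, w)" "norm (x, y, z, w) < 2 powi (k + 1)" "y \<noteq> 0"
  shows "b k = 1 \<and> x = 0 \<and> z = 0 \<and> w = 0 \<and> y = norm (x, y, z, w)"
  using assms(1)
proof (cases rule: bullseye_memE)
  case (circle j)
  then show ?thesis using powi2_not_between[of k j] assms(2,3) by simp
next
  case (bridge j)
  have pos: "0 < (2::real) powi j" by simp
  then have y: "0 < y" using bridge by linarith
  have n: "norm (x, y, z, w) = y" using bridge y by (simp add: norm_axis)
  have "(2::real) powi k < 2 powi (j + 1)" "(2::real) powi j < 2 powi (k + 1)"
    using assms(2,3) n bridge by linarith+
  then have "j = k" by (auto simp: powi2_less_iff)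
  then show ?thesis using bridge n by simp
qed (use assms in auto)

lemma mem_axis_level:
  assumes "(x, 0, z, w) \<in> Y" "norm (x, 0::real, z, w) = 2 powi k"
  shows "(x, 0, z, w) = vert k 0 \<or> (x, 0, z, w) = vert k 1"
  using assms(1)
proof (cases rule: bullseye_memE)
  case axis
  then show ?thesis using assms(2) by (auto simp: norm_axis)
next
  case (circle j)
  then show ?thesis using assms(2) by (auto simp: norm_axis)
next
  case (disc j)
  then show ?thesis using powi2_not_between[of j k] assms(2) by simp
next
  case (ball j)
  then show ?thesis using powi2_not_between[of j k] assms(2) by simp
next
  case (bridge j)
  have "0 < (2::real) powi j" by simp
  then show ?thesis using bridge by linarith
qed

lemma mem_y_axis_level:
  assumes "(0, y, z, w) \<in> Y" "norm (0::real, y, z, w) = 2 powi k"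
  shows "z = 0 \<and> w = 0 \<and> \<bar>y\<bar> = 2 powi k"
  using assms(1)
proof (cases rule: bullseye_memE)
  case axis
  then show ?thesis using assms(2) by (simp add: norm_axis)
next
  case (circle j)
  then show ?thesis using assms(2) by (auto simp: norm_axis)
next
  case (bridge j)
  then show ?thesis using assms(2) by (auto simp: norm_axis)
qed (use assms in auto)

lemma mem_x_nonzero:
  assumes "(x, 0, z, w) \<in> Y" "(x, 0::real, z, w) \<noteq> 0"
  shows "x \<noteq> 0"
  using assms(1)
proof (cases rule: bullseye_memE)
  case axis
  then show ?thesis using assms(2) by (auto simp: zero_prod_def)
next
  case (circle j)
  then show ?thesis using assms(2) by (auto simp: zero_prod_def)
next
  case (bridge j)
  have "0 < (2::real) powi j" by simp
  then show ?thesis using bridge by linarith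
qed auto

section \<open>Existence of branch points\<close>

lemma open_shell: "open {q::R4. r < norm q \<and> norm q < r' \<and> 0 < c * fst q}"
  "open {q::R4. r < norm q \<and> norm q < r' \<and> 0 < c * fst (snd q)}"
  by (intro open_Collect_conj open_Collect_less continuous_intros)+

text \<open>The three sides are the outward part of the ray, its inward part, and both arcs of the
  circle taken together; the norm separates them.\<close>

lemma branch_point_axis:
  assumes \<sigma>: "\<sigma> = 1 \<or> \<sigma> = -1"
  shows "branch_point (top_of_set Y) (\<sigma> * 2 powi k, 0, 0, 0)"
proof -
  let ?v = "(\<sigma> * 2 powi k, 0, 0, 0) :: R4"
  define V where "V = {q::R4. 2 powi (k - 1) < norm q \<and> norm q < 2 powi (k + 1) \<and> 0 < \<sigma> * fst q}"
  let ?A = "Y \<inter> (V \<inter> {q. 2 powi k < norm q})" and ?B = "Y \<inter> (V \<inter> {q. norm q < 2 powi k})"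
    and ?C = "Y \<inter> (V \<inter> {q. fst (snd q) \<noteq> 0})"
  have V: "open V" unfolding V_def by (rule open_shell)
  have pos: "0 < (2::real) powi k" by simp
  have \<sigma>': "\<bar>\<sigma>\<bar> = 1" "0 < \<sigma> * (\<sigma> * u) \<longleftrightarrow> 0 < u" for u using \<sigma> by auto
  have circle: "norm q = 2 powi k" if "q \<in> ?C" for q
  proof -
    have "fst q \<noteq> 0" using that by (auto simp: V_def)
    then show ?thesis
      using that mem_circle_level[of "fst q" "fst (snd q)" "fst (snd (snd q))" "snd (snd (snd q))" k]
      by (auto simp: V_def)
  qed
  have vert: "q = ?v" if q: "q \<in> Y" "q \<in> V" "norm q = 2 powi k" "fst (snd q) = 0" for q
  proof -
    obtain x z w where "q = (x, 0, z, w)" using q(4) by (cases q) auto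
    then show ?thesis
      using mem_axis_level[of x z w k] q(1,2,3) \<sigma> less_not_sym[OF pos]
      by (auto simp: V_def zero_less_mult_iff)
  qed
  have "openin (top_of_set Y) (Y \<inter> V)" "openin (top_of_set Y) ?A" "openin (top_of_set Y) ?B" "openin (top_of_set Y) ?C"
    by (intro openin_open_Int V open_Int open_Collect_less open_Collect_neq continuous_intros)+
  moreover have "?v \<in> Y \<inter> V"
    using \<sigma>' powi2_step[of k] axis_mem by (simp add: V_def norm_axis abs_mult)
  moreover have "Y \<inter> V - {?v} = ?A \<union> ?B \<union> ?C"
  proof -
    have "?v \<notin> ?A \<union> ?B \<union> ?C" using \<sigma>' by (simp add: norm_axis abs_mult)
    moreover have "q \<in> ?A \<union> ?B \<union> ?C" if "q \<in> Y \<inter> V" "q \<noteq> ?v" for q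
      using that vert[of q] by auto
    ultimately show ?thesis by blast
  qed
  moreover have "?A \<inter> ?B = {}" "?A \<inter> ?C = {}" "?B \<inter> ?C = {}" using circle by fastforce+
  moreover have "?v \<in> closure ?A"
  proof -
    let ?g = "\<lambda>u. (\<sigma> * u, 0, 0, 0) :: R4"
    have "?g u \<in> ?A" if u: "u \<in> {2 powi k<..<2 powi (k + 1)}" for u
    proof -
      have "0 < u" using less_trans[OF pos, of u] u by simp
      then show ?thesis using u \<sigma>' powi2_step[of k] axis_mem by (simp add: V_def norm_axis abs_mult)
    qed
    then show ?thesis
      using path_ends_in_closure(1)[OF powi2_step(2)[of k], of ?g ?A]
      by (force intro: continuous_intros)
  qed
  moreover have "?v \<in> closure ?B"
  proof -
    let ?g = "\<lambda>u. (\<sigma> * u, 0, 0, 0) :: R4"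
    have "?g u \<in> ?B" if u: "u \<in> {2 powi (k - 1)<..<2 powi k}" for u
    proof -
      have "0 < u" using less_trans[of 0 "2 powi (k - 1)" u] u by simp
      then show ?thesis using u \<sigma>' powi2_step[of k] axis_mem by (simp add: V_def norm_axis abs_mult)
    qed
    then show ?thesis
      using path_ends_in_closure(2)[OF powi2_step(1)[of k], of ?g ?B]
      by (force intro: continuous_intros)
  qed
  moreover have "?v \<in> closure ?C"
  proof -
    let ?r = "2 powi k :: real"
    let ?g = "\<lambda>u. (\<sigma> * sqrt (?r\<^sup>2 - u\<^sup>2), u, 0, 0) :: R4"
    have "?g u \<in> ?C" if u: "u \<in> {0<..<?r}" for u
    proof -
      have n: "norm (?g u) = ?r" using u by (intro norm_semicircle \<sigma>) auto
      have "u\<^sup>2 < ?r\<^sup>2" using u by (intro power_strict_mono) auto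
      then have "0 < \<sigma> * fst (?g u)" using \<sigma>' by simp
      then show ?thesis using n u powi2_step[of k] circle_mem[OF n] by (simp add: V_def)
    qed
    then show ?thesis
      using path_ends_in_closure(1)[OF pos, of ?g ?C] by (force intro: continuous_intros)
  qed
  ultimately show ?thesis
    unfolding branch_point_def
    by (intro exI[of _ "Y \<inter> V"] exI[of _ ?A] exI[of _ ?B] exI[of _ ?C])
      (simp add: closure_of_top_of_set)
qed

text \<open>The sides are the right arc, the left arc, and the bridge or bridges ending at the
  point; activity of the level makes the third side accumulate there.\<close>

lemma branch_point_bridge:
  assumes "active b k"
  shows "branch_point (top_of_set Y) (0, 2 powi k, 0, 0)"
proof -
  let ?v = "(0, 2 powi k, 0, 0) :: R4"
  define V where "V = {q::R4. 2 powi (k - 1) < norm q \<and> norm q < 2 powi (k + 1) \<and> 0 < 1 * fst (snd q)}"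
  let ?A = "Y \<inter> (V \<inter> {q. 0 < fst q})" and ?B = "Y \<inter> (V \<inter> {q. fst q < 0})"
    and ?C = "Y \<inter> (V \<inter> {q. norm q \<noteq> 2 powi k})"
  have V: "open V" unfolding V_def by (rule open_shell)
  have pos: "0 < (2::real) powi k" by simp
  have circle: "norm q = 2 powi k" if "q \<in> Y" "q \<in> V" "fst q \<noteq> 0" for q
    using that mem_circle_level[of "fst q" "fst (snd q)" "fst (snd (snd q))" "snd (snd (snd q))" k]
    by (auto simp: V_def)
  have vert: "q = ?v" if q: "q \<in> Y" "q \<in> V" "norm q = 2 powi k" "fst q = 0" for q
  proof -
    obtain y z w where "q = (0, y, z, w)" using q(4) by (cases q) auto
    then show ?thesis
      using mem_y_axis_level[of y z w k] q(1,2,3) pos by (auto simp: V_def)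
  qed
  have "openin (top_of_set Y) (Y \<inter> V)" "openin (top_of_set Y) ?A" "openin (top_of_set Y) ?B" "openin (top_of_set Y) ?C"
    by (intro openin_open_Int V open_Int open_Collect_less open_Collect_neq continuous_intros)+
  moreover have n: "norm ?v = 2 powi k" by (simp add: norm_axis)
  moreover have "?v \<in> Y \<inter> V"
    using powi2_step[of k] circle_mem[OF n] n by (simp add: V_def)
  moreover have "Y \<inter> V - {?v} = ?A \<union> ?B \<union> ?C"
  proof -
    have "?v \<notin> ?A \<union> ?B \<union> ?C" using n by simp
    moreover have "q \<in> ?A \<union> ?B \<union> ?C" if "q \<in> Y \<inter> V" "q \<noteq> ?v" for q
      using that vert[of q] by (auto simp: linorder_neq_iff[of "fst q"])
    ultimately show ?thesis by blast
  qed
  moreover have "?A \<inter> ?B = {}" "?A \<inter> ?C = {}" "?B \<inter> ?C = {}" using circle by force+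
  \<comment> \<open>Both arcs at once: \<open>c\<close> is the sign of the first coordinate, and the
    parameter runs to the top of the circle.\<close>
  moreover have side: "?v \<in> closure E"
    if c: "c = 1 \<or> c = -1" and E: "\<And>q. q \<in> Y \<Longrightarrow> q \<in> V \<Longrightarrow> 0 < c * fst q \<Longrightarrow> q \<in> E" for c E
  proof -
    let ?r = "2 powi k :: real"
    let ?g = "\<lambda>u. (c * u, 1 * sqrt (?r\<^sup>2 - (c * u)\<^sup>2), 0, 0) :: R4"
    have c': "c * c = 1" "\<bar>c\<bar> = 1" using c by auto
    have "?g u \<in> E" if u: "u \<in> {0<..<?r}" for u
    proof -
      have n: "norm (?g u) = ?r" using u c' by (intro norm_semicircle) (auto simp: abs_mult)
      have "u\<^sup>2 < ?r\<^sup>2" using u by (intro power_strict_mono) auto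
      moreover have "(c * u)\<^sup>2 = u\<^sup>2" using c by auto
      ultimately have "0 < fst (snd (?g u))" by simp
      then have "?g u \<in> V" using n powi2_step[of k] by (simp add: V_def)
      moreover have "0 < c * fst (?g u)" using u c' by (simp flip: mult.assoc)
      ultimately show ?thesis using circle_mem[OF n] E by blast
    qed
    then have "?g 0 \<in> closure E"
      using path_ends_in_closure(1)[OF pos, of ?g E] by (force intro: continuous_intros)
    then show ?thesis by simp
  qed
  have "?v \<in> closure ?A" "?v \<in> closure ?B" by (rule side[of 1] side[of "-1"]; auto)+
  moreover have "?v \<in> closure ?C"
  proof -
    let ?g = "\<lambda>u. (0, u, 0, 0) :: R4"
    consider "b k = 1" | "b (k - 1) = 1" using assms by (auto simp: active_def)
    then show ?thesis
    proof cases
      case 1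
      have "?g u \<in> ?C" if u: "u \<in> {2 powi k<..<2 powi (k + 1)}" for u
      proof -
        have "0 < u" using less_trans[OF pos, of u] u by simp
        then show ?thesis using u bridge_mem[OF 1, of u] powi2_step[of k] by (auto simp: V_def norm_axis)
      qed
      then show ?thesis
        using path_ends_in_closure(1)[OF powi2_step(2)[of k], of ?g ?C]
        by (force intro: continuous_intros)
    next
      case 2
      have "?g u \<in> ?C" if u: "u \<in> {2 powi (k - 1)<..<2 powi k}" for u
      proof -
        have "0 < (2::real) powi (k - 1)" by simp
        then have "0 < u" using less_trans[of 0 "2 powi (k - 1)" u] u by simp
        then show ?thesis using u bridge_mem[OF 2, of u] powi2_step[of k] by (auto simp: V_def norm_axis)
      qed
      then show ?thesis
        using path_ends_in_closure(2)[OF powi2_step(1)[of k], of ?g ?C]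
        by (force intro: continuous_intros)
    qed
  qed
  ultimately show ?thesis
    unfolding branch_point_def
    by (intro exI[of _ "Y \<inter> V"] exI[of _ ?A] exI[of _ ?B] exI[of _ ?C])
      (simp add: closure_of_top_of_set)
qed

lemma branch_point_vert: "vertex_index b k i \<Longrightarrow> branch_point (top_of_set Y) (vert k i)"
  using branch_point_axis[of 1 k] branch_point_axis[of "-1" k] branch_point_bridge[of k]
  by (auto simp: vertex_index_def)

end

section \<open>Absence of branch points elsewhere\<close>

lemma bullseye_disc_ends:
  assumes "(x, y, z, w) \<in> bullseye_disc s t k" "x = 2 powi k * s \<or> x = 2 powi k * t"
  shows "z = 0"
proof -
  let ?r = "2 powi k * ((t - s) / 2)"
  have "x - 2 powi k * ((s + t) / 2) = - ?r \<or> x - 2 powi k * ((s + t) / 2) = ?r"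
    using assms(2) by (auto simp: field_simps)
  then have "(x - 2 powi k * ((s + t) / 2))\<^sup>2 = ?r\<^sup>2" by (elim disjE) (simp_all only: power2_minus)
  then show ?thesis using assms(1) by (auto simp: bullseye_disc_def)
qed

lemma bullseye_ball_ends:
  assumes "(x, y, z, w) \<in> bullseye_ball s t k" "x = - (2 powi k * t) \<or> x = - (2 powi k * s)"
  shows "z = 0 \<and> w = 0"
proof -
  let ?r = "2 powi k * ((t - s) / 2)"
  have "x + 2 powi k * ((s + t) / 2) = - ?r \<or> x + 2 powi k * ((s + t) / 2) = ?r"
    using assms(2) by (auto simp: field_simps)
  then have "(x + 2 powi k * ((s + t) / 2))\<^sup>2 = ?r\<^sup>2" by (elim disjE) (simp_all only: power2_minus)
  then have "z\<^sup>2 + w\<^sup>2 \<le> 0" using assms(1) by (auto simp: bullseye_ball_def)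
  then show ?thesis by (simp add: sum_power2_le_zero_iff)
qed

lemma diameter_subset:
  assumes "s < t"
  shows "2 powi k * s \<le> u \<Longrightarrow> u \<le> 2 powi k * t \<Longrightarrow> (u, 0, 0, 0) \<in> bullseye_disc s t k"
    and "- (2 powi k * t) \<le> u \<Longrightarrow> u \<le> - (2 powi k * s) \<Longrightarrow> (u, 0, 0, 0) \<in> bullseye_ball s t k"
proof -
  let ?r = "2 powi k * ((t - s) / 2)"
  have sq: "v\<^sup>2 \<le> ?r\<^sup>2" if "\<bar>v\<bar> \<le> ?r" for v
    using power_mono[OF that, of 2] by simp
  show "(u, 0, 0, 0) \<in> bullseye_disc s t k" if "2 powi k * s \<le> u" "u \<le> 2 powi k * t"
  proof -
    have "\<bar>u - 2 powi k * ((s + t) / 2)\<bar> \<le> ?r" using that by (auto simp: abs_le_iff field_simps)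
    then show ?thesis using sq by (simp add: bullseye_disc_def)
  qed
  show "(u, 0, 0, 0) \<in> bullseye_ball s t k" if "- (2 powi k * t) \<le> u" "u \<le> - (2 powi k * s)"
  proof -
    have "\<bar>u + 2 powi k * ((s + t) / 2)\<bar> \<le> ?r" using that by (auto simp: abs_le_iff field_simps)
    then show ?thesis using sq by (simp add: bullseye_ball_def)
  qed
qed

context bullseye_space
begin

lemma not_branch_point_axis:
  assumes p: "(x, 0, z, w) \<in> Y" "2 powi k < norm (x, 0::real, z, w)" "norm (x, 0::real, z, w) < 2 powi (k + 1)"
  shows "\<not> branch_point (top_of_set Y) (x, 0, z, w)"
proof -
  have pos: "0 < (2::real) powi k" by simp
  then have "0 < norm (x, 0::real, z, w)" using p(2) by linarith
  then have "(x, 0::real, z, w) \<noteq> 0" by (rule zero_less_norm_iff[THEN iffD1])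
  then have "x \<noteq> 0" using mem_x_nonzero p(1) by blast
  then consider "0 < x" | "x < 0" by linarith
  then show ?thesis
  proof cases
    case 1
    let ?R = "{q::R4. 2 powi k < norm q \<and> norm q < 2 powi (k + 1) \<and> 0 < 1 * fst q}"
    show ?thesis
    proof (rule not_branch_point_beaded_axis[where R = ?R and D = "bullseye_disc s t k"])
      show "open ?R" by (rule open_shell)
      fix q assume q: "q \<in> ?R"
      obtain x y z w where e: "q = (x, y, z, w)" by (rule R4_exhaust)
      show "q \<in> Y \<longleftrightarrow> q \<in> bullseye_disc s t k \<or> q \<in> bullseye_axis"
      proof
        assume "q \<in> Y"
        then have "(x, y, z, w) \<in> Y" by (simp add: e)
        then show "q \<in> bullseye_disc s t k \<or> q \<in> bullseye_axis"
        proof (cases rule: bullseye_memE)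
          case axis
          then show ?thesis by (simp add: e mem_bullseye_axis)
        next
          case (circle j)
          then show ?thesis using q powi2_not_between[of k j] by (simp add: e)
        next
          case (disc j)
          then show ?thesis using q powi2_same_level[of j "norm q" k] by (simp add: e)
        qed (use q in \<open>auto simp: e\<close>)
      qed (auto simp: bullseye_def)
    next
      fix x y z w assume d: "(x, y, z, w) \<in> bullseye_disc s t k"
      show "2 powi k * s \<le> x \<and> x \<le> 2 powi k * t \<and>
         (x = 2 powi k * s \<or> x = 2 powi k * t \<longrightarrow> y = 0 \<and> z = 0 \<and> w = 0)"
        using mem_disc_bounds[OF st d] bullseye_disc_ends[OF d] by auto
    qed (use 1 p st diameter_subset closed_bullseye_pieces convex_bullseye_pieces in auto)
  next
    case 2
    let ?R = "{q::R4. 2 powi k < norm q \<and> norm q < 2 powi (k + 1) \<and> 0 < -1 * fst q}"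
    show ?thesis
    proof (rule not_branch_point_beaded_axis[where R = ?R and D = "bullseye_ball s t k"])
      show "open ?R" by (rule open_shell)
      fix q assume q: "q \<in> ?R"
      obtain x y z w where e: "q = (x, y, z, w)" by (rule R4_exhaust)
      show "q \<in> Y \<longleftrightarrow> q \<in> bullseye_ball s t k \<or> q \<in> bullseye_axis"
      proof
        assume "q \<in> Y"
        then have "(x, y, z, w) \<in> Y" by (simp add: e)
        then show "q \<in> bullseye_ball s t k \<or> q \<in> bullseye_axis"
        proof (cases rule: bullseye_memE)
          case axis
          then show ?thesis by (simp add: e mem_bullseye_axis)
        next
          case (circle j)
          then show ?thesis using q powi2_not_between[of k j] by (simp add: e)
        next
          case (ball j)
          then show ?thesis using q powi2_same_level[of j "norm q" k] by (simp add: e)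
        qed (use q in \<open>auto simp: e\<close>)
      qed (auto simp: bullseye_def)
    next
      fix x y z w assume d: "(x, y, z, w) \<in> bullseye_ball s t k"
      show "- (2 powi k * t) \<le> x \<and> x \<le> - (2 powi k * s) \<and>
         (x = - (2 powi k * t) \<or> x = - (2 powi k * s) \<longrightarrow> y = 0 \<and> z = 0 \<and> w = 0)"
        using mem_ball_bounds[OF st d] bullseye_ball_ends[OF d] by auto
    qed (use 2 p st diameter_subset closed_bullseye_pieces convex_bullseye_pieces in auto)
  qed
qed

text \<open>Near such a point the space is a graph over the first coordinate, so the arc criterion
  applies with \<open>\<xi> = fst\<close>; \<open>\<tau>\<close> selects the upper or lower
  semicircle.\<close>

lemma not_branch_point_circle:
  assumes p: "(x, y, z, w) \<in> Y" "norm (x, y, z, w) = 2 powi k"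
    and c: "y \<noteq> 0 \<and> x \<noteq> 0 \<or> y < 0 \<or> 0 < y \<and> \<not> active b k"
  shows "\<not> branch_point (top_of_set Y) (x, y, z, w)"
proof -
  define r :: real where "r = 2 powi k"
  have r: "0 < r" by (simp add: r_def)
  have zw: "z = 0" "w = 0" using mem_circle_level[OF p(1), of k] p(2) c powi2_step[of k] by auto
  have y: "y \<noteq> 0" using c by auto
  have sq: "x\<^sup>2 + y\<^sup>2 = r\<^sup>2" using p(2) norm_R4_sq[of x y z w] by (simp add: zw r_def)
  have "x\<^sup>2 < r\<^sup>2" using sq y by (simp add: sq[symmetric])
  then have x: "\<bar>x\<bar> < r" using r by (simp add: power2_less_imp_less abs_less_iff power_less_imp_less_base[of "\<bar>x\<bar>" 2 r])
  define \<tau> :: real where "\<tau> = sgn y"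
  have \<tau>: "\<tau> = 1 \<or> \<tau> = -1" "0 < \<tau> * y" using y by (auto simp: \<tau>_def sgn_if)
  then have \<tau>': "\<tau> * \<tau> = 1" by auto
  \<comment> \<open>On the upper half of an active circle the interval stops at 0, which keeps the
    vertex at the top out; otherwise the whole open semicircle is used.\<close>
  obtain t0 t1 where t: "t0 < x" "x < t1" "- r \<le> t0" "t1 \<le> r"
    and t_ok: "\<And>u. t0 < u \<Longrightarrow> u < t1 \<Longrightarrow> u \<noteq> 0 \<or> \<tau> = -1 \<or> \<not> active b k"
  proof -
    have "(\<tau> = -1 \<or> \<not> active b k) \<or> 0 < x \<or> x < 0" using c by (auto simp: \<tau>_def sgn_if)
    then consider "\<tau> = -1 \<or> \<not> active b k" | "0 < x" | "x < 0" by blast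
    then show ?thesis
      by cases (rule that[of "- r" r] that[of 0 r] that[of "- r" 0]; use x in auto)+
  qed
  let ?V = "{q::R4. 2 powi (k - 1) < norm q \<and> norm q < 2 powi (k + 1) \<and> 0 < \<tau> * fst (snd q)}
    \<inter> {q. t0 < fst q \<and> fst q < t1}"
  let ?g = "\<lambda>u. (u, \<tau> * sqrt (r\<^sup>2 - u\<^sup>2), 0, 0) :: R4"
  show ?thesis
  proof (rule not_branch_point_arc[where V = ?V and \<gamma> = ?g and \<xi> = fst and ?t0.0 = t0 and ?t1.0 = t1])
    show "open ?V"
      by (intro open_Int open_shell open_Collect_conj open_Collect_less continuous_intros)
    show "Y \<inter> ?V = ?g ` {t0<..<t1}"
    proof (intro equalityI subsetI)
      fix q assume q: "q \<in> Y \<inter> ?V"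
      obtain x' y' z' w' where e: "q = (x', y', z', w')" by (rule R4_exhaust)
      have "y' \<noteq> 0 \<and> x' \<noteq> 0 \<or> y' < 0 \<or> 0 < y' \<and> \<not> active b k"
        using q t_ok[of x'] \<tau>(1) by (auto simp: e)
      then have c: "z' = 0" "w' = 0" "norm q = r"
        using q mem_circle_level[of x' y' z' w' k] by (auto simp: e r_def)
      have "r\<^sup>2 - x'\<^sup>2 = (\<tau> * y')\<^sup>2"
        using c norm_R4_sq[of x' y' z' w'] \<tau>(1) by (auto simp: e)
      then have "\<tau> * sqrt (r\<^sup>2 - x'\<^sup>2) = \<tau> * (\<tau> * y')" using q by (simp add: e)
      then have "q = ?g x'" using c \<tau>' by (simp add: e flip: mult.assoc)
      then show "q \<in> ?g ` {t0<..<t1}" using q by (auto simp: e)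
    next
      fix q assume "q \<in> ?g ` {t0<..<t1}"
      then obtain u where u: "t0 < u" "u < t1" "q = ?g u" by auto
      then have "\<bar>u\<bar> < r" using t by auto
      then have n: "norm (?g u) = r" by (intro norm_semicircle \<tau>) simp
      have "u\<^sup>2 < r\<^sup>2" using \<open>\<bar>u\<bar> < r\<close> power_strict_mono[of "\<bar>u\<bar>" r 2] by simp
      then have "0 < \<tau> * fst (snd (?g u))" using \<tau>' by (simp flip: mult.assoc)
      then show "q \<in> Y \<inter> ?V"
        using u n circle_mem[of u "\<tau> * sqrt (r\<^sup>2 - u\<^sup>2)" k] powi2_step[of k] by (simp add: r_def)
    qed
    show "(x, y, z, w) \<in> ?V" using p(2) powi2_step[of k] \<tau>(2) t by simp
  qed (use p(1) in \<open>auto intro!: continuous_intros\<close>)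
qed

lemma not_branch_point_bridge:
  assumes p: "(x, y, z, w) \<in> Y" "2 powi k < norm (x, y, z, w)" "norm (x, y, z, w) < 2 powi (k + 1)" "y \<noteq> 0"
  shows "\<not> branch_point (top_of_set Y) (x, y, z, w)"
proof -
  let ?V = "{q::R4. 2 powi k < norm q \<and> norm q < 2 powi (k + 1) \<and> 0 < 1 * fst (snd q)}"
  have b: "b k = 1" using mem_bridge_level[OF p] by simp
  have "0 < norm (x, y, z, w)" using p(4) by (auto simp: zero_prod_def)
  then have y: "0 < y" using mem_bridge_level[OF p] by linarith
  have "open ?V" by (rule open_shell)
  moreover have "(x, y, z, w) \<in> ?V" using p y by simp
  ultimately obtain \<delta> where \<delta>: "0 < \<delta>" "\<And>q. dist (x, y, z, w) q < \<delta> \<Longrightarrow> q \<in> ?V"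
    by (meson open_contains_ball mem_ball subsetD)
  have iff: "q \<in> Y \<longleftrightarrow> q \<in> bullseye_bridge k" if "q \<in> ?V" for q
  proof -
    obtain x' y' z' w' where e: "q = (x', y', z', w')" by (rule R4_exhaust)
    show ?thesis
    proof
      assume "q \<in> Y"
      then show "q \<in> bullseye_bridge k"
        using that mem_bridge_level[of x' y' z' w' k] by (auto simp: e mem_bullseye_bridge)
    next
      assume "q \<in> bullseye_bridge k"
      then show "q \<in> Y" using b by (auto simp: bullseye_def)
    qed
  qed
  show ?thesis
    by (rule not_branch_point_convex[OF p(1) \<delta>(1) convex_bullseye_pieces(2) convex_bullseye_pieces(2)])
      (use iff \<delta>(2) in blast)+
qed

text \<open>A nonzero point lies on a circle radius or strictly between two, and each position other
  than a vertex has a local model. The origin is excluded because circles accumulate there.\<close>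

lemma branch_pointD:
  assumes br: "branch_point (top_of_set Y) p" and "p \<noteq> 0"
  shows "\<exists>k i. vertex_index b k i \<and> p = vert k i"
proof -
  obtain x y z w where e: "p = (x, y, z, w)" by (rule R4_exhaust)
  have mem: "(x, y, z, w) \<in> Y" using branch_point_in_topspace[OF br] by (simp add: e)
  have "0 < norm p" using assms(2) by simp
  then obtain k where k: "norm p = 2 powi k \<or> 2 powi k < norm p \<and> norm p < 2 powi (k + 1)"
    using powi2_level by blast
  show ?thesis
  proof (cases "2 powi k < norm p \<and> norm p < 2 powi (k + 1)")
    case True
    then show ?thesis
      using not_branch_point_axis[of x z w k] not_branch_point_bridge[OF mem, of k] br mem
      by (cases "y = 0") (auto simp: e)
  next
    case False
    then have "norm p = 2 powi k" using k by blast
    then have n: "norm (x, y, z, w) = 2 powi k" by (simp only: e)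
    show ?thesis
    proof (cases "y = 0")
      case True
      then have "p = vert k 0 \<or> p = vert k 1" using mem_axis_level[of x z w k] mem n by (simp add: e)
      moreover have "vertex_index b k 0" "vertex_index b k 1" by (simp_all add: vertex_index_def)
      ultimately show ?thesis by blast
    next
      case False
      have "\<not> (y \<noteq> 0 \<and> x \<noteq> 0 \<or> y < 0 \<or> 0 < y \<and> \<not> active b k)"
        using not_branch_point_circle[OF mem n] br by (auto simp: e)
      then have "x = 0" "0 < y" "active b k" using False by auto
      then have "p = vert k 2 \<and> vertex_index b k 2"
        using mem_y_axis_level[of y z w k] mem n by (auto simp: e vertex_index_def)
      then show ?thesis by blast
    qed
  qed
qed

lemma not_branch_pointI_level:
  assumes "2 powi k < norm p" "norm p < 2 powi (k + 1)"
  shows "\<not> branch_point (top_of_set Y) p"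
proof
  assume br: "branch_point (top_of_set Y) p"
  have "0 < (2::real) powi k" by simp
  then have "0 < norm p" using assms(1) by linarith
  then have "p \<noteq> 0" by simp
  then obtain l i where "p = vert l i" using branch_pointD[OF br] by blast
  then show False using assms powi2_not_between[of k l] by (simp add: norm_vert)
qed

end

section \<open>The graph of a bullseye space\<close>

context bullseye_space
begin

text \<open>The expected graph: any two vertices of a level are joined, and vertices of equal index
  are joined along three rails, the two rays and the y-axis, the last one only across a
  bridge.\<close>

definition edge :: "int \<Rightarrow> nat \<Rightarrow> int \<Rightarrow> nat \<Rightarrow> bool" where
  "edge k i l j \<longleftrightarrow> vertex_index b k i \<and> vertex_index b l j \<and>
     (k = l \<and> i \<noteq> j \<or>
      i = j \<and> (l = k + 1 \<and> (i = 2 \<longrightarrow> b k = 1) \<or> k = l + 1 \<and> (i = 2 \<longrightarrow> b l = 1)))"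

lemma edge_sym: "edge k i l j \<Longrightarrow> edge l j k i"
  by (auto simp: edge_def)

lemma edge_levels: "edge k i l j \<Longrightarrow> k = l \<and> i \<noteq> j \<or> i = j \<and> (l = k + 1 \<or> k = l + 1)"
  by (auto simp: edge_def)

section \<open>Comparison of topological adjacency with the combinatorial graph\<close>

lemma adjacent_sym: "adjacent X u v \<Longrightarrow> adjacent X v u"
  by (auto simp: adjacent_def)

lemma adjacent_pathI:
  fixes \<gamma> :: "real \<Rightarrow> R4"
  assumes "t0 < t1" "continuous_on {t0..t1} \<gamma>"
    and in_Y: "\<And>u. t0 < u \<Longrightarrow> u < t1 \<Longrightarrow> \<gamma> u \<in> Y"
    and nb: "\<And>u. t0 < u \<Longrightarrow> u < t1 \<Longrightarrow> \<not> branch_point (top_of_set Y) (\<gamma> u)"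
    and ends: "\<gamma> t0 = vert k i" "\<gamma> t1 = vert l j" "vertex_index b k i" "vertex_index b l j"
    and ne: "(k, i) \<noteq> (l, j)"
  shows "adjacent (top_of_set Y) (vert k i) (vert l j)"
proof -
  let ?C = "\<gamma> ` {t0<..<t1}"
  have br: "branch_point (top_of_set Y) (vert k i)" "branch_point (top_of_set Y) (vert l j)"
    using branch_point_vert ends by auto
  have "?C \<subseteq> Y" using in_Y by auto
  moreover have "connected ?C"
    by (intro connected_continuous_image continuous_on_subset[OF assms(2)]) auto
  moreover have "vert k i \<in> closure ?C" "vert l j \<in> closure ?C"
    using path_ends_in_closure[OF assms(1,2), of ?C] ends by auto
  moreover have "vert k i \<in> Y" "vert l j \<in> Y" using br by (auto dest: branch_point_in_topspace)
  moreover have "vert k i \<noteq> vert l j" using vert_eq_iff[OF ends(3,4)] ne by simp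
  ultimately show ?thesis
    unfolding adjacent_def using br nb
    by (intro conjI exI[of _ ?C]) (auto simp: connectedin_subtopology closure_of_top_of_set)
qed

lemma not_branch_pointI_vert:
  assumes "p \<noteq> 0" "\<And>k i. vertex_index b k i \<Longrightarrow> p \<noteq> vert k i"
  shows "\<not> branch_point (top_of_set Y) p"
  using branch_pointD assms by blast

lemma not_branch_point_quadrant:
  assumes "y < 0 \<or> 0 < y \<and> x \<noteq> 0"
  shows "\<not> branch_point (top_of_set Y) (x, y, z, w)"
proof (rule not_branch_pointI_vert)
  show "(x, y, z, w) \<noteq> 0" using assms by (auto simp: zero_prod_def)
  fix k i
  have "0 < (2::real) powi k" by simp
  then show "(x, y, z, w) \<noteq> vert k i" using assms by (auto simp: vert_def simp del: zero_less_power_int)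
qed

lemma adjacent_rail:
  assumes "edge k i (k + 1) i"
  shows "adjacent (top_of_set Y) (vert k i) (vert (k + 1) i)"
proof -
  have i: "vertex_index b k i" "vertex_index b (k + 1) i" "i = 2 \<Longrightarrow> b k = 1"
    using assms by (auto simp: edge_def)
  define e :: R4 where "e = (if i = 0 then (1, 0, 0, 0) else if i = 1 then (-1, 0, 0, 0) else (0, 1, 0, 0))"
  have e: "norm e = 1" "2 powi l *\<^sub>R e = vert l i" for l
    by (simp_all add: e_def norm_axis vert_def)
  have pos: "0 < (2::real) powi k" by simp
  show ?thesis
  proof (rule adjacent_pathI[where \<gamma> = "\<lambda>u. u *\<^sub>R e", OF powi2_step(2)[of k]])
    fix u :: real assume u: "2 powi k < u" "u < 2 powi (k + 1)"
    have "0 < u" using less_trans[OF pos u(1)] .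
    then have "norm (u *\<^sub>R e) = u" using e by simp
    then show "\<not> branch_point (top_of_set Y) (u *\<^sub>R e)"
      using u by (intro not_branch_pointI_level[of k]) auto
    show "u *\<^sub>R e \<in> Y"
      using i u axis_mem[of u] axis_mem[of "- u"] bridge_mem[of k u]
      by (auto simp: e_def vertex_index_def)
  qed (use e i in \<open>auto intro!: continuous_intros\<close>)
qed

text \<open>On the upper half, the arc must not cross the y-axis, where a vertex may sit; the lower
  half has none, so it can be used in full.\<close>

lemma adjacent_semicircle:
  assumes c: "c = 1 \<or> c = -1" and t: "- (2 powi k) \<le> t0" "t1 \<le> 2 powi k" "t0 < t1"
    and c': "c = 1 \<Longrightarrow> 0 \<le> t0 \<or> t1 \<le> 0"
    and ends: "(t0, c * sqrt ((2 powi k)\<^sup>2 - t0\<^sup>2), 0, 0) = vert k i"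
      "(t1, c * sqrt ((2 powi k)\<^sup>2 - t1\<^sup>2), 0, 0) = vert k j"
      "vertex_index b k i" "vertex_index b k j" "i \<noteq> j"
  shows "adjacent (top_of_set Y) (vert k i) (vert k j)"
proof (rule adjacent_pathI[where \<gamma> = "\<lambda>u. (u, c * sqrt ((2 powi k)\<^sup>2 - u\<^sup>2), 0, 0)", OF t(3)])
  fix u :: real assume u: "t0 < u" "u < t1"
  let ?r = "2 powi k :: real"
  have u': "\<bar>u\<bar> < ?r" using u t by (auto simp: abs_less_iff)
  then have "u\<^sup>2 < ?r\<^sup>2" using power_strict_mono[of "\<bar>u\<bar>" ?r 2] by simp
  then have "0 < sqrt (?r\<^sup>2 - u\<^sup>2)" by simp
  then show "\<not> branch_point (top_of_set Y) (u, c * sqrt (?r\<^sup>2 - u\<^sup>2), 0, 0)"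
    using c c' u by (intro not_branch_point_quadrant) auto
  have "norm (u, c * sqrt (?r\<^sup>2 - u\<^sup>2), 0::real, 0::real) = ?r"
    using u' by (intro norm_semicircle c) simp
  then show "(u, c * sqrt (?r\<^sup>2 - u\<^sup>2), 0, 0) \<in> Y" by (rule circle_mem)
qed (use ends in \<open>auto intro!: continuous_intros\<close>)

lemma adjacent_if_edge:
  assumes "edge k i l j"
  shows "adjacent (top_of_set Y) (vert k i) (vert l j)"
proof -
  have pos: "0 < (2::real) powi k" by simp
  then have neg: "- (2 powi k) < (2::real) powi k" "- (2 powi k) \<le> (0::real)" "0 \<le> (2::real) powi k" by linarith+
  have ix: "vertex_index b k 0" "vertex_index b k 1" by (simp_all add: vertex_index_def)
  \<comment> \<open>Through the bottom of the circle, which is not a branch point at any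
    level.\<close>
  have 01: "adjacent (top_of_set Y) (vert k 0) (vert k 1)"
    by (rule adjacent_sym, rule adjacent_semicircle[of "-1" k "- (2 powi k)" "2 powi k"]) (use neg ix in auto)
  have 02: "adjacent (top_of_set Y) (vert k 0) (vert k 2)" if "vertex_index b k 2"
    by (rule adjacent_sym, rule adjacent_semicircle[of 1 k 0 "2 powi k"]) (use neg pos ix that in auto)
  have 12: "adjacent (top_of_set Y) (vert k 1) (vert k 2)" if "vertex_index b k 2"
    by (rule adjacent_semicircle[of 1 k "- (2 powi k)" 0]) (use neg pos ix that in auto)
  consider "k = l" "i \<noteq> j" | "i = j" "l = k + 1" | "i = j" "k = l + 1"
    using assms by (auto simp: edge_def)
  then show ?thesis
  proof cases
    case 1
    have v: "vertex_index b k i" "vertex_index b k j" using assms 1 by (auto simp: edge_def)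
    then have "i \<in> {0, 1, 2}" "j \<in> {0, 1, 2}" by (auto simp: vertex_index_def)
    then show ?thesis
      using 1 v 01 02 12 adjacent_sym[OF 01] adjacent_sym[OF 02] adjacent_sym[OF 12] by auto
  next
    case 2
    then show ?thesis using adjacent_rail assms by simp
  next
    case 3
    then show ?thesis using adjacent_rail edge_sym[OF assms] by (auto intro: adjacent_sym)
  qed
qed

text \<open>On the part of \<open>Y\<close> without branch points, the open set \<open>V\<close> and
  the closed set \<open>K\<close> coincide. So \<open>V\<close> cuts out a relatively clopen part of
  \<open>C\<close>, which is all of \<open>C\<close> because it contains \<open>p\<close>.\<close>

lemma closure_in_piece:
  assumes "connected C" "C \<subseteq> Y" "\<And>q. q \<in> C \<Longrightarrow> \<not> branch_point (top_of_set Y) q"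
    and p: "p \<in> C" "p \<in> V" and "open V" "closed K"
    and VK: "\<And>q. q \<in> Y \<Longrightarrow> q \<in> V \<Longrightarrow> q \<in> K"
    and KV: "\<And>q. q \<in> Y \<Longrightarrow> q \<in> K \<Longrightarrow> \<not> branch_point (top_of_set Y) q \<Longrightarrow> q \<in> V"
  shows "closure C \<subseteq> K"
proof -
  have "C \<subseteq> V \<union> - K" "V \<inter> - K \<inter> C = {}" using assms by blast+
  then have "V \<inter> C = {} \<or> - K \<inter> C = {}"
    using connectedD[OF assms(1) \<open>open V\<close>, of "- K"] \<open>closed K\<close> by (auto simp: open_Compl)
  then have "C \<subseteq> K" using p by blast
  then show ?thesis using \<open>closed K\<close> by (rule closure_minimal)
qed

text \<open>The position of a nonzero point \<open>p\<close> of \<open>C\<close> decides which piece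
  traps the closure of \<open>C\<close>: a circle, one level of a ray, or a bridge. A whole circle
  is precise enough, since any two distinct vertices on it form an edge.\<close>

lemma edge_if_adjacent:
  assumes "adjacent (top_of_set Y) u v"
  shows "\<exists>k i l j. u = vert k i \<and> v = vert l j \<and> edge k i l j"
proof -
  obtain C where br: "branch_point (top_of_set Y) u" "branch_point (top_of_set Y) v" and ne: "u \<noteq> v"
    and C: "connectedin (top_of_set Y) C" "\<And>x. x \<in> C \<Longrightarrow> \<not> branch_point (top_of_set Y) x"
    and uv: "u \<in> top_of_set Y closure_of C" "v \<in> top_of_set Y closure_of C"
    using assms unfolding adjacent_def by blast
  have C': "connected C" "C \<subseteq> Y" using C(1) by (simp_all add: connectedin_subtopology)
  then have cl: "u \<in> closure C" "v \<in> closure C" using uv by (simp_all add: closure_of_top_of_set)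
  have Y: "u \<in> Y" "v \<in> Y" using br by (auto dest: branch_point_in_topspace)
  \<comment> \<open>The origin may fail to be a branch point, so it has to be ruled out as the whole
    of \<open>C\<close>.\<close>
  have "\<not> C \<subseteq> {0}"
  proof
    assume "C \<subseteq> {0}"
    then have "closure C \<subseteq> {0}" by (rule closure_minimal) simp
    then show False using cl ne by blast
  qed
  then obtain p where p: "p \<in> C" "p \<noteq> 0" by blast
  obtain x y z w where e: "p = (x, y, z, w)" by (rule R4_exhaust)
  have pY: "(x, y, z, w) \<in> Y" using p C' e by blast
  have nb: "\<not> branch_point (top_of_set Y) p" using C p by blast
  have "0 < norm p" using p by simp
  then obtain k where k: "norm p = 2 powi k \<or> 2 powi k < norm p \<and> norm p < 2 powi (k + 1)"
    using powi2_level by blast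
  have pos: "0 < (2::real) powi k" by simp
  then have npos: "\<not> (2::real) powi k \<le> 0" by linarith
  note piece = closure_in_piece[OF C' C(2) p(1)]
  have vertE: "\<exists>l i. vertex_index b l i \<and> q = vert l i" if "branch_point (top_of_set Y) q" "0 < norm q" for q
    using branch_pointD that by auto
  show ?thesis
  proof (cases "norm p = 2 powi k")
    case True
    \<comment> \<open>An open condition that holds on the circle except at its vertices.\<close>
    define V where "V = {q::R4. 2 powi (k - 1) < norm q \<and> norm q < 2 powi (k + 1)} \<inter>
      ({q. fst (snd q) \<noteq> 0 \<and> fst q \<noteq> 0} \<union> {q. fst (snd q) < 0} \<union> {q. 0 < fst (snd q) \<and> \<not> active b k})"
    have KV: "q \<in> V" if q: "q \<in> Y" "norm q = 2 powi k" "\<not> branch_point (top_of_set Y) q" for q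
    proof -
      obtain x y z w where e: "q = (x, y, z, w)" by (rule R4_exhaust)
      have "y \<noteq> 0"
        using mem_axis_level[of x z w k] branch_point_vert[of k 0] branch_point_vert[of k 1] q
        by (auto simp: e vertex_index_def)
      moreover have "x \<noteq> 0" if "0 < y" "active b k"
        using mem_y_axis_level[of y z w k] branch_point_vert[of k 2] q that
        by (auto simp: e vertex_index_def)
      ultimately show ?thesis using q powi2_step[of k] by (auto simp: V_def e linorder_neq_iff)
    qed
    have "closure C \<subseteq> {q. norm q = 2 powi k}"
    proof (rule piece)
      show "open V" unfolding V_def
        by (intro open_Int open_Un open_Collect_conj open_Collect_less open_Collect_neq
            open_Collect_const continuous_intros)
      show "closed {q::R4. norm q = 2 powi k}" by (intro closed_Collect_eq continuous_intros)
      show "p \<in> V" using KV nb True p C' by blast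
      show "q \<in> {q. norm q = 2 powi k}" if "q \<in> Y" "q \<in> V" for q
        using mem_circle_level[of "fst q" "fst (snd q)" "fst (snd (snd q))" "snd (snd (snd q))" k] that
        by (auto simp: V_def)
    qed (use KV in auto)
    then have n: "norm u = 2 powi k" "norm v = 2 powi k" using cl by auto
    then obtain l i m j where ix: "vertex_index b l i" "u = vert l i" "vertex_index b m j" "v = vert m j"
      using vertE[OF br(1)] vertE[OF br(2)] pos by metis
    then have "l = k" "m = k" using n by (simp_all add: norm_vert powi2_eq_iff)
    then show ?thesis using ix ne by (auto simp: edge_def)
  next
    case False
    then have lev: "2 powi k < norm p" "norm p < 2 powi (k + 1)" using k by auto
    define K where "K = {q::R4. 2 powi k \<le> norm q \<and> norm q \<le> 2 powi (k + 1)}"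
    have K: "closed K" unfolding K_def by (intro closed_Collect_conj closed_Collect_le continuous_intros)
    have level: "\<exists>l i. vertex_index b l i \<and> q = vert l i \<and> (l = k \<or> l = k + 1)"
      if q: "branch_point (top_of_set Y) q" "q \<in> K" for q
    proof -
      have "2 powi k \<le> norm q" using q(2) by (simp add: K_def)
      then have "0 < norm q" using pos by linarith
      then obtain l i where "vertex_index b l i" "q = vert l i" using vertE q by blast
      moreover from this have "l = k \<or> l = k + 1" using q(2) by (auto simp: K_def norm_vert powi2_le_iff)
      ultimately show ?thesis by blast
    qed
    \<comment> \<open>Common end of the two remaining cases: both ends lie at level \<open>k\<close>
      or \<open>k + 1\<close> and carry the same index \<open>i0\<close>; being distinct, they are
      consecutive on one rail.\<close>
    have same: ?thesis
      if uK: "u \<in> K" and vK: "v \<in> K" and bk: "i0 = 2 \<Longrightarrow> b k = 1"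
        and i0: "\<And>q l i. q \<in> {u, v} \<Longrightarrow> vertex_index b l i \<Longrightarrow> q = vert l i \<Longrightarrow> i = i0" for i0
    proof -
      obtain l i m j where ix: "vertex_index b l i" "u = vert l i" "l = k \<or> l = k + 1"
        "vertex_index b m j" "v = vert m j" "m = k \<or> m = k + 1"
        using level[OF br(1) uK] level[OF br(2) vK] by blast
      moreover have "i = i0" "j = i0" using i0[of u l i] i0[of v m j] ix by blast+
      ultimately have "edge l i m j" using ne bk by (auto simp: edge_def)
      then show ?thesis using ix by blast
    qed
    show ?thesis
    proof (cases "y = 0")
      case True
      \<comment> \<open>The sign of \<open>x\<close> selects the ray, so discs and balls are handled
        together.\<close>
      define c :: real where "c = sgn x"
      have "x \<noteq> 0" using mem_x_nonzero[of x z w] pY p(2) True by (simp add: e)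
      then have c: "c = 1 \<or> c = -1" "0 < c * x" by (auto simp: c_def sgn_if)
      define V where "V = {q::R4. 2 powi k < norm q \<and> norm q < 2 powi (k + 1) \<and> 0 < c * fst q}"
      have "closure C \<subseteq> K \<inter> {q. fst (snd q) = 0 \<and> 0 \<le> c * fst q}"
      proof (rule piece)
        show "p \<in> V" using lev c by (simp add: V_def e)
        show "open V" unfolding V_def by (rule open_shell)
        show "closed (K \<inter> {q. fst (snd q) = 0 \<and> 0 \<le> c * fst q})"
          by (intro closed_Int K closed_Collect_conj closed_Collect_le closed_Collect_eq continuous_intros)
      next
        fix q assume q: "q \<in> Y" "q \<in> V"
        have "fst q \<noteq> 0" using q by (auto simp: V_def)
        then have "fst (snd q) = 0"
          using mem_bridge_level[of "fst q" "fst (snd q)" "fst (snd (snd q))" "snd (snd (snd q))" k] q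
          by (auto simp: V_def)
        then show "q \<in> K \<inter> {q. fst (snd q) = 0 \<and> 0 \<le> c * fst q}" using q by (auto simp: V_def K_def)
      next
        fix q assume q: "q \<in> Y" "q \<in> K \<inter> {q. fst (snd q) = 0 \<and> 0 \<le> c * fst q}"
          "\<not> branch_point (top_of_set Y) q"
        obtain x y z w where e: "q = (x, y, z, w)" by (rule R4_exhaust)
        have y: "y = 0" using q by (simp add: e)
        have n: "norm q \<noteq> 2 powi l" for l
          using mem_axis_level[of x z w l] branch_point_vert[of l 0] branch_point_vert[of l 1] q
          by (auto simp: e vertex_index_def)
        have "q \<noteq> 0" using q(2) npos by (auto simp: K_def)
        then have "x \<noteq> 0" using mem_x_nonzero[of x z w] q(1) y by (simp add: e)
        then have "0 < c * fst q" using q(2) c(1) by (auto simp: e)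
        then show "q \<in> V" using q(2) n[of k] n[of "k + 1"] by (auto simp: V_def K_def)
      qed
      then have uv: "u \<in> K" "v \<in> K" "\<And>q. q \<in> {u, v} \<Longrightarrow> fst (snd q) = 0 \<and> 0 \<le> c * fst q"
        using cl by auto
      show ?thesis
      proof (rule same[OF uv(1,2), of "if c = 1 then 0 else 1"])
        fix q l i assume q: "q \<in> {u, v}" "vertex_index b l i" "q = vert l i"
        have "0 < (2::real) powi l" by simp
        then show "i = (if c = 1 then 0 else 1)"
          using uv(3)[OF q(1)] q(2,3) c(1) by (auto simp: vertex_index_def not_le[symmetric] simp del: zero_less_power_int)
      qed (auto split: if_splits)
    next
      case False
      have bk: "b k = 1" using mem_bridge_level[OF pY] lev False by (simp add: e)
      then have act: "active b k" "active b (k + 1)" by (auto simp: active_def)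
      define V where "V = {q::R4. 2 powi k < norm q \<and> norm q < 2 powi (k + 1) \<and> 0 < 1 * fst (snd q)}"
      have "closure C \<subseteq> K \<inter> {q. fst q = 0 \<and> 0 \<le> fst (snd q)}"
      proof (rule piece)
        have "y = norm p" using mem_bridge_level[OF pY] lev False by (simp add: e)
        then show "p \<in> V" using lev \<open>0 < norm p\<close> by (simp add: V_def e)
        show "open V" unfolding V_def by (rule open_shell)
        show "closed (K \<inter> {q. fst q = 0 \<and> 0 \<le> fst (snd q)})"
          by (intro closed_Int K closed_Collect_conj closed_Collect_le closed_Collect_eq continuous_intros)
      next
        fix q assume q: "q \<in> Y" "q \<in> V"
        have "fst (snd q) \<noteq> 0" using q by (auto simp: V_def)
        then have "fst q = 0"
          using mem_bridge_level[of "fst q" "fst (snd q)" "fst (snd (snd q))" "snd (snd (snd q))" k] q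
          by (auto simp: V_def)
        then show "q \<in> K \<inter> {q. fst q = 0 \<and> 0 \<le> fst (snd q)}" using q by (auto simp: V_def K_def)
      next
        fix q assume q: "q \<in> Y" "q \<in> K \<inter> {q. fst q = 0 \<and> 0 \<le> fst (snd q)}"
          "\<not> branch_point (top_of_set Y) q"
        obtain x y z w where e: "q = (x, y, z, w)" by (rule R4_exhaust)
        have x: "x = 0" using q by (simp add: e)
        have n: "norm q \<noteq> 2 powi l" if "active b l" for l
          using mem_y_axis_level[of y z w l] branch_point_vert[of l 2] q that
          by (auto simp: e vertex_index_def)
        have "q \<noteq> 0" using q(2) npos by (auto simp: K_def)
        then have "y \<noteq> 0" using mem_x_nonzero[of x z w] q(1) x by (auto simp: e)
        then show "q \<in> V" using q(2) n[OF act(1)] n[OF act(2)] by (auto simp: V_def K_def e)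
      qed
      then have uv: "u \<in> K" "v \<in> K" "\<And>q. q \<in> {u, v} \<Longrightarrow> fst q = 0" using cl by auto
      show ?thesis
      proof (rule same[OF uv(1,2), of 2])
        fix q l i assume q: "q \<in> {u, v}" "vertex_index b l i" "q = vert l i"
        have "0 < (2::real) powi l" by simp
        then show "i = 2" using uv(3)[OF q(1)] q(2,3) by (auto simp: vertex_index_def)
      qed (use bk in auto)
    qed
  qed
qed

section \<open>Triangles and their links\<close>

lemma adjacent_vert_iff:
  assumes "vertex_index b k i" "vertex_index b l j"
  shows "adjacent (top_of_set Y) (vert k i) (vert l j) \<longleftrightarrow> edge k i l j"
proof
  assume "adjacent (top_of_set Y) (vert k i) (vert l j)"
  then obtain k' i' l' j' where "vert k i = vert k' i'" "vert l j = vert l' j'" "edge k' i' l' j'"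
    using edge_if_adjacent by blast
  moreover from this have "vertex_index b k' i'" "vertex_index b l' j'" by (auto simp: edge_def)
  ultimately show "edge k i l j" using assms vert_eq_iff by simp
qed (rule adjacent_if_edge)

definition tri :: "int \<Rightarrow> R4 set" where "tri k = {vert k 0, vert k 1, vert k 2}"

text \<open>No triangle contains a rail edge: a third vertex on the same rail cannot be one level
  away from both ends, and a vertex beside one end differs from the other in both level and index.
  So a triangle is a full level with three vertices.\<close>

lemma triangle_iff: "triangle (top_of_set Y) T \<longleftrightarrow> (\<exists>k. active b k \<and> T = tri k)"
proof
  assume "triangle (top_of_set Y) T"
  then obtain u v w where T: "T = {u, v, w}" and adj: "adjacent (top_of_set Y) u v"
    "adjacent (top_of_set Y) v w" "adjacent (top_of_set Y) u w"
    by (auto simp: triangle_def)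
  obtain k1 i1 k2 i2 where uv: "u = vert k1 i1" "v = vert k2 i2" "edge k1 i1 k2 i2"
    using edge_if_adjacent[OF adj(1)] by blast
  obtain k3 i3 where w: "w = vert k3 i3" "vertex_index b k3 i3"
    using edge_if_adjacent[OF adj(2)] by (auto simp: edge_def)
  have ix: "vertex_index b k1 i1" "vertex_index b k2 i2" using uv by (auto simp: edge_def)
  have "edge k2 i2 k3 i3" "edge k1 i1 k3 i3"
    using adj adjacent_vert_iff ix w uv by auto
  then have "k1 = k2 \<and> k2 = k3 \<and> i1 \<noteq> i2 \<and> i2 \<noteq> i3 \<and> i1 \<noteq> i3"
    using edge_levels[OF uv(3)] edge_levels[of k2 i2 k3 i3] edge_levels[of k1 i1 k3 i3] by presburger
  moreover from this have "{i1, i2, i3} = {0, 1, 2} \<and> active b k1"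
    using ix w(2) by (auto simp: vertex_index_def)
  then have "vert k1 ` {i1, i2, i3} = vert k1 ` {0, 1, 2}" "active b k1" by auto
  ultimately show "\<exists>k. active b k \<and> T = tri k" using T uv w by (auto simp: tri_def)
next
  assume "\<exists>k. active b k \<and> T = tri k"
  then obtain k where k: "active b k" "T = tri k" by blast
  then have "edge k 0 k 1" "edge k 1 k 2" "edge k 0 k 2" by (auto simp: edge_def vertex_index_def)
  then show "triangle (top_of_set Y) T"
    using k(2) adjacent_if_edge unfolding triangle_def tri_def by blast
qed

lemma norm_tri: "q \<in> tri k \<Longrightarrow> norm q = 2 powi k"
  unfolding tri_def using norm_vert by blast

lemma tri_inter_iff: "tri k \<inter> tri l = {} \<longleftrightarrow> k \<noteq> l"
proof -
  have "k = l" if "q \<in> tri k" "q \<in> tri l" for q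
    using norm_tri that by (metis powi2_eq_iff)
  moreover have "vert k 0 \<in> tri k" unfolding tri_def by blast
  ultimately show ?thesis by blast
qed

lemma tri_inj: "tri k = tri l \<Longrightarrow> k = l"
  using tri_inter_iff[of k l] tri_inter_iff[of k k] by auto

text \<open>Vertices at different levels are adjacent only with equal index, so the third vertex
  needs a bridge, and then the two rays supply the other edges.\<close>

lemma triangle_link_iff:
  assumes "active b k" "active b l"
  shows "(tri k, tri l) \<in> triangle_link (top_of_set Y) \<longleftrightarrow> l = k + 1 \<and> b k = 1 \<or> k = l + 1 \<and> b l = 1"
proof -
  have ix: "vertex_index b k i" "vertex_index b l i" if "i \<in> {0, 1, 2}" for i
    using that assms by (auto simp: vertex_index_def)
  have tri: "tri k = vert k ` {0, 1, 2}" "tri l = vert l ` {0, 1, 2}" by (auto simp: tri_def)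
  have "(tri k, tri l) \<in> triangle_link (top_of_set Y) \<longleftrightarrow>
    tri k \<inter> tri l = {} \<and> (\<forall>i\<in>{0, 1, 2}. \<exists>j\<in>{0, 1, 2}. adjacent (top_of_set Y) (vert k i) (vert l j))"
    using assms triangle_iff by (auto simp: triangle_link_def tri simp del: vert_simps image_insert)
  also have "tri k \<inter> tri l = {} \<longleftrightarrow> k \<noteq> l" by (rule tri_inter_iff)
  also have "(\<forall>i\<in>{0, 1, 2}. \<exists>j\<in>{0, 1, 2}. adjacent (top_of_set Y) (vert k i) (vert l j))
    \<longleftrightarrow> (\<forall>i\<in>{0, 1, 2}. \<exists>j\<in>{0, 1, 2}. edge k i l j)"
    by (intro ball_cong bex_cong refl adjacent_vert_iff ix)
  also have "k \<noteq> l \<and> \<dots> \<longleftrightarrow> l = k + 1 \<and> b k = 1 \<or> k = l + 1 \<and> b l = 1"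
    using ix by (auto simp: edge_def)
  finally show ?thesis .
qed

definition links :: "(int \<times> int) set" where
  "links = {(k, l). l = k + 1 \<and> b k = 1 \<or> k = l + 1 \<and> b l = 1}"

lemma links_active: "(k, l) \<in> links \<Longrightarrow> active b l"
  by (auto simp: links_def active_def)

text \<open>\<open>tri\<close> is injective and carries \<open>links\<close> on active levels to
  \<open>triangle_link\<close>, so the components correspond one to one.\<close>

lemma chain_sizes_bullseye:
  "chain_sizes (top_of_set Y) = {card (links\<^sup>* `` {k}) | k. active b k}"
proof -
  have "card ((triangle_link (top_of_set Y))\<^sup>* `` {tri k}) = card (links\<^sup>* `` {k})" if k: "active b k" for k
  proof -
    have "(tri k, tri l) \<in> (triangle_link (top_of_set Y))\<^sup>* \<and> active b l" if "(k, l) \<in> links\<^sup>*" for l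
      using that
    proof induction
      case (step l m)
      then have "(tri l, tri m) \<in> triangle_link (top_of_set Y)" "active b m"
        using triangle_link_iff[of l m] links_active by (auto simp: links_def)
      then show ?case using step by (meson rtrancl.rtrancl_into_rtrancl)
    qed (use k in auto)
    moreover have "\<exists>l. T = tri l \<and> active b l \<and> (k, l) \<in> links\<^sup>*"
      if "(tri k, T) \<in> (triangle_link (top_of_set Y))\<^sup>*" for T
      using that
    proof induction
      case (step T T')
      then obtain l where l: "T = tri l" "active b l" "(k, l) \<in> links\<^sup>*" by blast
      obtain m where m: "T' = tri m" "active b m"
        using step(2) triangle_iff by (auto simp: triangle_link_def)
      then have "(l, m) \<in> links" using triangle_link_iff[OF l(2) m(2)] step(2) l(1) by (auto simp: links_def)
      then have "(k, m) \<in> links\<^sup>*" using l(3) by (rule rtrancl.rtrancl_into_rtrancl[rotated])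
      then show ?case using m by blast
    qed (use k in auto)
    ultimately have "(triangle_link (top_of_set Y))\<^sup>* `` {tri k} = tri ` (links\<^sup>* `` {k})" by blast
    moreover have "inj_on tri (links\<^sup>* `` {k})"
      by (auto intro!: inj_onI tri_inj)
    ultimately show ?thesis by (simp add: card_image)
  qed
  then show ?thesis unfolding chain_sizes_def triangle_iff by (metis (lifting))
qed

end

section \<open>Continuum many cones\<close>

text \<open>The sequence of \<open>A\<close> has a maximal run of exactly \<open>n + 1\<close> ones for each \<open>n \<in> A\<close>; the squares
  keep different runs apart.\<close>

definition run_sequence :: "nat set \<Rightarrow> int \<Rightarrow> nat" where
  "run_sequence A k = (if \<exists>n\<in>A. (int n + 1)\<^sup>2 \<le> k \<and> k \<le> (int n + 1)\<^sup>2 + int n then 1 else 0)"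

text \<open>The levels touched by the run belonging to \<open>n\<close>. There is one level more
  than there are bridges, hence the upper end exceeds that in \<open>run_sequence\<close> by
  1.\<close>

definition block :: "nat \<Rightarrow> int set" where
  "block n = {(int n + 1)\<^sup>2..(int n + 1)\<^sup>2 + int n + 1}"

text \<open>The next square is \<open>2 * n + 3\<close> further on, whereas the block ends
  \<open>n + 1\<close> after its start.\<close>

lemma block_disjoint:
  assumes "k \<in> block n" "k \<in> block m"
  shows "n = m"
proof -
  have "\<not> n < m" if "k \<in> block n" "k \<in> block m" for n m
  proof
    assume "n < m"
    then have "(int n + 2)\<^sup>2 \<le> (int m + 1)\<^sup>2" by (intro power_mono) auto
    then show False using that by (simp add: block_def power2_eq_square algebra_simps)
  qed
  then show ?thesis using assms by (meson linorder_neqE_nat)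
qed

lemma run_sequence_eq_1_iff: "run_sequence A k = 1 \<longleftrightarrow> (\<exists>n\<in>A. k \<in> block n \<and> k + 1 \<in> block n)"
  by (auto simp: run_sequence_def block_def)

lemma active_run_sequence: "active (run_sequence A) k \<longleftrightarrow> (\<exists>n\<in>A. k \<in> block n)"
proof
  show "active (run_sequence A) k \<Longrightarrow> \<exists>n\<in>A. k \<in> block n"
    by (auto simp only: active_def run_sequence_eq_1_iff) auto
next
  assume "\<exists>n\<in>A. k \<in> block n"
  then obtain n where n: "n \<in> A" "k \<in> block n" by blast
  then have "k \<in> block n \<and> k + 1 \<in> block n \<or> k - 1 \<in> block n \<and> k - 1 + 1 \<in> block n"
    by (auto simp: block_def)
  then show "active (run_sequence A) k"
    unfolding active_def run_sequence_eq_1_iff using n(1) by blast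
qed

text \<open>A link stays within one block and moves by one level, so no component leaves its block.
  Conversely the first level of the block reaches every other, and symmetry of \<open>links\<close>
  moves the starting point to \<open>k\<close>.\<close>

lemma links_component:
  assumes "bullseye_space s t" "n \<in> A" "k \<in> block n"
  shows "(bullseye_space.links (run_sequence A))\<^sup>* `` {k} = block n"
proof -
  interpret bullseye_space s t "run_sequence A" by fact
  have link: "(j, l) \<in> links \<longleftrightarrow>
      (\<exists>m\<in>A. j \<in> block m \<and> l \<in> block m) \<and> (l = j + 1 \<or> j = l + 1)" for j l
    unfolding links_def run_sequence_eq_1_iff by auto
  have "l \<in> block n" if "(k, l) \<in> links\<^sup>*" for l
    using that
  proof induction
    case (step l m)
    then show ?case using block_disjoint unfolding link by blast
  qed fact
  moreover have "(k, l) \<in> links\<^sup>*" if l: "l \<in> block n" for l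
  proof -
    let ?p = "(int n + 1)\<^sup>2"
    have reach: "(?p, ?p + int i) \<in> links\<^sup>*" if "i \<le> n + 1" for i
      using that
    proof (induction i)
      case (Suc i)
      then have "?p + int i \<in> block n" "?p + int (Suc i) \<in> block n" by (auto simp: block_def)
      then have "(?p + int i, ?p + int (Suc i)) \<in> links"
        using assms(2) unfolding link by auto
      then show ?case using Suc by (auto intro: rtrancl.rtrancl_into_rtrancl)
    qed simp
    have "(?p, j) \<in> links\<^sup>*" if "j \<in> block n" for j
      using reach[of "nat (j - ?p)"] that by (auto simp: block_def)
    moreover have "sym links" unfolding sym_def link by blast
    then have "sym (links\<^sup>*)" by (rule sym_rtrancl)
    ultimately show ?thesis using assms(3) l by (meson rtrancl_trans symD)
  qed
  ultimately show ?thesis by auto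
qed

lemma chain_sizes_run_sequence:
  assumes "1 < s" "s < t" "t < 2"
  shows "chain_sizes (top_of_set (bullseye s t (run_sequence A))) = (\<lambda>n. n + 2) ` A"
proof -
  interpret bullseye_space s t "run_sequence A" by unfold_locales fact+
  have card: "card (links\<^sup>* `` {k}) = n + 2" if "n \<in> A" "k \<in> block n" for n k
    using links_component[OF bullseye_space_axioms that] by (simp add: block_def)
  have "(int n + 1)\<^sup>2 \<in> block n" for n by (simp add: block_def)
  then show ?thesis
    unfolding chain_sizes_bullseye active_run_sequence using card by (auto simp: image_iff) metis+
qed

text \<open>The growing windows make every fixed index agree from some \<open>n\<close> on, and
  \<open>n \<le> m n\<close> makes the scaling factors diverge.\<close>

lemma rich_occurrences:
  assumes "rich a" "range b \<subseteq> {0, 1}"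
  shows "\<exists>m::nat \<Rightarrow> nat. \<forall>n. n \<le> m n \<and> (\<forall>k. \<bar>k\<bar> \<le> int n \<longrightarrow> a (k + int (m n)) = b k)"
proof -
  have "\<exists>m\<ge>n. \<forall>k. \<bar>k\<bar> \<le> int n \<longrightarrow> a (k + int m) = b k" for n :: nat
  proof -
    \<comment> \<open>The values of \<open>b\<close> on the window from \<open>-n\<close> to
      \<open>n\<close>, preceded by \<open>n\<close> zeros: an occurrence of \<open>w\<close> at
      \<open>m\<close> places index 0 of \<open>b\<close> at position \<open>m + 2 * n\<close>,
      which is at least \<open>n\<close>.\<close>
    define w where "w = replicate n 0 @ map (\<lambda>i. b (int i - int n)) [0..<2 * n + 1]"
    have "set w \<subseteq> {0, 1}" using assms(2) by (auto simp: w_def image_subset_iff)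
    from assms(1)[unfolded rich_def, rule_format, OF this] obtain m
      where m: "\<forall>i<length w. a (int m + int i) = w ! i" ..
    have "a (k + int (m + 2 * n)) = b k" if "\<bar>k\<bar> \<le> int n" for k
    proof -
      let ?i = "nat (k + int n)"
      have i: "int ?i = k + int n" "?i < 2 * n + 1" using that by auto
      then have "a (int m + int (n + ?i)) = w ! (n + ?i)" by (intro m[rule_format]) (simp add: w_def)
      also have "w ! (n + ?i) = b (int ?i - int n)"
        using i(2) by (simp add: w_def nth_append del: upt_Suc)
      finally show ?thesis using i(1) by (simp add: algebra_simps)
    qed
    then show ?thesis by (intro exI[of _ "m + 2 * n"]) auto
  qed
  then have "\<forall>n. \<exists>m. n \<le> m \<and> (\<forall>k. \<bar>k\<bar> \<le> int n \<longrightarrow> a (k + int m) = b k)" by blast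
  then show ?thesis by (rule choice)
qed

text \<open>If the complement of a point \<open>x\<close> were not in the ultrafilter, then
  \<open>{x}\<close> would be and the filter would be principal. So finitely many values can always
  be discarded.\<close>

lemma nonprincipal_ultrafilter_eventually_ge:
  fixes N :: nat
  assumes "nonprincipal_ultrafilter \<mu>"
  shows "eventually (\<lambda>n. N \<le> n) \<mu>"
proof -
  have ultra: "ultrafilter \<mu>" and np: "\<And>x. \<mu> \<noteq> principal {x}"
    using assms by (auto simp: nonprincipal_ultrafilter_def)
  have "eventually (\<lambda>n. n \<noteq> x) \<mu>" for x
  proof (rule ccontr)
    assume "\<not> eventually (\<lambda>n. n \<noteq> x) \<mu>"
    then have x: "eventually (\<lambda>n. n = x) \<mu>" using ultra by (auto simp: ultrafilter_def)
    have "eventually P \<mu> \<longleftrightarrow> P x" for P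
    proof
      assume "eventually P \<mu>"
      then have "eventually (\<lambda>_. P x) \<mu>" using x by eventually_elim simp
      then show "P x" using ultra by (simp add: ultrafilter_def)
    next
      assume "P x"
      show "eventually P \<mu>" using x by eventually_elim (use \<open>P x\<close> in simp)
    qed
    then have "\<mu> = principal {x}" by (auto simp: filter_eq_iff eventually_principal)
    then show False using np by blast
  qed
  then have "eventually (\<lambda>n. \<forall>x\<in>{..<N}. n \<noteq> x) \<mu>" by (simp add: eventually_ball_finite)
  then show ?thesis by eventually_elim (use linorder_not_le in blast)
qed

theorem proposition4p2:
  fixes s t :: real and a :: "int \<Rightarrow> nat" and X :: "R4 set" and e :: R4 and \<mu> :: "nat filter"
  assumes "1 < s" and "s < t" and "t < 2"
    and "range a \<subseteq> {0, 1}"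
    and "rich a"
    and "X = bullseye s t a"
    and "e = bullseye_basepoint"
    and "nonprincipal_ultrafilter \<mu>"
  shows "\<exists>\<S> :: (nat \<Rightarrow> real) set.
           (\<forall>\<alpha>\<in>\<S>. scaling_factor \<alpha>) \<and>
           \<S> \<approx> (UNIV :: nat set set) \<and>
           (\<forall>\<alpha>\<in>\<S>. \<forall>\<alpha>'\<in>\<S>. \<alpha> \<noteq> \<alpha>' \<longrightarrow>
              \<not> cone_topology \<mu> X (path_metric X) e \<alpha>
                  homeomorphic_space cone_topology \<mu> X (path_metric X) e \<alpha>')"
proof -
  have "\<forall>A. \<exists>m::nat \<Rightarrow> nat. \<forall>n. n \<le> m n \<and> (\<forall>k. \<bar>k\<bar> \<le> int n \<longrightarrow> a (k + int (m n)) = run_sequence A k)"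
    by (intro allI rich_occurrences assms) (auto simp: run_sequence_def)
  then obtain m :: "nat set \<Rightarrow> nat \<Rightarrow> nat" where m: "\<And>A n. n \<le> m A n"
    "\<And>A n k. \<bar>k\<bar> \<le> int n \<Longrightarrow> a (k + int (m A n)) = run_sequence A k"
    by metis
  define \<alpha> :: "nat set \<Rightarrow> nat \<Rightarrow> real" where "\<alpha> A = (\<lambda>n. 2 powi int (m A n))" for A
  have e: "e = 0" by (simp add: assms(7) bullseye_basepoint_def zero_prod_def)
  let ?cone = "\<lambda>\<alpha>. cone_topology \<mu> X (path_metric X) e \<alpha>"
  have cone: "?cone (\<alpha> A) homeomorphic_space top_of_set (bullseye s t (run_sequence A))" for A
  proof -
    have "bullseye_cone s t a (run_sequence A) \<mu> (\<lambda>n. int (m A n))"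
    proof
      show "ultrafilter \<mu>" using assms(8) by (simp add: nonprincipal_ultrafilter_def)
      fix k
      show "eventually (\<lambda>n. a (k + int (m A n)) = run_sequence A k) \<mu>"
        using nonprincipal_ultrafilter_eventually_ge[OF assms(8), of "nat \<bar>k\<bar>"]
        by eventually_elim (use m(2) in simp)
    qed (use assms in auto)
    then show ?thesis
      unfolding \<alpha>_def e assms(6) by (rule bullseye_cone.cone_homeomorphic)
  qed
  have sizes: "chain_sizes (?cone (\<alpha> A)) = (\<lambda>n. n + 2) ` A" for A
    using chain_sizes_homeomorphic[OF cone] chain_sizes_run_sequence[OF assms(1-3)] by simp
  have image: "A = B" if "(\<lambda>n::nat. n + 2) ` A = (\<lambda>n. n + 2) ` B" for A B
    using that by (simp add: inj_image_eq_iff inj_def)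
  \<comment> \<open>The sets are recovered from the cones themselves: equal scaling factors have the
    same cone, hence the same \<open>chain_sizes\<close>.\<close>
  have inj: "inj \<alpha>"
  proof (rule injI)
    fix A B assume "\<alpha> A = \<alpha> B"
    then have "chain_sizes (?cone (\<alpha> A)) = chain_sizes (?cone (\<alpha> B))" by (simp only:)
    then show "A = B" unfolding sizes by (rule image)
  qed
  have "scaling_factor (\<alpha> A)" for A
    unfolding scaling_factor_def
  proof (intro conjI allI)
    show "0 < \<alpha> A n" for n by (simp add: \<alpha>_def)
    have "real n \<le> \<alpha> A n" for n
    proof -
      have "real n \<le> 2 ^ n" by (simp add: less_imp_le)
      also have "\<dots> \<le> 2 ^ m A n" using m(1) by (intro power_increasing) auto
      finally show ?thesis by (simp add: \<alpha>_def)
    qed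
    then show "filterlim (\<alpha> A) at_top sequentially"
      by (intro filterlim_at_top_mono[OF filterlim_real_sequentially]) auto
  qed
  moreover have "range \<alpha> \<approx> (UNIV :: nat set set)"
    using inj_on_image_eqpoll_self[OF inj] by simp
  moreover have "\<not> ?cone (\<alpha> A) homeomorphic_space ?cone (\<alpha> B)" if "\<alpha> A \<noteq> \<alpha> B" for A B
  proof
    assume "?cone (\<alpha> A) homeomorphic_space ?cone (\<alpha> B)"
    then have "chain_sizes (?cone (\<alpha> A)) = chain_sizes (?cone (\<alpha> B))" by (rule chain_sizes_homeomorphic)
    then have "A = B" unfolding sizes by (rule image)
    then show False using that by simp
  qed
  ultimately show ?thesis by (intro exI[of _ "range \<alpha>"]) blast
qed

end
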